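(* Let $k=k(n)$ satisfy $1\ll k\ll\log n$ as $n\to\infty$, and consider either the simple or the directed random walk. For all $\alpha\in\mathbb{R}$, as $n\to\infty$, $$\mathbb{P}\bigl(Q(t_\alpha)\le \log n+\omega\bigr)\to\Psi(\alpha)\quad\text{and}\quad \mathbb{P}\bigl(Q(t_\alpha)\le \log n-\omega\bigr)\to\Psi(\alpha),$$ where $\omega := \mathrm{Var}(Q(t_0))^{1/4} = (vk)^{1/4}$.
   Context: Asymptotic notation is as $n\to\infty$ with $k=k(n)$: $a\ll b$ means $a/b\to0$. Logarithms are natural. $\Psi(\alpha) := \int_\alpha^\infty (2\pi)^{-1/2} e^{-x^2/2}\,dx$ is the standard Gaussian tail. The rate-1 simple random walk on $\mathbb{Z}^k$ jumps at rate 1; at each jump it chooses a coordinate uniformly at random and adds $+1$ or $-1$ to it with probability $1/2$ each. The directed random walk is the same but always adds $+1$. Both start from $0$. Let $W=(W_1(t),\dots,W_k(t))_{t\ge0}$ be one of these walks; each $W_i$ is a rate-$1/k$ walk on $\mathbb{Z}$. Let $\nu_s$ be the law of $W_1(sk)$ and let $\mu_t=\nu_{t/k}^{\otimes k}$ be the law of $W(t)$. Define $Q_i(t) := -\log\nu_{t/k}(W_i(t))$ and $Q(t) := -\log\mu_t(W(t)) = \sum_{i=1}^k Q_i(t)$. For $\alpha\in\mathbb{R}$, $t_\alpha=t_\alpha(k,n)$ is defined by $$\mathbb{E}(Q_1(t_\alpha)) = \bigl(\log n+\alpha\sqrt{vk}\bigr)/k,\qquad v:=\mathrm{Var}(Q_1(t_0)),$$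 where $t_0$ is given by $\mathbb{E}(Q_1(t_0))=(\log n)/k$. *)

theory Defs
  imports "HOL-Probability.Probability" "HOL-Library.Landau_Symbols"
begin

datatype walk_kind = Simple | Directed

fun increments :: "walk_kind \<Rightarrow> int set" where
  "increments Simple = {-1, 1}"
| "increments Directed = {1}"

definition jump_pmf :: "walk_kind \<Rightarrow> nat \<Rightarrow> (nat \<times> int) pmf" where
  "jump_pmf w k = pair_pmf (pmf_of_set {..<k}) (pmf_of_set (increments w))"

text \<open>
  A sample point lists, for each \<open>j\<close>, the waiting time before the \<open>j\<close>-th jump together with the
  coordinate chosen and the increment added at that jump. All of these are independent, and
  the waiting times are exponential with parameter 1.
\<close>

definition walk_space :: "walk_kind \<Rightarrow> nat \<Rightarrow> (nat \<Rightarrow> real \<times> nat \<times> int) measure" where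
  "walk_space w k =
     (\<Pi>\<^sub>M j\<in>UNIV. density lborel (exponential_density 1) \<Otimes>\<^sub>M measure_pmf (jump_pmf w k))"

definition jump_time :: "(nat \<Rightarrow> real \<times> nat \<times> int) \<Rightarrow> nat \<Rightarrow> real" where
  "jump_time \<omega> j = (\<Sum>l\<le>j. fst (\<omega> l))"

text \<open>
  The position at time \<open>t\<close>, as an element of \<open>{..<k} \<rightarrow>\<^sub>E \<int>\<close>. Coordinates are numbered from 0, so
  \<open>W\<^sub>1\<close> is coordinate \<open>0\<close>. Almost surely only finitely many jumps occur up to time \<open>t\<close>, so the
  default value of an infinite sum plays no role.
\<close>

definition walk :: "nat \<Rightarrow> real \<Rightarrow> (nat \<Rightarrow> real \<times> nat \<times> int) \<Rightarrow> nat \<Rightarrow> int" where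
  "walk k t \<omega> = (\<lambda>i\<in>{..<k}.
     \<Sum>j | jump_time \<omega> j \<le> t \<and> fst (snd (\<omega> j)) = i. snd (snd (\<omega> j)))"

definition nu :: "walk_kind \<Rightarrow> nat \<Rightarrow> real \<Rightarrow> int measure" where
  "nu w k s = distr (walk_space w k) (count_space UNIV) (\<lambda>\<omega>. walk k (s * real k) \<omega> 0)"

definition mu :: "walk_kind \<Rightarrow> nat \<Rightarrow> real \<Rightarrow> (nat \<Rightarrow> int) measure" where
  "mu w k t = distr (walk_space w k) (\<Pi>\<^sub>M i\<in>{..<k}. count_space UNIV) (walk k t)"

definition Q_coord ::
  "walk_kind \<Rightarrow> nat \<Rightarrow> nat \<Rightarrow> real \<Rightarrow> (nat \<Rightarrow> real \<times> nat \<times> int) \<Rightarrow> real" where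
  "Q_coord w k i t \<omega> = - ln (measure (nu w k (t / real k)) {walk k t \<omega> i})"

definition Q_total ::
  "walk_kind \<Rightarrow> nat \<Rightarrow> real \<Rightarrow> (nat \<Rightarrow> real \<times> nat \<times> int) \<Rightarrow> real" where
  "Q_total w k t \<omega> = - ln (measure (mu w k t) {walk k t \<omega>})"

text \<open>
  The time at which \<open>E(Q\<^sub>1(t)) = h\<close>. This expectation is the entropy of \<open>W\<^sub>1(t)\<close>, which for
  \<open>k > 0\<close> increases continuously and strictly from 0 to infinity on \<open>t \<ge> 0\<close>; so the solution exists
  and is unique for every \<open>h \<ge> 0\<close>. For \<open>h < 0\<close> the value is unspecified; this concerns only
  finitely many \<open>n\<close> for the right-hand sides used below.
\<close>

definition entropy_time :: "walk_kind \<Rightarrow> nat \<Rightarrow> real \<Rightarrow> real" where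
  "entropy_time w k h =
     (SOME t. 0 \<le> t \<and> prob_space.expectation (walk_space w k) (Q_coord w k 0 t) = h)"

definition t_zero :: "walk_kind \<Rightarrow> nat \<Rightarrow> nat \<Rightarrow> real" where
  "t_zero w k n = entropy_time w k (ln (real n) / real k)"

definition var_coord :: "walk_kind \<Rightarrow> nat \<Rightarrow> nat \<Rightarrow> real" where
  "var_coord w k n =
     prob_space.variance (walk_space w k) (Q_coord w k 0 (t_zero w k n))"

definition t_alpha :: "walk_kind \<Rightarrow> nat \<Rightarrow> nat \<Rightarrow> real \<Rightarrow> real" where
  "t_alpha w k n \<alpha> =
     entropy_time w k ((ln (real n) + \<alpha> * sqrt (var_coord w k n * real k)) / real k)"

definition window :: "walk_kind \<Rightarrow> nat \<Rightarrow> nat \<Rightarrow> real" where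
  "window w k n =
     prob_space.variance (walk_space w k) (Q_total w k (t_zero w k n)) powr (1/4)"

definition Psi :: "real \<Rightarrow> real" where
  "Psi \<alpha> = (LINT x:{\<alpha>..}|lborel. std_normal_density x)"

end

theory Submission
  imports Defs "HOL-Real_Asymp.Real_Asymp"
begin

text \<open>
  Given independence of the coordinates, \<open>Q(t)\<close> is almost surely the sum of the \<open>k\<close> independent,
  identically distributed surprisals \<open>Q\<^sub>i(t)\<close>, whose law depends only on the time \<open>s = t/k\<close> seen by
  one coordinate. The time \<open>t\<^sub>\<alpha>\<close> is chosen so that \<open>Q(t\<^sub>\<alpha>)\<close> has mean \<open>ln n + \<alpha> sqrt (v k)\<close>, so that
  \<open>Q(t\<^sub>\<alpha>) \<le> ln n\<close> asks the sum to lie \<open>\<alpha> sqrt (v k)\<close> below its mean. A central limit theorem then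
  gives the limit \<open>\<Psi>(\<alpha>)\<close>, provided that the variance of one surprisal at \<open>t\<^sub>\<alpha>\<close> is asymptotically
  \<open>v\<close>; and a shift by \<open>\<omega> = (v k) powr (1/4)\<close> is negligible on the scale \<open>sqrt (v k)\<close>.

  The work is in controlling the surprisal of one coordinate as \<open>s\<close> tends to infinity, which is
  forced by \<open>k \<lless> ln n\<close> (lemma \<open>entropy_at_topD\<close>). The point masses of one coordinate are given by
  a Fourier integral, \<open>lattice_mass\<close>, in which the two walks differ only in the parameter \<open>drift\<close>.
  Rescaled to a density on the line, they converge pointwise to the Gaussian density
  (\<open>rescaled_mass_tendsto\<close>) and, after two integrations by parts in the Fourier integral, are bounded by
  a constant times \<open>(1 + \<bar>y\<bar>) powr (-2)\<close> uniformly in \<open>s \<ge> 1\<close> (\<open>rescaled_mass_bound\<close>). For a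
  function \<open>f\<close> with such a bound, \<open>f \<bar>ln f\<bar>\<^sup>j\<close> is at most a constant times
  \<open>(1 + \<bar>y\<bar>) powr (-3/2)\<close>, so dominated convergence gives the limits of the first
  four moments of the logarithm of the rescaled mass (\<open>log_moment_tendsto\<close>). Hence the entropy is
  \<open>ln s / 2\<close> plus a convergent term, the variance of one surprisal tends to that of half the square of
  a standard Gaussian, namely \<open>1/2\<close>, and the third absolute moments stay bounded, which is what the
  central limit theorem for arrays (\<open>clt_array\<close>) requires.

  The exact law of the walk (\<open>prob_walk_coords\<close>) comes from the characteristic function of the whole
  vector, \<open>integral_iexp_walk\<close>: conditioning on the number of jumps, which is Poisson, turns it into
  the exponential of a sum over coordinates, hence into a product. Fourier inversion over a
  product of circles then yields the independence of the coordinates and their common law at once.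
\<close>

section \<open>The sample space of waiting times and marks\<close>

abbreviation step_law :: "walk_kind \<Rightarrow> nat \<Rightarrow> (real \<times> nat \<times> int) measure" where
  "step_law w k \<equiv> density lborel (exponential_density 1) \<Otimes>\<^sub>M measure_pmf (jump_pmf w k)"

lemma prob_space_step_law: "prob_space (step_law w k)"
  by (intro prob_space_pair prob_space_exponential_density measure_pmf.prob_space_axioms) simp

lemma prob_space_walk_space: "prob_space (walk_space w k)"
  unfolding walk_space_def by (intro prob_space_PiM prob_space_step_law)

lemma space_walk_space [simp]: "space (walk_space w k) = UNIV"
  unfolding walk_space_def by (auto simp: space_PiM space_pair_measure)

lemma measurable_waiting_time [measurable]: "(\<lambda>\<omega>. fst (\<omega> j)) \<in> borel_measurable (walk_space w k)"
proof -
  have "(\<lambda>\<omega>. \<omega> j) \<in> measurable (walk_space w k) (step_law w k)"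
    unfolding walk_space_def by measurable
  moreover have "fst \<in> measurable (step_law w k) borel"
    by (rule measurable_compose[OF measurable_fst]) simp
  ultimately show ?thesis by (rule measurable_compose)
qed

lemma measurable_mark: "(\<lambda>\<omega>. c (snd (\<omega> j))) \<in> measurable (walk_space w k) N"
  if "range c \<subseteq> space N"
proof -
  have "(\<lambda>\<omega>. \<omega> j) \<in> measurable (walk_space w k) (step_law w k)"
    unfolding walk_space_def by measurable
  moreover have "(\<lambda>s. c (snd s)) \<in> measurable (step_law w k) N"
    by (rule measurable_compose[OF measurable_snd]) (use that in auto)
  ultimately show ?thesis by (rule measurable_compose)
qed

lemma measurable_jump_time [measurable]:
  "(\<lambda>\<omega>. jump_time \<omega> j) \<in> borel_measurable (walk_space w k)"
  unfolding jump_time_def by measurable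

text \<open>
  The condition concerns all indices, not only \<open>m - 1\<close> and \<open>m\<close>, because the jump times are increasing
  only almost surely. In this form the first-step recursion \<open>exactly_jumps_case_nat\<close> holds surely.
\<close>

definition exactly_jumps :: "nat \<Rightarrow> real \<Rightarrow> (nat \<Rightarrow> real \<times> nat \<times> int) \<Rightarrow> bool" where
  "exactly_jumps m t \<omega> \<longleftrightarrow> (\<forall>j<m. jump_time \<omega> j \<le> t) \<and> (\<forall>j\<ge>m. t < jump_time \<omega> j)"

lemma measurable_exactly_jumps [measurable]:
  "Measurable.pred (walk_space w k) (exactly_jumps m t)"
  unfolding exactly_jumps_def[abs_def] by measurable

text \<open>
  Prepending a step to the sample point delays all later jumps by its waiting time. The facts about
  \<open>case_nat\<close> express the renewal structure of the jump times and allow induction on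
  the number of jumps without any independence argument beyond the invariance of the
  sequence space under prepending a sample.
\<close>

lemma jump_time_case_nat:
  "jump_time (case_nat s \<omega>) 0 = fst s"
  "jump_time (case_nat s \<omega>) (Suc j) = fst s + jump_time \<omega> j"
proof -
  have "{..Suc j} = insert 0 (Suc ` {..j})"
    by (rule atMost_Suc_eq_insert_0)
  then show "jump_time (case_nat s \<omega>) (Suc j) = fst s + jump_time \<omega> j"
    by (simp add: jump_time_def sum.reindex)
qed (simp add: jump_time_def)

lemma exactly_jumps_case_nat:
  "exactly_jumps (Suc m) t (case_nat s \<omega>) \<longleftrightarrow> fst s \<le> t \<and> exactly_jumps m (t - fst s) \<omega>"
proof -
  have less: "(\<forall>j<Suc m. P j) \<longleftrightarrow> P 0 \<and> (\<forall>j<m. P (Suc j))" for P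
    using less_Suc_eq_0_disj by auto
  have ge: "(\<forall>j\<ge>Suc m. P j) \<longleftrightarrow> (\<forall>j\<ge>m. P (Suc j))" for P
    by (metis Suc_le_D Suc_le_mono)
  show ?thesis
    unfolding exactly_jumps_def less ge jump_time_case_nat
    by (auto simp: algebra_simps)
qed

lemma AE_step_nonneg: "AE s in step_law w k. 0 \<le> fst s"
proof -
  interpret D: prob_space "density lborel (exponential_density 1)"
    by (rule prob_space_exponential_density) simp
  interpret J: prob_space "measure_pmf (jump_pmf w k)" by (rule measure_pmf.prob_space_axioms)
  interpret DJ: pair_prob_space "density lborel (exponential_density 1)" "measure_pmf (jump_pmf w k)" ..
  have "AE x in density lborel (exponential_density 1). 0 \<le> (x :: real)"
    by (subst AE_density) (auto simp: exponential_density_def)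
  then have "AE x in density lborel (exponential_density 1).
      AE y in measure_pmf (jump_pmf w k). 0 \<le> fst (x, y)"
    by eventually_elim simp
  then show ?thesis
    by (subst DJ.AE_pair_iff[symmetric]) auto
qed

lemma AE_waiting_times_nonneg: "AE \<omega> in walk_space w k. \<forall>j. 0 \<le> fst (\<omega> j)"
proof -
  have "AE \<omega> in walk_space w k. 0 \<le> fst (\<omega> j)" for j
    unfolding walk_space_def
    by (rule AE_PiM_component[OF prob_space_step_law, where P = "\<lambda>s. 0 \<le> fst s"])
       (simp_all add: AE_step_nonneg)
  then show ?thesis
    by (simp add: AE_all_countable)
qed

lemma integral_exponential_poisson:
  assumes "0 \<le> t"
  shows "(LINT x|density lborel (exponential_density 1).
            (if x \<le> t then exp (-(t - x)) * (t - x) ^ m / fact m else 0))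
         = exp (- t) * t ^ Suc m / fact (Suc m)"
proof -
  let ?F = "\<lambda>x. - exp (- t) * (t - x) ^ Suc m / fact (Suc m)"
  have "(LINT x|density lborel (exponential_density 1).
            (if x \<le> t then exp (-(t - x)) * (t - x) ^ m / fact m else 0))
      = (LINT x|lborel. exponential_density 1 x *\<^sub>R
            (if x \<le> t then exp (-(t - x)) * (t - x) ^ m / fact m else 0))"
    by (rule integral_density) (auto simp: exponential_density_def)
  also have "\<dots> = (LINT x|lborel. indicator {0..t} x *\<^sub>R (exp (- t) * (t - x) ^ m / fact m))"
    by (rule Bochner_Integration.integral_cong)
       (auto simp: exponential_density_def exp_diff exp_minus field_simps indicator_def)
  also have "\<dots> = ?F t - ?F 0"
  proof (rule integral_FTC_Icc[OF assms])
    fix x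
    have "((\<lambda>x. (t - x) ^ Suc m) has_real_derivative - ((1 + real m) * (t - x) ^ m)) (at x within {0..t})"
      by (rule derivative_eq_intros refl)+ simp
    then have "(?F has_real_derivative
        - exp (- t) * - ((1 + real m) * (t - x) ^ m) / fact (Suc m)) (at x within {0..t})"
      by (intro DERIV_cdivide DERIV_cmult)
    moreover have "- exp (- t) * - ((1 + real m) * (t - x) ^ m) / fact (Suc m)
        = exp (- t) * (t - x) ^ m / fact m"
      by (simp add: divide_simps) (simp add: algebra_simps)?
    ultimately show "(?F has_vector_derivative exp (- t) * (t - x) ^ m / fact m) (at x within {0..t})"
      unfolding has_real_derivative_iff_has_vector_derivative[symmetric] by simp
  qed (auto intro!: continuous_intros)
  finally show ?thesis by simp
qed

text \<open>
  No jump up to time \<open>t\<close> means that the first waiting time exceeds \<open>t\<close>, once the null set on which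
  some waiting time is negative is discarded.
\<close>

lemma prob_no_jumps:
  assumes "0 \<le> t"
  shows "(LINT \<omega>|walk_space w k. (if exactly_jumps 0 t \<omega> then 1 else 0 :: complex)) = exp (- t)"
proof -
  interpret W: prob_space "walk_space w k" by (rule prob_space_walk_space)
  interpret D: prob_space "density lborel (exponential_density 1)"
    by (rule prob_space_exponential_density) simp
  interpret J: prob_space "measure_pmf (jump_pmf w k)" by (rule measure_pmf.prob_space_axioms)
  have "(LINT \<omega>|walk_space w k. (if exactly_jumps 0 t \<omega> then 1 else 0 :: complex))
      = (LINT \<omega>|walk_space w k. (if t < fst (\<omega> 0) then 1 else 0))"
  proof (rule integral_cong_AE)
    have "exactly_jumps 0 t \<omega> \<longleftrightarrow> t < fst (\<omega> 0)" if "\<forall>j. 0 \<le> fst (\<omega> j)" for \<omega>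
    proof -
      have "fst (\<omega> 0) \<le> jump_time \<omega> j" for j
        unfolding jump_time_def using that by (intro member_le_sum) auto
      moreover have "jump_time \<omega> 0 = fst (\<omega> 0)" by (simp add: jump_time_def)
      ultimately show ?thesis
        unfolding exactly_jumps_def by (metis less_le_trans not_less_zero zero_le)
    qed
    then show "AE \<omega> in walk_space w k.
      (if exactly_jumps 0 t \<omega> then 1 else 0 :: complex) = (if t < fst (\<omega> 0) then 1 else 0)"
      using AE_waiting_times_nonneg[of w k] by (auto elim!: eventually_mono)
  qed measurable
  also have "\<dots> = (LINT s|step_law w k. (if t < fst s then 1 else 0))"
  proof -
    have "distr (walk_space w k) (step_law w k) (\<lambda>\<omega>. \<omega> 0) = step_law w k"
      unfolding walk_space_def by (rule distr_PiM_component[OF prob_space_step_law]) simp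
    moreover have "(LINT s|distr (walk_space w k) (step_law w k) (\<lambda>\<omega>. \<omega> 0).
        (if t < fst s then 1 else 0 :: complex))
      = (LINT \<omega>|walk_space w k. (if t < fst (\<omega> 0) then 1 else 0))"
      by (rule integral_distr) (simp_all add: walk_space_def)
    ultimately show ?thesis by simp
  qed
  also have "\<dots> = (LINT x|distr (step_law w k) (density lborel (exponential_density 1)) fst.
      (if t < x then 1 else 0))"
    by (rule integral_distr[symmetric]) measurable
  also have "distr (step_law w k) (density lborel (exponential_density 1)) fst
      = density lborel (exponential_density 1)"
    by (rule prob_space.distr_pair_fst[OF measure_pmf.prob_space_axioms])
  also have "(LINT x|density lborel (exponential_density 1). (if t < x then 1 else 0 :: complex))
      = (LINT x|density lborel (exponential_density 1). complex_of_real (indicator {t<..} x))"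
    by (rule Bochner_Integration.integral_cong) (auto simp: indicator_def)
  also have "\<dots> = complex_of_real (measure (density lborel (exponential_density 1)) {t<..})"
    by simp
  also have "measure (density lborel (exponential_density 1)) {t<..} = exp (- t)"
  proof -
    have "distributed (density lborel (exponential_density 1)) lborel (\<lambda>x. x) (exponential_density 1)"
      unfolding distributed_def by (auto intro!: distr_id2)
    from D.exponential_distributedD_gt[OF this assms zero_less_one] show ?thesis
      by (simp add: greaterThan_def)
  qed
  finally show ?thesis by (simp add: exp_of_real)
qed

text \<open>
  The number of jumps up to time \<open>t\<close> is Poisson and independent of the marks. Stated with a
  multiplicative function \<open>c\<close> of the marks, this is exactly what the characteristic function needs, and
  it is stable under first-step analysis: the first step contributes one factor and leaves
  a problem with one jump less and a time shortened by the first wait.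
\<close>

lemma integral_exactly_jumps:
  fixes c :: "nat \<times> int \<Rightarrow> complex"
  assumes c: "\<And>x. norm (c x) \<le> 1" and t: "0 \<le> t"
  shows "(LINT \<omega>|walk_space w k. (if exactly_jumps m t \<omega> then \<Prod>j<m. c (snd (\<omega> j)) else 0))
       = complex_of_real (exp (- t) * t ^ m / fact m) * (LINT x|measure_pmf (jump_pmf w k). c x) ^ m"
  using t
proof (induction m arbitrary: t)
  case 0
  then show ?case using prob_no_jumps[of t w k] by (simp cong: if_cong)
next
  case (Suc m)
  let ?G = "\<lambda>m t \<omega>. if exactly_jumps m t \<omega> then \<Prod>j<m. c (snd (\<omega> j)) else 0"
  let ?phi = "LINT x|measure_pmf (jump_pmf w k). c x"
  interpret W: prob_space "walk_space w k" by (rule prob_space_walk_space)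
  interpret M: prob_space "step_law w k" by (rule prob_space_step_law)
  interpret D: prob_space "density lborel (exponential_density 1)"
    by (rule prob_space_exponential_density) simp
  interpret J: prob_space "measure_pmf (jump_pmf w k)" by (rule measure_pmf.prob_space_axioms)
  interpret MS: pair_prob_space "step_law w k" "walk_space w k" ..
  interpret DJ: pair_prob_space "density lborel (exponential_density 1)" "measure_pmf (jump_pmf w k)" ..
  interpret Seq: sequence_space "step_law w k" ..
  have c_meas: "(\<lambda>\<omega>. c (snd (\<omega> j))) \<in> borel_measurable (walk_space w k)" for j
    by (rule measurable_mark) simp
  have c_meas2: "(\<lambda>s. c (snd s)) \<in> borel_measurable (step_law w k)"
    by (rule measurable_compose[OF measurable_snd]) simp
  have G_meas: "?G m t \<in> borel_measurable (walk_space w k)" for m t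
    by (intro measurable_If borel_measurable_prod c_meas borel_measurable_const
        measurable_exactly_jumps[unfolded pred_def])
  have G_bound: "norm (?G m t \<omega>) \<le> 1" for m t \<omega>
    by (simp add: prod_norm[symmetric] prod_le_1 c)
  have cons_meas: "(\<lambda>(s, \<omega>). case_nat s \<omega>) \<in> measurable (step_law w k \<Otimes>\<^sub>M walk_space w k) (walk_space w k)"
    unfolding walk_space_def by measurable
  have cons: "?G (Suc m) t (case_nat s \<omega>) = (if fst s \<le> t then c (snd s) * ?G m (t - fst s) \<omega> else 0)"
    for s \<omega> t
    by (simp add: exactly_jumps_case_nat prod.lessThan_Suc_shift del: prod.lessThan_Suc)
  have "(LINT \<omega>|walk_space w k. ?G (Suc m) t \<omega>)
      = (LINT \<omega>|distr (step_law w k \<Otimes>\<^sub>M walk_space w k) (walk_space w k) (\<lambda>(s, \<omega>). case_nat s \<omega>).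
           ?G (Suc m) t \<omega>)"
    using Seq.PiM_iter by (simp add: walk_space_def)
  also have "\<dots> = (LINT z|(step_law w k \<Otimes>\<^sub>M walk_space w k). ?G (Suc m) t (case_prod case_nat z))"
    by (rule integral_distr[OF cons_meas G_meas])
  also have "\<dots> = (LINT s|step_law w k. LINT \<omega>|walk_space w k. ?G (Suc m) t (case_nat s \<omega>))"
  proof (subst MS.integral_fst'[symmetric])
    show "integrable (step_law w k \<Otimes>\<^sub>M walk_space w k) (\<lambda>z. ?G (Suc m) t (case_prod case_nat z))"
      using G_bound measurable_compose[OF cons_meas G_meas]
      by (intro MS.integrable_const_bound[where B=1]) (auto simp del: prod.lessThan_Suc)
  qed (simp only: prod.case)
  also have "\<dots> = (LINT s|step_law w k.
      complex_of_real (if fst s \<le> t then exp (- (t - fst s)) * (t - fst s) ^ m / fact m else 0)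
        * (c (snd s) * ?phi ^ m))"
  proof (rule Bochner_Integration.integral_cong[OF refl])
    fix s
    show "(LINT \<omega>|walk_space w k. ?G (Suc m) t (case_nat s \<omega>)) =
        complex_of_real (if fst s \<le> t then exp (- (t - fst s)) * (t - fst s) ^ m / fact m else 0)
          * (c (snd s) * ?phi ^ m)"
    proof (cases "fst s \<le> t")
      case True
      then have "(LINT \<omega>|walk_space w k. ?G (Suc m) t (case_nat s \<omega>))
          = c (snd s) * (LINT \<omega>|walk_space w k. ?G m (t - fst s) \<omega>)"
        unfolding cons by simp
      then show ?thesis
        using True by (subst (asm) Suc.IH) auto
    qed (simp add: cons del: prod.lessThan_Suc)
  qed
  also have "\<dots> = (LINT x|density lborel (exponential_density 1). LINT y|measure_pmf (jump_pmf w k).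
      complex_of_real (if x \<le> t then exp (- (t - x)) * (t - x) ^ m / fact m else 0)
        * (c y * ?phi ^ m))"
  proof (subst DJ.integral_fst'[symmetric])
    have pos: "AE s in step_law w k. 0 \<le> fst s"
      using AE_step_nonneg .
    show "integrable (step_law w k) (\<lambda>s.
        complex_of_real (if fst s \<le> t then exp (- (t - fst s)) * (t - fst s) ^ m / fact m else 0)
          * (c (snd s) * ?phi ^ m))"
    proof (rule M.integrable_const_bound[where B="t ^ m"])
      have phi: "norm ?phi \<le> 1"
        by (intro order_trans[OF integral_norm_bound] measure_pmf.integral_le_const
            integrable_norm measure_pmf.integrable_const_bound[where B=1]) (simp_all add: c)
      show "AE s in step_law w k. norm
        (complex_of_real (if fst s \<le> t then exp (- (t - fst s)) * (t - fst s) ^ m / fact m else 0)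
          * (c (snd s) * ?phi ^ m)) \<le> t ^ m"
        using pos
      proof eventually_elim
        fix s :: "real \<times> nat \<times> int" assume s: "0 \<le> fst s"
        have "exp (- (t - fst s)) * (t - fst s) ^ m / fact m \<le> t ^ m" if "fst s \<le> t"
        proof -
          have A: "exp (- (t - fst s)) * (t - fst s) ^ m \<le> t ^ m"
            using that s mult_mono[of "exp (- (t - fst s))" 1 "(t - fst s) ^ m" "t ^ m"]
            by (simp add: power_mono)
          have B: "t ^ m / fact m \<le> t ^ m"
            using Suc.prems fact_ge_1[of m, where 'a=real]
            by (simp add: divide_le_eq mult_le_cancel_left1)
          show ?thesis
            by (rule order_trans[OF divide_right_mono[OF A] B]) simp
        qed
        then have "\<bar>if fst s \<le> t then exp (- (t - fst s)) * (t - fst s) ^ m / fact m else 0\<bar> \<le> t ^ m"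
          using Suc.prems by auto
        moreover have "norm (c (snd s) * ?phi ^ m) \<le> 1"
          by (simp add: norm_mult norm_power c phi mult_le_one power_le_one)
        ultimately show "norm (complex_of_real
            (if fst s \<le> t then exp (- (t - fst s)) * (t - fst s) ^ m / fact m else 0)
              * (c (snd s) * ?phi ^ m)) \<le> t ^ m"
          unfolding norm_mult norm_of_real
          using mult_mono[of _ "t ^ m" _ 1] by (metis mult_1_right norm_ge_zero norm_mult zero_le_one zero_le_power Suc.prems)
      qed
    qed (intro borel_measurable_times c_meas2 borel_measurable_const, measurable)
  qed (simp only: fst_conv snd_conv)
  also have "\<dots> = complex_of_real (LINT x|density lborel (exponential_density 1).
      (if x \<le> t then exp (- (t - x)) * (t - x) ^ m / fact m else 0)) * ?phi ^ Suc m"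
    by (simp only: integral_mult_right_zero integral_mult_left_zero integral_complex_of_real
        power_Suc)
  finally show ?case
    unfolding integral_exponential_poisson[OF Suc.prems] by simp
qed

section \<open>The characteristic function of the walk\<close>

lemma prob_exactly_jumps:
  assumes "0 \<le> t"
  shows "measure (walk_space w k) {\<omega>. exactly_jumps m t \<omega>} = exp (- t) * t ^ m / fact m"
proof -
  interpret W: prob_space "walk_space w k" by (rule prob_space_walk_space)
  have "complex_of_real (measure (walk_space w k) {\<omega>. exactly_jumps m t \<omega>})
      = (LINT \<omega>|walk_space w k. complex_of_real (indicator {\<omega>. exactly_jumps m t \<omega>} \<omega>))"
    by simp
  also have "\<dots> = (LINT \<omega>|walk_space w k.
      (if exactly_jumps m t \<omega> then \<Prod>j<m. (\<lambda>_. 1) (snd (\<omega> j)) else 0))"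
    by (rule Bochner_Integration.integral_cong) auto
  also have "\<dots> = complex_of_real (exp (- t) * t ^ m / fact m)"
    by (subst integral_exactly_jumps[OF _ assms]) auto
  finally show ?thesis unfolding of_real_eq_iff .
qed

lemma exactly_jumps_unique:
  assumes "exactly_jumps m t \<omega>" "exactly_jumps n t \<omega>"
  shows "m = n"
  using assms unfolding exactly_jumps_def by (metis linorder_neqE_nat not_le order_refl)

lemma sets_exactly_jumps [measurable]: "{\<omega>. exactly_jumps m t \<omega>} \<in> sets (walk_space w k)"
  using measurable_exactly_jumps[of m t w k] by (simp add: pred_def)

text \<open>
  The Poisson weights sum to \<open>1\<close>, so almost surely the number of jumps is finite. This is where the
  possibility that the waiting times have a finite sum is excluded.
\<close>

lemma AE_exactly_jumps:
  assumes "0 \<le> t"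
  shows "AE \<omega> in walk_space w k. \<exists>m. exactly_jumps m t \<omega>"
proof -
  interpret W: prob_space "walk_space w k" by (rule prob_space_walk_space)
  have "(\<lambda>m. measure (walk_space w k) {\<omega>. exactly_jumps m t \<omega>}) sums
      measure (walk_space w k) (\<Union>m. {\<omega>. exactly_jumps m t \<omega>})"
    by (rule W.finite_measure_UNION) (auto simp: disjoint_family_on_def dest: exactly_jumps_unique)
  moreover have "(\<lambda>m. exp (- t) * (t ^ m /\<^sub>R fact m)) sums (exp (- t) * exp t)"
    by (intro sums_mult exp_converges)
  then have "(\<lambda>m. measure (walk_space w k) {\<omega>. exactly_jumps m t \<omega>}) sums 1"
    by (simp add: prob_exactly_jumps[OF assms] exp_minus field_simps)
  ultimately have "measure (walk_space w k) (\<Union>m. {\<omega>. exactly_jumps m t \<omega>}) = 1"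
    by (rule sums_unique2)
  from W.AE_prob_1[OF this] show ?thesis by simp
qed

lemma walk_exactly_jumps:
  assumes "exactly_jumps m t \<omega>" "i < k"
  shows "walk k t \<omega> i = (\<Sum>j<m. if fst (snd (\<omega> j)) = i then snd (snd (\<omega> j)) else 0)"
proof -
  have "{j. jump_time \<omega> j \<le> t \<and> fst (snd (\<omega> j)) = i} = {j \<in> {..<m}. fst (snd (\<omega> j)) = i}"
    using assms(1) unfolding exactly_jumps_def by (auto simp: not_le[symmetric])
  then have "walk k t \<omega> i = (\<Sum>j\<in>{j \<in> {..<m}. fst (snd (\<omega> j)) = i}. snd (snd (\<omega> j)))"
    using assms(2) by (simp add: walk_def)
  also have "\<dots> = (\<Sum>j<m. if fst (snd (\<omega> j)) = i then snd (snd (\<omega> j)) else 0)"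
    by (rule sum.inter_filter) simp
  finally show ?thesis .
qed

text \<open>
  The position is a sum over a random set of indices. There are only countably many finite
  index sets, so the event is split according to the value of that set; when the set is infinite
  the sum takes the default value \<open>0\<close>.
\<close>

lemma measurable_walk_coord:
  assumes "i < k"
  shows "(\<lambda>\<omega>. walk k t \<omega> i) \<in> measurable (walk_space w k) (count_space UNIV)"
proof -
  define S where "S \<omega> = {j. jump_time \<omega> j \<le> t \<and> fst (snd (\<omega> j)) = i}"
    for \<omega> :: "nat \<Rightarrow> real \<times> nat \<times> int"
  define P where "P j = {\<omega> :: nat \<Rightarrow> real \<times> nat \<times> int. jump_time \<omega> j \<le> t} \<inter> {\<omega>. fst (snd (\<omega> j)) = i}" for j
  have P_sets: "P j \<in> sets (walk_space w k)" for j
  proof -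
    have "(\<lambda>\<omega>. jump_time \<omega> j) -` {..t} \<inter> space (walk_space w k) \<in> sets (walk_space w k)"
      by (rule measurable_sets[OF measurable_jump_time]) simp
    moreover have "(\<lambda>\<omega>. fst (snd (\<omega> j))) -` {i} \<inter> space (walk_space w k) \<in> sets (walk_space w k)"
      by (rule measurable_sets[OF measurable_mark[where c = fst and N = "count_space UNIV"]]) simp_all
    ultimately show ?thesis
      by (auto simp: P_def vimage_def)
  qed
  have S_sets: "{\<omega>. S \<omega> = F} \<in> sets (walk_space w k)" for F
  proof -
    have "{\<omega>. S \<omega> = F} = (\<Inter>j. if j \<in> F then P j else space (walk_space w k) - P j)"
      by (auto simp: S_def P_def split: if_splits)
    also have "\<dots> \<in> sets (walk_space w k)"
    proof (rule sets.countable_INT)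
      have "(if j \<in> F then P j else space (walk_space w k) - P j) \<in> sets (walk_space w k)" for j
        using P_sets[of j] sets.compl_sets[OF P_sets[of j]] by (simp del: space_walk_space)
      then show "range (\<lambda>j. if j \<in> F then P j else space (walk_space w k) - P j) \<subseteq> sets (walk_space w k)"
        by blast
    qed (rule UNIV_not_empty)
    finally show ?thesis .
  qed
  have sum_sets: "{\<omega>. (\<Sum>j\<in>F. snd (snd (\<omega> j))) = x} \<in> sets (walk_space w k)" for F x
  proof -
    have "(\<lambda>\<omega>. \<Sum>j\<in>F. real_of_int (snd (snd (\<omega> j)))) -` {real_of_int x} \<inter> space (walk_space w k)
        \<in> sets (walk_space w k)"
      by (intro measurable_sets[OF borel_measurable_sum]
            measurable_mark[where c = "\<lambda>x. real_of_int (snd x)"]) simp_all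
    moreover have "(\<Sum>j\<in>F. real_of_int (snd (snd (\<omega> j)))) = real_of_int x
        \<longleftrightarrow> (\<Sum>j\<in>F. snd (snd (\<omega> j))) = x" for \<omega> :: "nat \<Rightarrow> real \<times> nat \<times> int"
      unfolding of_int_sum[symmetric] of_int_eq_iff ..
    ultimately show ?thesis by (simp only: vimage_singleton_eq vimage_def Int_UNIV_right space_walk_space singleton_iff)
  qed
  have "(\<lambda>\<omega>. walk k t \<omega> i) -` {x} \<inter> space (walk_space w k) \<in> sets (walk_space w k)" for x
  proof -
    let ?Fin = "\<Union>F\<in>{F. finite F}. {\<omega>. S \<omega> = F} \<inter> {\<omega>. (\<Sum>j\<in>F. snd (snd (\<omega> j))) = x}"
    let ?Inf = "space (walk_space w k) - (\<Union>F\<in>{F. finite F}. {\<omega>. S \<omega> = F})"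
    have fin: "?Fin \<in> sets (walk_space w k)"
      using S_sets sum_sets by (intro sets.countable_UN' countable_Collect_finite) auto
    have inf: "?Inf \<in> sets (walk_space w k)"
      using S_sets by (intro sets.Diff sets.top sets.countable_UN' countable_Collect_finite) auto
    have walk_eq: "walk k t \<omega> i = (\<Sum>j\<in>S \<omega>. snd (snd (\<omega> j)))" for \<omega>
      using assms by (simp add: walk_def S_def)
    have "\<omega> \<in> ?Fin \<longleftrightarrow> finite (S \<omega>) \<and> walk k t \<omega> i = x" for \<omega>
      unfolding walk_eq by blast
    moreover have "\<omega> \<in> ?Inf \<longleftrightarrow> infinite (S \<omega>)" for \<omega>
      by simp
    moreover have "walk k t \<omega> i = 0" if "infinite (S \<omega>)" for \<omega>
      unfolding walk_eq using that by simp
    ultimately have "(\<lambda>\<omega>. walk k t \<omega> i) -` {x} \<inter> space (walk_space w k)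
        = ?Fin \<union> (if x = 0 then ?Inf else {})"
      by (intro set_eqI) (simp only: vimage_singleton_eq Int_iff space_walk_space UNIV_I Un_iff
          split: if_split, metis empty_iff)
    then show ?thesis
      using fin inf by (cases "x = 0") (simp_all only: simp_thms if_True if_False sets.Un sets.empty_sets Un_empty_right)
  qed
  then show ?thesis
    by (subst measurable_count_space_eq_countable) simp_all
qed

lemma measurable_walk: "walk k t \<in> measurable (walk_space w k) (\<Pi>\<^sub>M i\<in>{..<k}. count_space UNIV)"
proof -
  have eq: "walk k t = (\<lambda>\<omega>. \<lambda>i\<in>{..<k}. walk k t \<omega> i)"
    by (auto simp: fun_eq_iff walk_def)
  show ?thesis
    by (subst eq, rule measurable_restrict) (simp add: measurable_walk_coord)
qed

text \<open>
  The mean increment. It is the only parameter in which the two walks differ below, because the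
  characteristic function of one increment is \<open>cos \<theta> + \<i> drift sin \<theta>\<close> in both cases.
\<close>

fun drift :: "walk_kind \<Rightarrow> real" where
  "drift Simple = 0"
| "drift Directed = 1"

definition walk_char :: "walk_kind \<Rightarrow> real \<Rightarrow> real \<Rightarrow> complex" where
  "walk_char w s \<theta> = exp (complex_of_real s * Complex (cos \<theta> - 1) (drift w * sin \<theta>))"

lemma finite_increments [simp]: "finite (increments w)" "increments w \<noteq> {}"
  by (cases w; simp)+

lemma increments_char:
  "(\<Sum>\<xi>\<in>increments w. iexp (\<theta> * real_of_int \<xi>)) / of_nat (card (increments w))
     = Complex (cos \<theta>) (drift w * sin \<theta>)"
  by (cases w) (auto simp: complex_eq_iff exp_eq_polar cis.ctr Re_divide Im_divide)

text \<open>
  A coordinate outside \<open>I\<close> carries frequency \<open>0\<close> and contributes \<open>1\<close>; subtracting \<open>1\<close> from all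
  contributions leaves a sum over \<open>I\<close> alone.
\<close>

lemma jump_char:
  assumes k: "0 < k" and I: "I \<subseteq> {..<k}"
  shows "(LINT x|measure_pmf (jump_pmf w k). (if fst x \<in> I then iexp (\<theta> (fst x) * real_of_int (snd x)) else 1))
      = 1 + (\<Sum>i\<in>I. Complex (cos (\<theta> i) - 1) (drift w * sin (\<theta> i))) / of_nat k"
proof -
  let ?c = "\<lambda>x::nat \<times> int. if fst x \<in> I then iexp (\<theta> (fst x) * real_of_int (snd x)) else 1"
  have ne: "{..<k} \<noteq> {}" using k by auto
  have "(LINT x|measure_pmf (jump_pmf w k). ?c x)
      = (\<Sum>x\<in>{..<k} \<times> increments w. pmf (jump_pmf w k) x *\<^sub>R ?c x)"
    by (rule integral_measure_pmf) (auto simp: jump_pmf_def ne)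
  also have "\<dots> = (\<Sum>i<k. \<Sum>\<xi>\<in>increments w. pmf (jump_pmf w k) (i, \<xi>) *\<^sub>R ?c (i, \<xi>))"
    unfolding sum.cartesian_product by (rule sum.cong) auto
  also have "\<dots> = (\<Sum>i<k. (\<Sum>\<xi>\<in>increments w. ?c (i, \<xi>)) / of_nat (card (increments w)) / of_nat k)"
    by (intro sum.cong refl)
       (simp add: jump_pmf_def pmf_pair ne sum_divide_distrib scaleR_conv_of_real divide_simps mult.commute)
  also have "\<dots> = (\<Sum>i<k. (1 + (if i \<in> I then Complex (cos (\<theta> i) - 1) (drift w * sin (\<theta> i)) else 0)) / of_nat k)"
  proof (intro sum.cong refl arg_cong[where f = "\<lambda>x. x / of_nat k"])
    fix i
    show "(\<Sum>\<xi>\<in>increments w. ?c (i, \<xi>)) / of_nat (card (increments w))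
        = 1 + (if i \<in> I then Complex (cos (\<theta> i) - 1) (drift w * sin (\<theta> i)) else 0)"
      using increments_char[of "\<theta> i" w] by (auto simp: complex_eq_iff)
  qed
  also have "\<dots> = 1 + (\<Sum>i\<in>I. Complex (cos (\<theta> i) - 1) (drift w * sin (\<theta> i))) / of_nat k"
    using k I by (simp add: sum_divide_distrib[symmetric] sum.distrib add_divide_distrib
        sum.inter_restrict[symmetric] Int_absorb1)
  finally show ?thesis .
qed

text \<open>
  Averaging the \<open>m\<close>-th power of the characteristic function of one jump over a Poisson number \<open>m\<close> of
  jumps gives an exponential. As the characteristic function of one jump is a sum over the
  coordinates, its exponential is a product over them: this is where independence of the coordinates
  originates.
\<close>

lemma integral_iexp_walk:
  assumes k: "0 < k" and t: "0 \<le> t" and I: "I \<subseteq> {..<k}"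
  shows "(LINT \<omega>|walk_space w k. (\<Prod>i\<in>I. iexp (\<theta> i * real_of_int (walk k t \<omega> i))))
       = (\<Prod>i\<in>I. walk_char w (t / real k) (\<theta> i))"
proof -
  interpret W: prob_space "walk_space w k" by (rule prob_space_walk_space)
  have finI: "finite I" using I finite_subset by blast
  let ?g = "\<lambda>\<omega>. \<Prod>i\<in>I. iexp (\<theta> i * real_of_int (walk k t \<omega> i))"
  let ?c = "\<lambda>x::nat \<times> int. if fst x \<in> I then iexp (\<theta> (fst x) * real_of_int (snd x)) else 1"
  let ?A = "\<lambda>m. {\<omega>. exactly_jumps m t \<omega>}"
  define z where "z = (\<Sum>i\<in>I. Complex (cos (\<theta> i) - 1) (drift w * sin (\<theta> i))) / of_nat k"
  have g_meas: "?g \<in> borel_measurable (walk_space w k)"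
    using I by (intro borel_measurable_prod measurable_compose[OF measurable_walk_coord]) auto
  have g_bound: "norm (?g \<omega>) \<le> 1" for \<omega>
    by (simp add: prod_norm[symmetric])
  have g_int: "integrable (walk_space w k) ?g"
    by (rule W.integrable_const_bound[where B=1]) (use g_meas g_bound in auto)
  have g_eq: "?g \<omega> = (\<Prod>j<m. ?c (snd (\<omega> j)))" if "exactly_jumps m t \<omega>" for m \<omega>
  proof -
    have "?g \<omega> = (\<Prod>i\<in>I. \<Prod>j<m. if fst (snd (\<omega> j)) = i then iexp (\<theta> i * real_of_int (snd (snd (\<omega> j)))) else 1)"
    proof (rule prod.cong[OF refl])
      fix i assume "i \<in> I"
      then have "i < k" using I by auto
      then have "iexp (\<theta> i * real_of_int (walk k t \<omega> i))
        = exp (\<Sum>j<m. \<i> * of_real (if fst (snd (\<omega> j)) = i then \<theta> i * real_of_int (snd (snd (\<omega> j))) else 0))"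
        unfolding walk_exactly_jumps[OF that \<open>i < k\<close>]
        by (auto simp: sum_distrib_left if_distrib intro!: arg_cong[where f=exp] sum.cong)
      also have "\<dots> = (\<Prod>j<m. if fst (snd (\<omega> j)) = i then iexp (\<theta> i * real_of_int (snd (snd (\<omega> j)))) else 1)"
        by (subst exp_sum) (auto intro!: prod.cong)
      finally show "iexp (\<theta> i * real_of_int (walk k t \<omega> i)) = \<dots>" .
    qed
    also have "\<dots> = (\<Prod>j<m. \<Prod>i\<in>I. if fst (snd (\<omega> j)) = i then iexp (\<theta> i * real_of_int (snd (snd (\<omega> j)))) else 1)"
      by (rule prod.swap)
    also have "\<dots> = (\<Prod>j<m. ?c (snd (\<omega> j)))"
      using finI by (intro prod.cong refl) (simp add: prod.delta)
    finally show ?thesis .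
  qed
  have "(LINT \<omega>|walk_space w k. ?g \<omega>) = (LINT \<omega>:(\<Union>m. ?A m)|walk_space w k. ?g \<omega>)"
    unfolding set_lebesgue_integral_def
  proof (rule integral_cong_AE)
    show "AE \<omega> in walk_space w k. ?g \<omega> = indicator (\<Union>m. ?A m) \<omega> *\<^sub>R ?g \<omega>"
      using AE_exactly_jumps[OF t, of w k] by eventually_elim auto
    show "(\<lambda>\<omega>. indicator (\<Union>m. ?A m) \<omega> *\<^sub>R ?g \<omega>) \<in> borel_measurable (walk_space w k)"
      by (intro borel_measurable_scaleR borel_measurable_indicator g_meas sets.countable_UN) auto
  qed (rule g_meas)
  also have "\<dots> = (\<Sum>m. LINT \<omega>:?A m|walk_space w k. ?g \<omega>)"
  proof (rule lebesgue_integral_countable_add)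
    show "set_integrable (walk_space w k) (\<Union>m. ?A m) ?g"
      unfolding set_integrable_def using g_int by (intro integrable_mult_indicator) auto
  qed (auto dest: exactly_jumps_unique)
  also have "(\<lambda>m. LINT \<omega>:?A m|walk_space w k. ?g \<omega>)
      = (\<lambda>m. exp (of_real (- t)) * ((of_real t * (1 + z)) ^ m /\<^sub>R fact m))"
  proof
    fix m
    have "(LINT \<omega>:?A m|walk_space w k. ?g \<omega>)
        = (LINT \<omega>|walk_space w k. (if exactly_jumps m t \<omega> then \<Prod>j<m. ?c (snd (\<omega> j)) else 0))"
      unfolding set_lebesgue_integral_def
    proof (rule Bochner_Integration.integral_cong[OF refl])
      fix \<omega>
      show "indicator (?A m) \<omega> *\<^sub>R ?g \<omega>
          = (if exactly_jumps m t \<omega> then \<Prod>j<m. ?c (snd (\<omega> j)) else 0)"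
      proof (cases "exactly_jumps m t \<omega>")
        case True
        then show ?thesis unfolding g_eq[OF True] by simp
      qed simp
    qed
    also have "\<dots> = of_real (exp (- t) * t ^ m / fact m) * (1 + z) ^ m"
      unfolding z_def jump_char[OF k I, symmetric]
      by (rule integral_exactly_jumps[OF _ t]) simp
    also have "\<dots> = exp (of_real (- t)) * ((of_real t * (1 + z)) ^ m /\<^sub>R fact m)"
      unfolding power_mult_distrib scaleR_conv_of_real exp_of_real by (simp add: divide_inverse)
    finally show "(LINT \<omega>:?A m|walk_space w k. ?g \<omega>)
        = exp (of_real (- t)) * ((of_real t * (1 + z)) ^ m /\<^sub>R fact m)" .
  qed
  also have "(\<Sum>m. exp (of_real (- t)) * ((of_real t * (1 + z)) ^ m /\<^sub>R fact m))
      = exp (of_real (- t)) * exp (of_real t * (1 + z))"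
    by (intro sums_unique[symmetric] sums_mult exp_converges)
  also have "\<dots> = exp (\<Sum>i\<in>I. complex_of_real (t / real k) * Complex (cos (\<theta> i) - 1) (drift w * sin (\<theta> i)))"
    unfolding exp_add[symmetric] z_def sum_distrib_left[symmetric] using k by (simp add: field_simps)
  also have "\<dots> = (\<Prod>i\<in>I. walk_char w (t / real k) (\<theta> i))"
    unfolding walk_char_def by (rule exp_sum[OF finI])
  finally show ?thesis .
qed

section \<open>Fourier inversion and the law of the walk\<close>

text \<open>
  The Fourier inversion formula for the mass that one coordinate, with mean increment \<open>c\<close>, gives to \<open>x\<close>
  after time \<open>s\<close>, written with the real part of the characteristic function.
\<close>

definition lattice_mass :: "real \<Rightarrow> real \<Rightarrow> int \<Rightarrow> real" where
  "lattice_mass c s x =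
     (LINT \<theta>:{-pi..pi}|lborel. exp (s * (cos \<theta> - 1)) * cos (real_of_int x * \<theta> - c * s * sin \<theta>)) / (2 * pi)"

definition circle :: "real measure" where
  "circle = density lborel (\<lambda>\<theta>. ennreal (indicator {-pi..pi} \<theta> / (2 * pi)))"

lemma prob_space_circle: "prob_space circle"
proof
  have pi: "emeasure lborel {-pi..pi} = ennreal (2 * pi)"
    by (subst emeasure_lborel_Icc) simp_all
  have "emeasure circle (space circle)
      = (\<integral>\<^sup>+ \<theta>. ennreal (indicator {-pi..pi} \<theta> / (2 * pi)) * indicator UNIV \<theta> \<partial>lborel)"
    unfolding circle_def space_density space_lborel space_borel by (rule emeasure_density) simp_all
  also have "\<dots> = (\<integral>\<^sup>+ \<theta>. ennreal (1 / (2 * pi)) * indicator {-pi..pi} \<theta> \<partial>lborel)"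
    by (rule nn_integral_cong) (simp split: split_indicator)
  also have "\<dots> = ennreal (1 / (2 * pi)) * ennreal (2 * pi)"
    by (subst nn_integral_cmult_indicator) (simp_all only: pi sets_lborel atLeastAtMost_borel)
  also have "\<dots> = ennreal (1 / (2 * pi) * (2 * pi))"
    by (rule ennreal_mult[symmetric]) simp_all
  finally show "emeasure circle (space circle) = 1" by simp
qed

lemma sets_circle [measurable_cong]: "sets circle = sets borel"
  by (simp add: circle_def)

lemma integral_circle:
  fixes f :: "real \<Rightarrow> 'a :: {banach, second_countable_topology}"
  assumes "f \<in> borel_measurable borel"
  shows "(LINT \<theta>|circle. f \<theta>) = (LINT \<theta>:{-pi..pi}|lborel. f \<theta>) /\<^sub>R (2 * pi)"
proof -
  have "(LINT \<theta>|circle. f \<theta>) = (LINT \<theta>|lborel. (indicator {-pi..pi} \<theta> / (2 * pi)) *\<^sub>R f \<theta>)"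
    unfolding circle_def using assms by (intro integral_density AE_I2) simp_all
  also have "\<dots> = (LINT \<theta>|lborel. (1 / (2 * pi)) *\<^sub>R (indicator {-pi..pi} \<theta> *\<^sub>R f \<theta>))"
    by (intro Bochner_Integration.integral_cong) (simp_all split: split_indicator)
  also have "\<dots> = (LINT \<theta>:{-pi..pi}|lborel. f \<theta>) /\<^sub>R (2 * pi)"
    unfolding set_lebesgue_integral_def integral_scaleR_right by (simp only: inverse_eq_divide)
  finally show ?thesis .
qed

lemma integral_circle_iexp:
  "(LINT \<theta>|circle. iexp (\<theta> * real_of_int n)) = (if n = 0 then 1 else 0)"
proof (cases "n = 0")
  case True
  interpret prob_space circle by (rule prob_space_circle)
  show ?thesis using True prob_space by simp
next
  case False
  have "(LINT \<theta>|lborel. indicator {-pi..pi} \<theta> *\<^sub>R iexp (\<theta> * real_of_int n))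
      = iexp (pi * real_of_int n) / (\<i> * of_int n) - iexp (- pi * real_of_int n) / (\<i> * of_int n)"
  proof (rule integral_FTC_Icc)
    show "((\<lambda>\<theta>. iexp (\<theta> * real_of_int n) / (\<i> * of_int n)) has_vector_derivative
        iexp (x * real_of_int n)) (at x within {- pi..pi})" for x
      using False by (auto intro!: derivative_eq_intros has_vector_derivative_real_field simp: field_simps)
  qed (auto intro!: continuous_intros)
  also have "iexp (pi * real_of_int n) = iexp (- pi * real_of_int n)"
    by (simp add: exp_eq_polar complex_eq_iff sin_npi_int)
  finally show ?thesis
    using False by (subst integral_circle) (auto simp: set_lebesgue_integral_def)
qed

lemma norm_walk_char_le: "0 \<le> s \<Longrightarrow> norm (walk_char w s \<theta>) \<le> 1"
  by (simp add: walk_char_def mult_nonneg_nonpos)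

lemma walk_char_measurable [measurable]: "walk_char w s \<in> borel_measurable borel"
proof -
  have "walk_char w s = (\<lambda>\<theta>. exp (complex_of_real s *
      (complex_of_real (cos \<theta> - 1) + \<i> * complex_of_real (drift w * sin \<theta>))))"
    by (simp add: fun_eq_iff walk_char_def Complex_eq)
  then show ?thesis by simp
qed

text \<open>
  The indicator of \<open>W\<^sub>i = x\<^sub>i\<close> is the average of \<open>exp (\<i> \<theta> (W\<^sub>i - x\<^sub>i))\<close> over the circle. Averaging over
  independent angles, one for each coordinate in \<open>I\<close>, and exchanging the order of integration
  reduces the joint law to the joint characteristic function.
\<close>

lemma prob_walk_coords_complex:
  assumes k: "0 < k" and t: "0 \<le> t" and I: "I \<subseteq> {..<k}"
  shows "complex_of_real (measure (walk_space w k) {\<omega>. \<forall>i\<in>I. walk k t \<omega> i = x i})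
       = (\<Prod>i\<in>I. LINT \<theta>|circle. iexp (- (\<theta> * real_of_int (x i))) * walk_char w (t / real k) \<theta>)"
proof -
  interpret W: prob_space "walk_space w k" by (rule prob_space_walk_space)
  interpret C: prob_space circle by (rule prob_space_circle)
  interpret PC: product_prob_space "\<lambda>_. circle" I ..
  have finI: "finite I" using I finite_subset by blast
  interpret FC: prob_space "\<Pi>\<^sub>M i\<in>I. circle" by (rule prob_space_PiM) (rule prob_space_circle)
  interpret WC: pair_prob_space "walk_space w k" "\<Pi>\<^sub>M i\<in>I. circle" ..
  let ?e = "\<lambda>\<omega> \<Theta>. \<Prod>i\<in>I. iexp (\<Theta> i * real_of_int (walk k t \<omega> i - x i))"
  have walk_meas: "(\<lambda>\<omega>. real_of_int (walk k t \<omega> i - x i)) \<in> borel_measurable (walk_space w k)"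
    if "i \<in> I" for i
    using I that by (intro measurable_compose[OF measurable_walk_coord]) auto
  have ev: "{\<omega>. \<forall>i\<in>I. walk k t \<omega> i = x i} \<in> sets (walk_space w k)"
  proof -
    have "{\<omega>. walk k t \<omega> i = x i} \<in> sets (walk_space w k)" if "i \<in> I" for i
      using measurable_sets[OF measurable_walk_coord[of i k t w], of "{x i}"] I that
      by (auto simp: vimage_def)
    then have "{\<omega> \<in> space (walk_space w k). \<forall>i\<in>I. walk k t \<omega> i = x i} \<in> sets (walk_space w k)"
      by (intro sets.sets_Collect_finite_All finI) simp
    then show ?thesis by simp
  qed
  have e_meas: "case_prod ?e \<in> borel_measurable (walk_space w k \<Otimes>\<^sub>M (\<Pi>\<^sub>M i\<in>I. circle))"
  proof -
    have angle: "(\<lambda>z. snd z i) \<in> borel_measurable (walk_space w k \<Otimes>\<^sub>M (\<Pi>\<^sub>M i\<in>I. circle))"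
      if "i \<in> I" for i
      using measurable_compose[OF measurable_snd measurable_component_singleton[OF that, of "\<lambda>_. circle"]]
      by (simp only: measurable_cong_sets[OF refl sets_circle])
    have position: "(\<lambda>z. real_of_int (walk k t (fst z) i - x i))
        \<in> borel_measurable (walk_space w k \<Otimes>\<^sub>M (\<Pi>\<^sub>M i\<in>I. circle))" if "i \<in> I" for i
      by (rule measurable_compose[OF measurable_fst walk_meas[OF that]])
    have "iexp \<in> borel_measurable borel" by simp
    from measurable_compose[OF borel_measurable_times[OF angle position] this]
    have "(\<lambda>z. \<Prod>i\<in>I. iexp (snd z i * real_of_int (walk k t (fst z) i - x i)))
        \<in> borel_measurable (walk_space w k \<Otimes>\<^sub>M (\<Pi>\<^sub>M i\<in>I. circle))"
      by (rule borel_measurable_prod)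
    then show ?thesis by (subst measurable_split_conv)
  qed
  have e_int: "integrable (walk_space w k \<Otimes>\<^sub>M (\<Pi>\<^sub>M i\<in>I. circle)) (case_prod ?e)"
    by (rule WC.integrable_const_bound[OF _ e_meas, where B=1]) (auto simp: prod_norm[symmetric])
  have "complex_of_real (measure (walk_space w k) {\<omega>. \<forall>i\<in>I. walk k t \<omega> i = x i})
      = (LINT \<omega>|walk_space w k. complex_of_real (indicator {\<omega>. \<forall>i\<in>I. walk k t \<omega> i = x i} \<omega>))"
    using ev by simp
  also have "\<dots> = (LINT \<omega>|walk_space w k. LINT \<Theta>|(\<Pi>\<^sub>M i\<in>I. circle). ?e \<omega> \<Theta>)"
  proof (rule Bochner_Integration.integral_cong[OF refl])
    fix \<omega>
    have "(LINT \<Theta>|(\<Pi>\<^sub>M i\<in>I. circle). ?e \<omega> \<Theta>)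
        = (\<Prod>i\<in>I. LINT \<theta>|circle. iexp (\<theta> * real_of_int (walk k t \<omega> i - x i)))"
      by (rule PC.product_integral_prod[OF finI]) (rule C.integrable_const_bound[where B=1]; simp)
    also have "\<dots> = (\<Prod>i\<in>I. if walk k t \<omega> i = x i then 1 else 0)"
      by (simp only: integral_circle_iexp right_minus_eq)
    also have "\<dots> = complex_of_real (indicator {\<omega>. \<forall>i\<in>I. walk k t \<omega> i = x i} \<omega>)"
    proof (cases "\<forall>i\<in>I. walk k t \<omega> i = x i")
      case True
      then show ?thesis by simp
    next
      case False
      then have "(\<Prod>i\<in>I. if walk k t \<omega> i = x i then 1 else 0 :: complex) = 0"
        using finI by (intro prod_zero) auto
      then show ?thesis using False by simp
    qed
    finally show "complex_of_real (indicator {\<omega>. \<forall>i\<in>I. walk k t \<omega> i = x i} \<omega>)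
        = (LINT \<Theta>|(\<Pi>\<^sub>M i\<in>I. circle). ?e \<omega> \<Theta>)" ..
  qed
  also have "\<dots> = (LINT \<Theta>|(\<Pi>\<^sub>M i\<in>I. circle). LINT \<omega>|walk_space w k. ?e \<omega> \<Theta>)"
    by (rule WC.Fubini_integral[OF e_int, symmetric])
  also have "\<dots> = (LINT \<Theta>|(\<Pi>\<^sub>M i\<in>I. circle).
      (\<Prod>i\<in>I. iexp (- (\<Theta> i * real_of_int (x i))) * walk_char w (t / real k) (\<Theta> i)))"
  proof (rule Bochner_Integration.integral_cong[OF refl])
    fix \<Theta> :: "nat \<Rightarrow> real"
    have "(LINT \<omega>|walk_space w k. ?e \<omega> \<Theta>) = (LINT \<omega>|walk_space w k.
        (\<Prod>i\<in>I. iexp (- (\<Theta> i * real_of_int (x i)))) * (\<Prod>i\<in>I. iexp (\<Theta> i * real_of_int (walk k t \<omega> i))))"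
    proof (intro Bochner_Integration.integral_cong refl)
      fix \<omega>
      have "iexp (\<Theta> i * real_of_int (walk k t \<omega> i - x i))
          = iexp (- (\<Theta> i * real_of_int (x i))) * iexp (\<Theta> i * real_of_int (walk k t \<omega> i))" for i
        unfolding exp_add[symmetric] by (rule arg_cong[where f=exp]) (simp add: algebra_simps)
      then show "?e \<omega> \<Theta> = (\<Prod>i\<in>I. iexp (- (\<Theta> i * real_of_int (x i))))
          * (\<Prod>i\<in>I. iexp (\<Theta> i * real_of_int (walk k t \<omega> i)))"
        by (simp only: prod.distrib)
    qed
    also have "\<dots> = (\<Prod>i\<in>I. iexp (- (\<Theta> i * real_of_int (x i)))) *
        (\<Prod>i\<in>I. walk_char w (t / real k) (\<Theta> i))"
      unfolding integral_mult_right_zero integral_iexp_walk[OF k t I] ..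
    finally show "(LINT \<omega>|walk_space w k. ?e \<omega> \<Theta>)
        = (\<Prod>i\<in>I. iexp (- (\<Theta> i * real_of_int (x i))) * walk_char w (t / real k) (\<Theta> i))"
      by (simp only: prod.distrib)
  qed
  also have "\<dots> = (\<Prod>i\<in>I. LINT \<theta>|circle. iexp (- (\<theta> * real_of_int (x i))) * walk_char w (t / real k) \<theta>)"
  proof (rule PC.product_integral_prod[OF finI])
    fix i
    show "integrable circle (\<lambda>\<theta>. iexp (- (\<theta> * real_of_int (x i))) * walk_char w (t / real k) \<theta>)"
    proof (rule C.integrable_const_bound[where B=1])
      show "AE \<theta> in circle. norm (iexp (- (\<theta> * real_of_int (x i))) * walk_char w (t / real k) \<theta>) \<le> 1"
        using t by (intro always_eventually allI) (simp add: norm_mult norm_walk_char_le)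
    qed measurable
  qed
  finally show ?thesis .
qed

lemma Re_walk_char_integral:
  assumes s: "0 \<le> s"
  shows "Re (LINT \<theta>|circle. iexp (- (\<theta> * real_of_int y)) * walk_char w s \<theta>) = lattice_mass (drift w) s y"
proof -
  interpret C: prob_space circle by (rule prob_space_circle)
  have int: "integrable circle (\<lambda>\<theta>. iexp (- (\<theta> * real_of_int y)) * walk_char w s \<theta>)"
  proof (rule C.integrable_const_bound[where B=1])
    show "AE \<theta> in circle. norm (iexp (- (\<theta> * real_of_int y)) * walk_char w s \<theta>) \<le> 1"
      using s by (intro always_eventually allI) (simp add: norm_mult norm_walk_char_le)
  qed measurable
  have "Re (iexp (- (\<theta> * real_of_int y)) * walk_char w s \<theta>)
      = exp (s * (cos \<theta> - 1)) * cos (real_of_int y * \<theta> - drift w * s * sin \<theta>)" for \<theta>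
  proof -
    have "iexp (- (\<theta> * real_of_int y)) * walk_char w s \<theta>
        = exp (Complex (s * (cos \<theta> - 1)) (drift w * s * sin \<theta> - real_of_int y * \<theta>))"
      unfolding walk_char_def exp_add[symmetric]
      by (rule arg_cong[where f=exp]) (simp add: complex_eq_iff algebra_simps)
    then show ?thesis
      using cos_minus[of "drift w * s * sin \<theta> - real_of_int y * \<theta>"] by (simp add: Re_exp)
  qed
  then have "Re (LINT \<theta>|circle. iexp (- (\<theta> * real_of_int y)) * walk_char w s \<theta>)
      = (LINT \<theta>|circle. exp (s * (cos \<theta> - 1)) * cos (real_of_int y * \<theta> - drift w * s * sin \<theta>))"
    unfolding integral_Re[OF int, symmetric] by (simp only:)
  also have "\<dots> = lattice_mass (drift w) s y"
  proof -
    have "(\<lambda>\<theta>. exp (s * (cos \<theta> - 1)) * cos (real_of_int y * \<theta> - drift w * s * sin \<theta>))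
        \<in> borel_measurable borel"
      by measurable
    from integral_circle[OF this] show ?thesis
      unfolding lattice_mass_def by (simp only: real_scaleR_def divide_inverse mult.commute)
  qed
  finally show ?thesis .
qed

text \<open>
  The Fourier integral is real because it is a probability, so its real part determines it.
\<close>

lemma walk_char_integral:
  assumes s: "0 \<le> s"
  shows "(LINT \<theta>|circle. iexp (- (\<theta> * real_of_int y)) * walk_char w s \<theta>)
       = complex_of_real (lattice_mass (drift w) s y)"
    (is "?z = _")
proof -
  have "complex_of_real (measure (walk_space w 1) {\<omega>. \<forall>i\<in>{0}. walk 1 s \<omega> i = y})
      = (\<Prod>i\<in>{0::nat}. LINT \<theta>|circle. iexp (- (\<theta> * real_of_int y)) * walk_char w (s / real 1) \<theta>)"
    by (rule prob_walk_coords_complex[OF _ s]) simp_all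
  also have "\<dots> = ?z"
    by (simp only: prod.insert prod.empty finite.emptyI empty_iff not_False_eq_True mult_1_right
        of_nat_1 div_by_1)
  finally have z: "?z = complex_of_real (measure (walk_space w 1) {\<omega>. \<forall>i\<in>{0}. walk 1 s \<omega> i = y})" ..
  have "?z = complex_of_real (Re ?z)"
    unfolding z Re_complex_of_real ..
  then show ?thesis
    unfolding Re_walk_char_integral[OF s] .
qed

lemma prob_walk_coords:
  assumes k: "0 < k" and t: "0 \<le> t" and I: "I \<subseteq> {..<k}"
  shows "measure (walk_space w k) {\<omega>. \<forall>i\<in>I. walk k t \<omega> i = x i}
       = (\<Prod>i\<in>I. lattice_mass (drift w) (t / real k) (x i))"
proof -
  have s: "0 \<le> t / real k" using t by simp
  have "complex_of_real (measure (walk_space w k) {\<omega>. \<forall>i\<in>I. walk k t \<omega> i = x i})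
      = complex_of_real (\<Prod>i\<in>I. lattice_mass (drift w) (t / real k) (x i))"
    unfolding prob_walk_coords_complex[OF k t I] walk_char_integral[OF s] of_real_prod ..
  then show ?thesis unfolding of_real_eq_iff .
qed

section \<open>Decay of the point masses\<close>

text \<open>
  The quadratic gap that makes the Fourier integrand Gaussian on the whole circle. The constant \<open>18\<close>
  comes from \<open>sin u \<ge> u - u\<^sup>3 / 6 \<ge> u / 3\<close> on \<open>0 \<le> u \<le> 2\<close> with \<open>u = \<bar>\<theta>\<bar> / 2\<close>.
\<close>

lemma cos_gap:
  fixes \<theta> :: real
  assumes "\<bar>\<theta>\<bar> \<le> pi"
  shows "cos \<theta> - 1 \<le> - (\<theta>\<^sup>2 / 18)"
proof -
  define u where "u = \<bar>\<theta>\<bar> / 2"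
  have u: "0 \<le> u" "u \<le> 2"
    using assms pi_less_4 by (auto simp: u_def)
  obtain t where t: "sin u = (\<Sum>m<3. sin_coeff m * u ^ m) + sin (t + 1/2 * real 3 * pi) / fact 3 * u ^ 3"
    using Maclaurin_sin_expansion[of u 3] by blast
  have "(\<Sum>m<3. sin_coeff m * u ^ m) = u"
    by (simp add: eval_nat_numeral sin_coeff_def)
  moreover have "- (1 / 6 * u ^ 3) \<le> sin (t + 1/2 * real 3 * pi) / fact 3 * u ^ 3"
  proof -
    have "- 1 * (u ^ 3 / 6) \<le> sin (t + 1/2 * real 3 * pi) * (u ^ 3 / 6)"
      using u by (intro mult_right_mono sin_ge_minus_one) simp_all
    then show ?thesis by (simp add: fact_numeral)
  qed
  ultimately have "u - u ^ 3 / 6 \<le> sin u" using t by simp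
  moreover have "u * u\<^sup>2 \<le> u * 4"
    using u by (intro mult_left_mono) (auto simp: power2_eq_square intro: mult_mono[of u 2 u 2, simplified])
  ultimately have "u / 3 \<le> sin u" by (simp add: power3_eq_cube power2_eq_square)
  then have "(u / 3)\<^sup>2 \<le> (sin u)\<^sup>2"
    using u by (intro power_mono) simp_all
  moreover have "cos \<theta> = 1 - 2 * (sin u)\<^sup>2"
    using cos_double_sin[of u] by (simp add: u_def)
  ultimately show ?thesis by (simp add: u_def power_divide)
qed

lemma one_minus_cos_le: "1 - cos \<theta> \<le> \<theta>\<^sup>2 / 2" for \<theta> :: real
proof -
  have "(sin (\<theta> / 2))\<^sup>2 \<le> (\<theta> / 2)\<^sup>2"
    by (rule abs_le_square_iff[THEN iffD1, OF abs_sin_x_le_abs_x])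
  then show ?thesis using cos_double_sin[of "\<theta> / 2"] by (simp add: power_divide)
qed

text \<open>
  These are the zeroth and second moments of a Gaussian of variance \<open>9 / s\<close>, up to normalisation.
\<close>

lemma gauss_weight_integral:
  assumes s: "0 < s"
  shows "integrable lborel (\<lambda>\<theta>::real. exp (- (s * \<theta>\<^sup>2 / 18)))"
    and "(LINT \<theta>|lborel. exp (- (s * \<theta>\<^sup>2 / 18))) = sqrt (18 * pi) / sqrt s"
    and "integrable lborel (\<lambda>\<theta>::real. exp (- (s * \<theta>\<^sup>2 / 18)) * \<theta>\<^sup>2)"
    and "(LINT \<theta>|lborel. exp (- (s * \<theta>\<^sup>2 / 18)) * \<theta>\<^sup>2) = 9 * sqrt (18 * pi) / (s * sqrt s)"
proof -
  define \<sigma> where "\<sigma> = 3 / sqrt s"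
  have \<sigma>: "0 < \<sigma>" using s by (simp add: \<sigma>_def)
  have \<sigma>2: "\<sigma>\<^sup>2 = 9 / s" using s by (simp add: \<sigma>_def power_divide)
  have eq: "exp (- (s * \<theta>\<^sup>2 / 18)) = (sqrt (18 * pi) / sqrt s) * normal_density 0 \<sigma> \<theta>" for \<theta>
  proof -
    have "sqrt (2 * pi * \<sigma>\<^sup>2) = sqrt (18 * pi) / sqrt s"
      unfolding \<sigma>2 real_sqrt_divide[symmetric] by simp
    moreover have "- (\<theta> - 0)\<^sup>2 / (2 * \<sigma>\<^sup>2) = - (s * \<theta>\<^sup>2 / 18)"
      unfolding \<sigma>2 by simp
    moreover have "sqrt (18 * pi) / sqrt s \<noteq> 0" using s by simp
    ultimately show ?thesis unfolding normal_density_def by simp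
  qed
  have m0: "has_bochner_integral lborel (\<lambda>\<theta>. normal_density 0 \<sigma> \<theta>) 1"
    using normal_moment_even[OF \<sigma>, of 0 0] by simp
  have m2: "has_bochner_integral lborel (\<lambda>\<theta>. normal_density 0 \<sigma> \<theta> * \<theta>\<^sup>2) (9 / s)"
    using normal_moment_even[OF \<sigma>, of 0 1] by (simp add: \<sigma>2 fact_numeral)
  have 0: "has_bochner_integral lborel (\<lambda>\<theta>::real. exp (- (s * \<theta>\<^sup>2 / 18))) (sqrt (18 * pi) / sqrt s * 1)"
    unfolding eq by (rule has_bochner_integral_mult_right) (use m0 in simp)
  have 2: "has_bochner_integral lborel (\<lambda>\<theta>::real. exp (- (s * \<theta>\<^sup>2 / 18)) * \<theta>\<^sup>2)
      (sqrt (18 * pi) / sqrt s * (9 / s))"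
    unfolding eq mult.assoc by (rule has_bochner_integral_mult_right) (use m2 in simp)
  show "integrable lborel (\<lambda>\<theta>::real. exp (- (s * \<theta>\<^sup>2 / 18)))"
    "integrable lborel (\<lambda>\<theta>::real. exp (- (s * \<theta>\<^sup>2 / 18)) * \<theta>\<^sup>2)"
    using 0 2 by (auto intro: integrable.intros)
  show "(LINT \<theta>|lborel. exp (- (s * \<theta>\<^sup>2 / 18))) = sqrt (18 * pi) / sqrt s"
    using has_bochner_integral_integral_eq[OF 0] by simp
  show "(LINT \<theta>|lborel. exp (- (s * \<theta>\<^sup>2 / 18)) * \<theta>\<^sup>2) = 9 * sqrt (18 * pi) / (s * sqrt s)"
    using has_bochner_integral_integral_eq[OF 2] by (simp add: mult.commute)
qed

text \<open>
  The factor multiplying \<open>exp (s (cos \<theta> - 1))\<close> after the Fourier integrand of \<open>lattice_mass\<close>, times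
  \<open>(x - c s)\<^sup>2\<close>, has been integrated by parts twice.
\<close>

definition ibp_rest :: "real \<Rightarrow> real \<Rightarrow> real \<Rightarrow> real \<Rightarrow> real" where
  "ibp_rest c s x \<theta> = (let g = x * \<theta> - c * s * sin \<theta> in
     s * (- s * (sin \<theta>)\<^sup>2 * cos g + cos \<theta> * cos g - c * s * sin \<theta> * (1 - cos \<theta>) * sin g)
     - c * s * (s * sin \<theta> * (1 - cos \<theta>) * sin g - sin \<theta> * sin g - c * s * (1 - cos \<theta>)\<^sup>2 * cos g))"

lemma ibp_rest_continuous: "continuous_on A (ibp_rest c s x)"
  unfolding ibp_rest_def Let_def by (intro continuous_intros)

text \<open>
  Near \<open>\<theta> = 0\<close> the remainder has size \<open>s\<close>, although it was obtained from \<open>(x - c s)\<^sup>2\<close>; each further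
  factor \<open>s\<close> comes with a factor \<open>\<theta>\<^sup>2\<close>, that is \<open>1 / s\<close> after integration against the Gaussian weight.
\<close>

lemma ibp_rest_bound:
  assumes c: "\<bar>c\<bar> \<le> 1" and s: "0 \<le> s"
  shows "\<bar>ibp_rest c s x \<theta>\<bar> \<le> 2 * s + 3 * s\<^sup>2 * \<theta>\<^sup>2"
proof -
  define g where "g = x * \<theta> - c * s * sin \<theta>"
  define v where "v = 1 - cos \<theta>"
  have v: "0 \<le> v" "v \<le> \<theta>\<^sup>2 / 2" "v \<le> 2"
    using one_minus_cos_le[of \<theta>] cos_ge_minus_one[of \<theta>] by (auto simp: v_def simp del: cos_ge_minus_one)
  have cg: "\<bar>cos g\<bar> \<le> 1" "\<bar>sin g\<bar> \<le> 1" "\<bar>cos \<theta>\<bar> \<le> 1" "\<bar>sin \<theta>\<bar> \<le> 1" by simp_all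
  have a1: "\<bar>(sin \<theta>)\<^sup>2 * cos g\<bar> \<le> \<theta>\<^sup>2"
  proof -
    have "(sin \<theta>)\<^sup>2 \<le> \<theta>\<^sup>2" by (rule abs_le_square_iff[THEN iffD1, OF abs_sin_x_le_abs_x])
    then have "(sin \<theta>)\<^sup>2 * \<bar>cos g\<bar> \<le> \<theta>\<^sup>2 * 1" using cg by (intro mult_mono) auto
    then show ?thesis by (simp add: abs_mult)
  qed
  have a2: "\<bar>cos \<theta> * cos g\<bar> \<le> 1"
    unfolding abs_mult using cg by (intro mult_le_one) auto
  have a3: "\<bar>c * (sin \<theta> * v * sin g)\<bar> \<le> \<theta>\<^sup>2 / 2"
  proof -
    have "\<bar>c\<bar> * (\<bar>sin \<theta>\<bar> * v * \<bar>sin g\<bar>) \<le> 1 * (1 * (\<theta>\<^sup>2 / 2) * 1)"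
      using cg c v by (intro mult_mono) auto
    then show ?thesis using v by (simp add: abs_mult)
  qed
  have a4: "\<bar>c * (sin \<theta> * sin g)\<bar> \<le> 1"
  proof -
    have "\<bar>c\<bar> * (\<bar>sin \<theta>\<bar> * \<bar>sin g\<bar>) \<le> 1 * (1 * 1)"
      using cg c by (intro mult_mono) auto
    then show ?thesis by (simp add: abs_mult)
  qed
  have a5: "\<bar>c * (c * (v\<^sup>2 * cos g))\<bar> \<le> \<theta>\<^sup>2"
  proof -
    have "v\<^sup>2 \<le> 2 * (\<theta>\<^sup>2 / 2)" unfolding power2_eq_square[of v] using v by (intro mult_mono) auto
    then have "\<bar>c\<bar> * (\<bar>c\<bar> * (v\<^sup>2 * \<bar>cos g\<bar>)) \<le> 1 * (1 * (\<theta>\<^sup>2 * 1))"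
      using cg c by (intro mult_mono) auto
    then show ?thesis by (simp add: abs_mult)
  qed
  have "ibp_rest c s x \<theta> = s\<^sup>2 * (- ((sin \<theta>)\<^sup>2 * cos g)) + s * (cos \<theta> * cos g)
      + s\<^sup>2 * (- (c * (sin \<theta> * v * sin g))) + s\<^sup>2 * (- (c * (sin \<theta> * v * sin g)))
      + s * (c * (sin \<theta> * sin g)) + s\<^sup>2 * (c * (c * (v\<^sup>2 * cos g)))"
    unfolding ibp_rest_def Let_def g_def[symmetric] v_def[symmetric]
    by (simp add: algebra_simps power2_eq_square)
  also have "\<bar>\<dots>\<bar> \<le> s\<^sup>2 * \<theta>\<^sup>2 + s * 1 + s\<^sup>2 * (\<theta>\<^sup>2 / 2) + s\<^sup>2 * (\<theta>\<^sup>2 / 2) + s * 1 + s\<^sup>2 * \<theta>\<^sup>2"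
  proof -
    have b: "\<bar>s\<^sup>2 * y\<bar> \<le> s\<^sup>2 * z" if "\<bar>y\<bar> \<le> z" for y z
      unfolding abs_mult using that by (auto intro!: mult_left_mono)
    have b': "\<bar>s * y\<bar> \<le> s * z" if "\<bar>y\<bar> \<le> z" for y z
      unfolding abs_mult using that s by (auto intro!: mult_left_mono)
    have tri: "\<bar>y1 + y2 + y3 + y4 + y5 + y6\<bar> \<le> z1 + z2 + z3 + z4 + z5 + z6"
      if "\<bar>y1\<bar> \<le> z1" "\<bar>y2\<bar> \<le> z2" "\<bar>y3\<bar> \<le> z3" "\<bar>y4\<bar> \<le> z4" "\<bar>y5\<bar> \<le> z5" "\<bar>y6\<bar> \<le> z6"
      for y1 y2 y3 y4 y5 y6 z1 z2 z3 z4 z5 z6 :: real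
      using that by linarith
    show ?thesis
      by (intro tri b b') (use a1 a2 a3 a4 a5 in simp_all)
  qed
  finally show ?thesis by (simp add: algebra_simps)
qed

text \<open>
  The phase \<open>g = x \<theta> - c s sin \<theta>\<close> has derivative \<open>(x - c s) + c s (1 - cos \<theta>)\<close>, so that multiplication
  by \<open>x - c s\<close> can be traded for differentiation. The two integrations by parts are collected in a
  single antiderivative, which vanishes at both ends because \<open>sin \<theta>\<close> and \<open>sin (x \<theta>)\<close> do, \<open>x\<close> being
  an integer.
\<close>

lemma lattice_mass_ibp:
  "(real_of_int x - c * s)\<^sup>2 * lattice_mass c s x
     = (LINT \<theta>:{-pi..pi}|lborel. exp (s * (cos \<theta> - 1)) * ibp_rest c s x \<theta>) / (2 * pi)"
proof -
  define D where "D = real_of_int x - c * s"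
  let ?g = "\<lambda>\<theta>. real_of_int x * \<theta> - c * s * sin \<theta>"
  let ?e = "\<lambda>\<theta>. exp (s * (cos \<theta> - 1))"
  let ?H = "\<lambda>\<theta>. ?e \<theta> * (D * sin (?g \<theta>) - s * sin \<theta> * cos (?g \<theta>) - c * s * (1 - cos \<theta>) * sin (?g \<theta>))"
  let ?h = "\<lambda>\<theta>. D\<^sup>2 * (?e \<theta> * cos (?g \<theta>)) - ?e \<theta> * ibp_rest c s x \<theta>"
  have "(LINT \<theta>|lborel. indicator {-pi..pi} \<theta> *\<^sub>R ?h \<theta>) = ?H pi - ?H (-pi)"
  proof (rule integral_FTC_Icc)
    fix \<theta>
    have "(?H has_real_derivative ?h \<theta>) (at \<theta>)"
      unfolding ibp_rest_def Let_def D_def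
      by (rule derivative_eq_intros refl)+ (simp add: algebra_simps power2_eq_square)
    then show "(?H has_vector_derivative ?h \<theta>) (at \<theta> within {-pi..pi})"
      unfolding has_real_derivative_iff_has_vector_derivative[symmetric]
      by (rule DERIV_subset) simp
  qed (auto intro!: continuous_intros ibp_rest_continuous)
  also have "\<dots> = 0"
    using sin_npi_int[of x] by (simp add: mult.commute)
  finally have 0: "(LINT \<theta>:{-pi..pi}|lborel. ?h \<theta>) = 0"
    unfolding set_lebesgue_integral_def .
  have i1: "set_integrable lborel {-pi..pi} (\<lambda>\<theta>. ?e \<theta> * cos (?g \<theta>))"
    by (intro borel_integrable_atLeastAtMost' continuous_intros)
  have i2: "set_integrable lborel {-pi..pi} (\<lambda>\<theta>. ?e \<theta> * ibp_rest c s x \<theta>)"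
    by (intro borel_integrable_atLeastAtMost' continuous_intros ibp_rest_continuous)
  have "(LINT \<theta>:{-pi..pi}|lborel. ?h \<theta>)
      = D\<^sup>2 * (LINT \<theta>:{-pi..pi}|lborel. ?e \<theta> * cos (?g \<theta>))
        - (LINT \<theta>:{-pi..pi}|lborel. ?e \<theta> * ibp_rest c s x \<theta>)"
    using i1 i2 by (subst set_integral_diff) simp_all
  with 0 show ?thesis
    unfolding D_def[symmetric] lattice_mass_def by simp
qed

lemma set_integral_pi_bound:
  fixes F G :: "real \<Rightarrow> real"
  assumes F: "continuous_on {-pi..pi} F" and FG: "\<And>\<theta>. \<bar>\<theta>\<bar> \<le> pi \<Longrightarrow> \<bar>F \<theta>\<bar> \<le> G \<theta>"
    and G: "integrable lborel G" "\<And>\<theta>. 0 \<le> G \<theta>"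
  shows "\<bar>LINT \<theta>:{-pi..pi}|lborel. F \<theta>\<bar> \<le> (LINT \<theta>|lborel. G \<theta>)"
proof -
  have int: "integrable lborel (\<lambda>\<theta>. indicator {-pi..pi} \<theta> *\<^sub>R F \<theta>)"
    using borel_integrable_atLeastAtMost'[OF F] unfolding set_integrable_def .
  have "\<bar>LINT \<theta>:{-pi..pi}|lborel. F \<theta>\<bar> \<le> (LINT \<theta>|lborel. \<bar>indicator {-pi..pi} \<theta> *\<^sub>R F \<theta>\<bar>)"
    unfolding set_lebesgue_integral_def by (rule integral_abs_bound)
  also have "\<dots> \<le> (LINT \<theta>|lborel. G \<theta>)"
  proof (rule integral_mono[OF integrable_abs[OF int] G(1)])
    fix \<theta> :: real
    show "\<bar>indicator {-pi..pi} \<theta> *\<^sub>R F \<theta>\<bar> \<le> G \<theta>"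
      using FG[of \<theta>] G(2)[of \<theta>] by (auto split: split_indicator)
  qed
  finally show ?thesis .
qed

lemma sqrt_18_pi_le: "sqrt (18 * pi) / (2 * pi) \<le> 2"
proof -
  have "sqrt (18 * pi) \<le> 9"
    using pi_less_4 by (intro real_le_lsqrt) auto
  then show ?thesis using pi_gt3 by (simp add: divide_le_eq)
qed

text \<open>
  The second bound is the essential one: it shows that the masses decay like the inverse square of the
  distance from the mean, measured in units of \<open>sqrt s\<close>, uniformly in \<open>s\<close>.
\<close>

lemma lattice_mass_bounds_large:
  assumes c: "\<bar>c\<bar> \<le> 1" and s: "0 < s"
  shows "sqrt s * \<bar>lattice_mass c s x\<bar> \<le> 2"
    and "(real_of_int x - c * s)\<^sup>2 * \<bar>lattice_mass c s x\<bar> \<le> 58 * sqrt s"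
proof -
  let ?K = "sqrt (18 * pi) / (2 * pi)"
  have e: "exp (s * (cos \<theta> - 1)) \<le> exp (- (s * \<theta>\<^sup>2 / 18))" if "\<bar>\<theta>\<bar> \<le> pi" for \<theta> :: real
    using mult_left_mono[OF cos_gap[OF that], of s] s by simp
  note gauss = gauss_weight_integral[OF s]
  have "\<bar>LINT \<theta>:{-pi..pi}|lborel. exp (s * (cos \<theta> - 1)) * cos (real_of_int x * \<theta> - c * s * sin \<theta>)\<bar>
      \<le> (LINT \<theta>|lborel. exp (- (s * \<theta>\<^sup>2 / 18)))"
  proof (rule set_integral_pi_bound[OF _ _ gauss(1)])
    fix \<theta> :: real assume "\<bar>\<theta>\<bar> \<le> pi"
    then have "exp (s * (cos \<theta> - 1)) * \<bar>cos (real_of_int x * \<theta> - c * s * sin \<theta>)\<bar>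
        \<le> exp (- (s * \<theta>\<^sup>2 / 18)) * 1"
      by (intro mult_mono e) auto
    then show "\<bar>exp (s * (cos \<theta> - 1)) * cos (real_of_int x * \<theta> - c * s * sin \<theta>)\<bar>
        \<le> exp (- (s * \<theta>\<^sup>2 / 18))"
      by (simp add: abs_mult)
  qed (auto intro!: continuous_intros)
  then have "\<bar>lattice_mass c s x\<bar> \<le> sqrt (18 * pi) / sqrt s / (2 * pi)"
    unfolding lattice_mass_def gauss(2) abs_divide
    by (simp only: abs_mult abs_of_nonneg[OF pi_ge_zero] abs_numeral) (rule divide_right_mono, simp_all)
  then have "sqrt s * \<bar>lattice_mass c s x\<bar> \<le> sqrt s * (sqrt (18 * pi) / sqrt s / (2 * pi))"
    using s by (intro mult_left_mono) auto
  also have "\<dots> = ?K" using s by simp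
  finally show "sqrt s * \<bar>lattice_mass c s x\<bar> \<le> 2"
    using sqrt_18_pi_le by linarith
  let ?G = "\<lambda>\<theta>. (2 * s) * exp (- (s * \<theta>\<^sup>2 / 18)) + (3 * s\<^sup>2) * (exp (- (s * \<theta>\<^sup>2 / 18)) * \<theta>\<^sup>2)"
  have "\<bar>LINT \<theta>:{-pi..pi}|lborel. exp (s * (cos \<theta> - 1)) * ibp_rest c s x \<theta>\<bar> \<le> (LINT \<theta>|lborel. ?G \<theta>)"
  proof (rule set_integral_pi_bound)
    fix \<theta> :: real assume "\<bar>\<theta>\<bar> \<le> pi"
    then have "exp (s * (cos \<theta> - 1)) * \<bar>ibp_rest c s x \<theta>\<bar>
        \<le> exp (- (s * \<theta>\<^sup>2 / 18)) * (2 * s + 3 * s\<^sup>2 * \<theta>\<^sup>2)"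
      using s by (intro mult_mono e ibp_rest_bound c) auto
    then show "\<bar>exp (s * (cos \<theta> - 1)) * ibp_rest c s x \<theta>\<bar> \<le> ?G \<theta>"
      by (simp add: abs_mult algebra_simps)
  next
    show "integrable lborel ?G"
      by (intro Bochner_Integration.integrable_add integrable_mult_right gauss(1) gauss(3))
  qed (use s in \<open>auto intro!: continuous_intros ibp_rest_continuous\<close>)
  also have "(LINT \<theta>|lborel. ?G \<theta>)
      = (2 * s) * (sqrt (18 * pi) / sqrt s) + (3 * s\<^sup>2) * (9 * sqrt (18 * pi) / (s * sqrt s))"
    unfolding gauss(2)[symmetric] gauss(4)[symmetric]
    by (subst Bochner_Integration.integral_add)
       (simp_all only: integral_mult_right_zero integrable_mult_right gauss(1) gauss(3))
  also have "\<dots> = 29 * sqrt (18 * pi) * sqrt s"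
  proof -
    have "s / sqrt s = sqrt s" using s by (simp add: real_div_sqrt)
    then have "(2 * s) * (sqrt (18 * pi) / sqrt s) = 2 * sqrt (18 * pi) * sqrt s"
      "(3 * s\<^sup>2) * (9 * sqrt (18 * pi) / (s * sqrt s)) = 27 * sqrt (18 * pi) * sqrt s"
      using s by (simp_all add: power2_eq_square field_simps)
    then show ?thesis by simp
  qed
  finally have "\<bar>LINT \<theta>:{-pi..pi}|lborel. exp (s * (cos \<theta> - 1)) * ibp_rest c s x \<theta>\<bar> / (2 * pi)
      \<le> 29 * sqrt (18 * pi) * sqrt s / (2 * pi)"
    by (intro divide_right_mono) auto
  also have "\<dots> = ?K * (29 * sqrt s)" by simp
  also have "\<dots> \<le> 2 * (29 * sqrt s)"
    using s by (intro mult_right_mono sqrt_18_pi_le) auto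
  finally have "\<bar>(real_of_int x - c * s)\<^sup>2 * lattice_mass c s x\<bar> \<le> 58 * sqrt s"
    unfolding lattice_mass_ibp by (simp add: abs_divide)
  then show "(real_of_int x - c * s)\<^sup>2 * \<bar>lattice_mass c s x\<bar> \<le> 58 * sqrt s"
    by (simp add: abs_mult)
qed

text \<open>
  For bounded times no scaling is needed and the Fourier integrand may be bounded by constants. The
  estimate serves the continuity of the entropy, also at times close to \<open>0\<close>.
\<close>

lemma lattice_mass_bounds_small:
  assumes c: "\<bar>c\<bar> \<le> 1" and s: "0 \<le> s" "s \<le> S" and S: "1 \<le> S"
  shows "\<bar>lattice_mass c s x\<bar> \<le> 1"
    and "(real_of_int x - c * s)\<^sup>2 * \<bar>lattice_mass c s x\<bar> \<le> 50 * S\<^sup>2"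
proof -
  have e: "exp (s * (cos \<theta> - 1)) \<le> 1" for \<theta> :: real
    using s by (simp add: mult_nonneg_nonpos)
  have I: "integrable lborel (\<lambda>\<theta>::real. B * indicator {-pi..pi} \<theta>)"
    "(LINT \<theta>::real|lborel. B * indicator {-pi..pi} \<theta>) = B * (2 * pi)" for B
    by simp_all
  have "\<bar>LINT \<theta>:{-pi..pi}|lborel. exp (s * (cos \<theta> - 1)) * cos (real_of_int x * \<theta> - c * s * sin \<theta>)\<bar>
      \<le> (LINT \<theta>::real|lborel. 1 * indicator {-pi..pi} \<theta>)"
  proof (rule set_integral_pi_bound[OF _ _ I(1)])
    fix \<theta> :: real assume "\<bar>\<theta>\<bar> \<le> pi"
    then have "indicator {-pi..pi} \<theta> = (1 :: real)" by (auto simp: indicator_def)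
    moreover have "exp (s * (cos \<theta> - 1)) * \<bar>cos (real_of_int x * \<theta> - c * s * sin \<theta>)\<bar> \<le> 1"
      by (intro mult_le_one e) auto
    ultimately show "\<bar>exp (s * (cos \<theta> - 1)) * cos (real_of_int x * \<theta> - c * s * sin \<theta>)\<bar>
        \<le> 1 * indicator {-pi..pi} \<theta>"
      by (simp add: abs_mult)
  qed (auto intro!: continuous_intros)
  then show "\<bar>lattice_mass c s x\<bar> \<le> 1"
    unfolding I(2) lattice_mass_def by (simp add: abs_divide)
  have "\<bar>LINT \<theta>:{-pi..pi}|lborel. exp (s * (cos \<theta> - 1)) * ibp_rest c s x \<theta>\<bar>
      \<le> (LINT \<theta>::real|lborel. (50 * S\<^sup>2) * indicator {-pi..pi} \<theta>)"
  proof (rule set_integral_pi_bound[OF _ _ I(1)])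
    fix \<theta> :: real assume \<theta>: "\<bar>\<theta>\<bar> \<le> pi"
    then have "indicator {-pi..pi} \<theta> = (1 :: real)" by (auto simp: indicator_def)
    moreover have "\<bar>ibp_rest c s x \<theta>\<bar> \<le> 50 * S\<^sup>2"
    proof -
      have "\<theta>\<^sup>2 \<le> 4\<^sup>2" using \<theta> pi_less_4 by (intro abs_le_square_iff[THEN iffD1]) auto
      then have "s\<^sup>2 * \<theta>\<^sup>2 \<le> S\<^sup>2 * 16" using s by (intro mult_mono power_mono) auto
      moreover have "s \<le> S\<^sup>2" using s S by (meson order_trans self_le_power zero_less_numeral)
      ultimately show ?thesis using ibp_rest_bound[OF c s(1), of x \<theta>] by linarith
    qed
    then have "exp (s * (cos \<theta> - 1)) * \<bar>ibp_rest c s x \<theta>\<bar> \<le> 1 * (50 * S\<^sup>2)"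
      by (intro mult_mono e) auto
    ultimately show "\<bar>exp (s * (cos \<theta> - 1)) * ibp_rest c s x \<theta>\<bar> \<le> 50 * S\<^sup>2 * indicator {-pi..pi} \<theta>"
      by (simp add: abs_mult)
  qed (auto intro!: continuous_intros ibp_rest_continuous)
  then have "\<bar>LINT \<theta>:{-pi..pi}|lborel. exp (s * (cos \<theta> - 1)) * ibp_rest c s x \<theta>\<bar> / (2 * pi)
      \<le> 50 * S\<^sup>2 * (2 * pi) / (2 * pi)"
    unfolding I(2) by (intro divide_right_mono) auto
  then have "\<bar>(real_of_int x - c * s)\<^sup>2 * lattice_mass c s x\<bar> \<le> 50 * S\<^sup>2"
    unfolding lattice_mass_ibp by (simp add: abs_divide)
  then show "(real_of_int x - c * s)\<^sup>2 * \<bar>lattice_mass c s x\<bar> \<le> 50 * S\<^sup>2"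
    by (simp add: abs_mult)
qed

text \<open>
  The step function whose integral over the line equals the total mass; it is the density of the
  standardised coordinate smeared over lattice cells.
\<close>

definition rescaled_mass :: "real \<Rightarrow> real \<Rightarrow> real \<Rightarrow> real" where
  "rescaled_mass c s y = sqrt s * lattice_mass c s \<lfloor>c * s + sqrt s * y\<rfloor>"

text \<open>
  The constant is \<open>8 * 2 + 2 * 58\<close>, from \<open>(1 + \<bar>y\<bar>)\<^sup>2 \<le> 8 + 2 d\<^sup>2\<close>, where \<open>d\<close> is the standardised lattice
  point of the cell containing \<open>y\<close>.
\<close>

lemma rescaled_mass_bound:
  assumes c: "\<bar>c\<bar> \<le> 1" and s: "1 \<le> s"
  shows "\<bar>rescaled_mass c s y\<bar> \<le> 132 / (1 + \<bar>y\<bar>)\<^sup>2"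
proof -
  define x where "x = \<lfloor>c * s + sqrt s * y\<rfloor>"
  define d where "d = (real_of_int x - c * s) / sqrt s"
  define f where "f = \<bar>rescaled_mass c s y\<bar>"
  have s1: "1 \<le> sqrt s" "0 < sqrt s" "0 < s" using s by auto
  have f: "f = sqrt s * \<bar>lattice_mass c s x\<bar>"
    using s1 by (simp add: f_def rescaled_mass_def x_def abs_mult)
  have f2: "f \<le> 2"
    unfolding f by (rule lattice_mass_bounds_large[OF c s1(3)])
  have fd: "d\<^sup>2 * f \<le> 58"
  proof -
    have "d\<^sup>2 * f = (real_of_int x - c * s)\<^sup>2 * \<bar>lattice_mass c s x\<bar> / sqrt s"
      using s1 unfolding f d_def by (simp add: power_divide field_simps real_sqrt_mult_self)
    also have "\<dots> \<le> 58 * sqrt s / sqrt s"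
      using s1 by (intro divide_right_mono lattice_mass_bounds_large[OF c s1(3)]) auto
    finally show ?thesis using s1 by simp
  qed
  have "\<bar>y\<bar> \<le> \<bar>d\<bar> + 1"
  proof -
    define r where "r = frac (c * s + sqrt s * y)"
    have r: "0 \<le> r" "r \<le> 1"
      unfolding r_def using frac_lt_1[of "c * s + sqrt s * y"] by auto
    have "sqrt s * y = (real_of_int x - c * s) + r"
      by (simp add: x_def r_def frac_def)
    then have "sqrt s * y / sqrt s = ((real_of_int x - c * s) + r) / sqrt s"
      by (rule arg_cong)
    then have "y = d + r / sqrt s"
      using s1 unfolding d_def add_divide_distrib[symmetric] by simp
    moreover have "0 \<le> r / sqrt s" "r / sqrt s \<le> 1"
      using s1 r order_trans[OF r(2) s1(1)] by (simp_all add: divide_le_eq)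
    ultimately show ?thesis by linarith
  qed
  then have "(1 + \<bar>y\<bar>)\<^sup>2 \<le> (2 + \<bar>d\<bar>)\<^sup>2" by (intro power_mono) auto
  also have "\<dots> \<le> 8 + 2 * d\<^sup>2"
    using zero_le_power2[of "\<bar>d\<bar> - 2"] by (simp add: power2_eq_square algebra_simps)
  finally have "(1 + \<bar>y\<bar>)\<^sup>2 * f \<le> (8 + 2 * d\<^sup>2) * f"
    by (intro mult_right_mono) (simp_all add: f_def)
  also have "\<dots> \<le> 132" using f2 fd by (simp add: algebra_simps)
  finally show ?thesis
    unfolding f_def[symmetric] by (simp add: pos_le_divide_eq mult.commute add_pos_nonneg)
qed

lemma lattice_mass_floor_bound:
  assumes c: "\<bar>c\<bar> \<le> 1" and s: "0 \<le> s" "s \<le> S" and S: "1 \<le> S"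
  shows "\<bar>lattice_mass c s \<lfloor>y\<rfloor>\<bar> \<le> 118 * S\<^sup>2 / (1 + \<bar>y\<bar>)\<^sup>2"
proof -
  define d where "d = real_of_int \<lfloor>y\<rfloor> - c * s"
  define f where "f = \<bar>lattice_mass c s \<lfloor>y\<rfloor>\<bar>"
  have f1: "f \<le> 1" and fd: "d\<^sup>2 * f \<le> 50 * S\<^sup>2" and f0: "0 \<le> f"
    unfolding f_def d_def by (rule lattice_mass_bounds_small[OF c s S] abs_ge_zero)+
  have "\<bar>c * s\<bar> \<le> 1 * S" unfolding abs_mult using c s by (intro mult_mono) auto
  then have "\<bar>y\<bar> \<le> \<bar>d\<bar> + S + 1"
    unfolding d_def using floor_le_iff[of y] of_int_floor_le[of y] real_of_int_floor_add_one_ge[of y] by linarith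
  then have "(1 + \<bar>y\<bar>)\<^sup>2 \<le> (3 * S + \<bar>d\<bar>)\<^sup>2" using S by (intro power_mono) auto
  also have "\<dots> \<le> 18 * S\<^sup>2 + 2 * d\<^sup>2"
    using zero_le_power2[of "\<bar>d\<bar> - 3 * S"] by (simp add: power2_eq_square algebra_simps)
  finally have "(1 + \<bar>y\<bar>)\<^sup>2 * f \<le> (18 * S\<^sup>2 + 2 * d\<^sup>2) * f"
    using f0 by (intro mult_right_mono)
  also have "\<dots> = 18 * S\<^sup>2 * f + 2 * (d\<^sup>2 * f)" by (simp add: algebra_simps)
  also have "\<dots> \<le> 18 * S\<^sup>2 * 1 + 2 * (50 * S\<^sup>2)"
    using f1 fd by (intro add_mono mult_left_mono) auto
  finally show ?thesis
    unfolding f_def[symmetric] by (simp add: pos_le_divide_eq mult.commute add_pos_nonneg)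
qed

section \<open>The local limit theorem\<close>

text \<open>
  The Gaussian density is, up to a constant, its own Fourier transform; here the known characteristic
  function is read with the roles of space and frequency exchanged.
\<close>

lemma gaussian_cos_integral:
  "(LINT u|lborel. exp (- (u\<^sup>2 / 2)) * cos (y * u)) = 2 * pi * std_normal_density y"
proof -
  interpret real_distribution std_normal_distribution by (rule real_dist_normal_dist)
  have "exp (- (y\<^sup>2 / 2)) = Re (char std_normal_distribution y)"
    by (simp add: char_std_normal_distribution)
  also have "\<dots> = (LINT u|std_normal_distribution. Re (iexp (y * u)))"
    unfolding char_def by (rule integral_Re[symmetric]) (rule integrable_iexp, simp_all)
  also have "\<dots> = (LINT u|std_normal_distribution. cos (y * u))"
    by (simp add: Re_exp)
  also have "\<dots> = (LINT u|lborel. std_normal_density u * cos (y * u))"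
    by (subst integral_density) simp_all
  also have "\<dots> = (LINT u|lborel. (1 / sqrt (2 * pi)) * (exp (- (u\<^sup>2 / 2)) * cos (y * u)))"
    by (simp add: std_normal_density_def)
  also have "\<dots> = (1 / sqrt (2 * pi)) * (LINT u|lborel. exp (- (u\<^sup>2 / 2)) * cos (y * u))"
    by (rule integral_mult_right_zero)
  finally have "(LINT u|lborel. exp (- (u\<^sup>2 / 2)) * cos (y * u)) = sqrt (2 * pi) * exp (- (y\<^sup>2 / 2))"
    by (simp add: field_simps)
  also have "\<dots> = 2 * pi * (1 / sqrt (2 * pi) * exp (- (y\<^sup>2 / 2)))"
  proof -
    have "2 * pi / sqrt (2 * pi) = sqrt (2 * pi)" by (simp add: real_div_sqrt)
    then show ?thesis by (simp add: field_simps)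
  qed
  finally show ?thesis by (simp add: std_normal_density_def)
qed

lemma cos_rescaled_tendsto: "((\<lambda>s. s * (cos (u / sqrt s) - 1)) \<longlongrightarrow> - (u\<^sup>2 / 2)) at_top" for u :: real
proof (cases u "0 :: real" rule: linorder_cases)
  case less
  then show ?thesis by (real_asymp simp: power2_eq_square)
next
  case greater
  then show ?thesis by (real_asymp simp: power2_eq_square)
qed simp

lemma sin_rescaled_tendsto: "((\<lambda>s. s * (u / sqrt s - sin (u / sqrt s))) \<longlongrightarrow> 0) at_top" for u :: real
proof (cases u "0 :: real" rule: linorder_cases)
  case less
  then show ?thesis by (real_asymp simp: power2_eq_square)
next
  case greater
  then show ?thesis by (real_asymp simp: power2_eq_square)
qed simp

text \<open>
  The substitution \<open>\<theta> = u / sqrt s\<close>. The phase is written so that each part has an evident limit: the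
  standardised lattice point tends to \<open>y\<close>, and the remaining term tends to \<open>0\<close>.
\<close>

lemma rescaled_mass_eq:
  assumes s: "0 < s"
  shows "rescaled_mass c s y = (LINT u|lborel. indicator {-pi..pi} (u / sqrt s) *
      (exp (s * (cos (u / sqrt s) - 1)) *
       cos (u * ((real_of_int \<lfloor>c * s + sqrt s * y\<rfloor> - c * s) / sqrt s)
            + c * (s * (u / sqrt s - sin (u / sqrt s)))))) / (2 * pi)"
proof -
  define x where "x = \<lfloor>c * s + sqrt s * y\<rfloor>"
  let ?F = "\<lambda>\<theta>. indicator {-pi..pi} \<theta> * (exp (s * (cos \<theta> - 1)) * cos (real_of_int x * \<theta> - c * s * sin \<theta>))"
  have r: "0 < sqrt s" using s by simp
  have "(LINT \<theta>|lborel. ?F \<theta>) = \<bar>1 / sqrt s\<bar> *\<^sub>R (LINT u|lborel. ?F (0 + 1 / sqrt s * u))"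
    using r by (intro lborel_integral_real_affine) simp
  then have "sqrt s * (LINT \<theta>|lborel. ?F \<theta>) = (LINT u|lborel. ?F (u / sqrt s))"
    using r by simp
  also have "(\<lambda>u. ?F (u / sqrt s)) = (\<lambda>u. indicator {-pi..pi} (u / sqrt s) *
      (exp (s * (cos (u / sqrt s) - 1)) *
       cos (u * ((real_of_int x - c * s) / sqrt s) + c * (s * (u / sqrt s - sin (u / sqrt s))))))"
  proof
    fix u
    have "real_of_int x * (u / sqrt s) - c * s * sin (u / sqrt s)
        = u * ((real_of_int x - c * s) / sqrt s) + c * (s * (u / sqrt s - sin (u / sqrt s)))"
      using r by (simp add: field_simps)
    then show "?F (u / sqrt s) = indicator {-pi..pi} (u / sqrt s) *
      (exp (s * (cos (u / sqrt s) - 1)) *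
       cos (u * ((real_of_int x - c * s) / sqrt s) + c * (s * (u / sqrt s - sin (u / sqrt s)))))"
      by (simp only:)
  qed
  finally show ?thesis
    unfolding rescaled_mass_def lattice_mass_def set_lebesgue_integral_def x_def[symmetric] real_scaleR_def
    by (simp only: times_divide_eq_right)
qed

text \<open>
  The local limit theorem, by dominated convergence in frequency space; \<open>cos_gap\<close> provides a Gaussian
  majorant.
\<close>

lemma rescaled_mass_tendsto:
  assumes S': "filterlim S' at_top sequentially"
  shows "(\<lambda>n. rescaled_mass c (S' n) y) \<longlonglongrightarrow> std_normal_density y"
proof -
  \<comment> \<open>Dominated convergence needs the majorant for every index, and the bounds hold from \<open>1\<close> on.\<close>
  define S where "S n = max 1 (S' n)" for n
  have S1: "1 \<le> S n" for n by (simp add: S_def)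
  have S: "filterlim S at_top sequentially"
    by (rule filterlim_at_top_mono[OF S']) (simp add: S_def)
  let ?G = "\<lambda>s u. indicator {-pi..pi} (u / sqrt s) *
      (exp (s * (cos (u / sqrt s) - 1)) *
       cos (u * ((real_of_int \<lfloor>c * s + sqrt s * y\<rfloor> - c * s) / sqrt s)
            + c * (s * (u / sqrt s - sin (u / sqrt s)))))"
  have centre: "((\<lambda>s. (real_of_int \<lfloor>c * s + sqrt s * y\<rfloor> - c * s) / sqrt s) \<longlongrightarrow> y) at_top"
  proof (rule tendsto_sandwich)
    show "\<forall>\<^sub>F s in at_top. y - 1 / sqrt s \<le> (real_of_int \<lfloor>c * s + sqrt s * y\<rfloor> - c * s) / sqrt s"
      using eventually_gt_at_top[of 0]
    proof eventually_elim
      fix s :: real assume "0 < s"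
      then have "0 < sqrt s" by simp
      have "sqrt s * y - 1 \<le> real_of_int \<lfloor>c * s + sqrt s * y\<rfloor> - c * s"
        by linarith
      with \<open>0 < sqrt s\<close> have "(sqrt s * y - 1) / sqrt s \<le> (real_of_int \<lfloor>c * s + sqrt s * y\<rfloor> - c * s) / sqrt s"
        by (intro divide_right_mono) auto
      then show "y - 1 / sqrt s \<le> (real_of_int \<lfloor>c * s + sqrt s * y\<rfloor> - c * s) / sqrt s"
        using \<open>0 < sqrt s\<close> by (simp add: diff_divide_distrib)
    qed
    show "\<forall>\<^sub>F s in at_top. (real_of_int \<lfloor>c * s + sqrt s * y\<rfloor> - c * s) / sqrt s \<le> y"
      using eventually_gt_at_top[of 0]
    proof eventually_elim
      fix s :: real assume "0 < s"
      then have "0 < sqrt s" by simp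
      moreover have "real_of_int \<lfloor>c * s + sqrt s * y\<rfloor> - c * s \<le> sqrt s * y"
        by linarith
      ultimately show "(real_of_int \<lfloor>c * s + sqrt s * y\<rfloor> - c * s) / sqrt s \<le> y"
        by (simp add: pos_divide_le_eq mult.commute)
    qed
    show "((\<lambda>s. y - 1 / sqrt s) \<longlongrightarrow> y) at_top" by real_asymp
  qed simp
  have "(\<lambda>n. LINT u|lborel. ?G (S n) u) \<longlonglongrightarrow> (LINT u|lborel. exp (- (u\<^sup>2 / 2)) * cos (y * u))"
  proof (rule integral_dominated_convergence)
    show "integrable lborel (\<lambda>u::real. exp (- (u\<^sup>2 / 18)))"
      using gauss_weight_integral(1)[of 1] by simp
    show "AE u in lborel. (\<lambda>n. ?G (S n) u) \<longlonglongrightarrow> exp (- (u\<^sup>2 / 2)) * cos (y * u)"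
    proof (rule AE_I2)
      fix u :: real
      have 0: "((\<lambda>s. u / sqrt s) \<longlongrightarrow> 0) at_top"
        by real_asymp
      then have "\<forall>\<^sub>F s in at_top. \<bar>u / sqrt s\<bar> < pi"
        using tendstoD[OF 0, of pi] by (simp add: dist_real_def)
      then have "((\<lambda>s. indicator {-pi..pi} (u / sqrt s) :: real) \<longlongrightarrow> 1) at_top"
        by (intro tendsto_eventually) (auto elim!: eventually_mono simp: indicator_def abs_less_iff simp del: abs_divide)
      then have "((\<lambda>s. ?G s u) \<longlongrightarrow> 1 * (exp (- (u\<^sup>2 / 2)) * cos (u * y + c * 0))) at_top"
        by (intro tendsto_mult tendsto_exp tendsto_cos tendsto_add tendsto_const
            cos_rescaled_tendsto sin_rescaled_tendsto centre)
      then have "((\<lambda>s. ?G s u) \<longlongrightarrow> exp (- (u\<^sup>2 / 2)) * cos (y * u)) at_top"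
        by (simp add: mult.commute)
      from filterlim_compose[OF this S]
      show "(\<lambda>n. ?G (S n) u) \<longlonglongrightarrow> exp (- (u\<^sup>2 / 2)) * cos (y * u)" .
    qed
    show "AE u in lborel. norm (?G (S n) u) \<le> exp (- (u\<^sup>2 / 18))" for n
    proof (rule AE_I2)
      fix u :: real
      have r: "0 < S n" using S1[of n] by simp
      show "norm (?G (S n) u) \<le> exp (- (u\<^sup>2 / 18))"
      proof (cases "u / sqrt (S n) \<in> {-pi..pi}")
        case True
        then have "\<bar>u / sqrt (S n)\<bar> \<le> pi" by (simp add: abs_le_iff del: abs_divide)
        from mult_left_mono[OF cos_gap[OF this], of "S n"]
        have "exp (S n * (cos (u / sqrt (S n)) - 1)) \<le> exp (- (u\<^sup>2 / 18))"
          using r by (simp add: power_divide)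
        then have "exp (S n * (cos (u / sqrt (S n)) - 1)) * \<bar>cos v\<bar> \<le> exp (- (u\<^sup>2 / 18)) * 1" for v
          by (intro mult_mono) auto
        then show ?thesis using True by (simp add: abs_mult)
      qed simp
    qed
    show "?G (S n) \<in> borel_measurable lborel" for n
      by simp
  qed simp
  then have "(\<lambda>n. (LINT u|lborel. ?G (S n) u) / (2 * pi)) \<longlonglongrightarrow> (2 * pi * std_normal_density y) / (2 * pi)"
    unfolding gaussian_cos_integral by (intro tendsto_divide tendsto_const) simp_all
  moreover have "\<forall>\<^sub>F n in sequentially. (LINT u|lborel. ?G (S n) u) / (2 * pi) = rescaled_mass c (S' n) y"
    using filterlim_at_top_dense[THEN iffD1, OF S', rule_format, of 1]
  proof eventually_elim
    fix n assume "1 < S' n"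
    then show "(LINT u|lborel. ?G (S n) u) / (2 * pi) = rescaled_mass c (S' n) y"
      using rescaled_mass_eq[of "S' n" c y] by (simp add: S_def)
  qed
  ultimately show ?thesis
    using Lim_transform_eventually[of "\<lambda>n. (LINT u|lborel. ?G (S n) u) / (2 * pi)"] by simp
qed

section \<open>Moments of the logarithm of the point masses\<close>

text \<open>
  A power of \<open>ln t\<close> costs only an arbitrarily small power of \<open>t\<close>, so \<open>t \<bar>ln t\<bar>\<^sup>j\<close> is at most a multiple of
  \<open>t powr (3/4)\<close> on bounded sets. Inverse square decay of \<open>t\<close> thereby becomes decay of order \<open>3/2\<close>,
  which is still integrable. The value at \<open>t = 0\<close> is \<open>0\<close>.
\<close>

lemma ln_power_envelope:
  fixes t a K :: real
  assumes t: "0 \<le> t" "t \<le> K / (1 + a)\<^sup>2" and a: "0 \<le> a" and K: "1 \<le> K" and j: "j \<le> 4"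
  shows "\<bar>t * ln t ^ j\<bar> \<le> 65537 * K\<^sup>2 * (1 + a) powr (-3/2)"
proof (cases "t = 0")
  case False
  with t have t0: "0 < t" by simp
  have "K / (1 + a)\<^sup>2 \<le> K / 1"
    using K a by (intro divide_left_mono) (auto simp: one_le_power)
  then have tK: "t \<le> K" using t by simp
  have "\<bar>ln t\<bar> \<le> 16 * K powr (1/8) * t powr (-1/16)"
  proof (cases "1 \<le> t")
    case True
    have "ln t \<le> t powr (1/16) / (1/16)"
      using True by (intro ln_powr_bound) auto
    also have "\<dots> = 16 * (t powr (1/8) * t powr (-1/16))"
      by (simp add: powr_add[symmetric])
    also have "\<dots> \<le> 16 * (K powr (1/8) * t powr (-1/16))"
      using tK t0 by (intro mult_left_mono mult_right_mono powr_mono2) auto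
    finally show ?thesis using True by simp
  next
    case False
    then have "ln (1 / t) \<le> (1 / t) powr (1/16) / (1/16)"
      using t0 by (intro ln_powr_bound) auto
    also have "(1 / t) powr (1/16) = t powr (-1/16)"
      using t0 by (simp add: powr_divide powr_minus_divide)
    also have "t powr (-1/16) / (1/16) \<le> 16 * (K powr (1/8) * t powr (-1/16))"
      using K by (simp add: ge_one_powr_ge_zero mult_le_cancel_right1)
    finally have "- ln t \<le> 16 * (K powr (1/8) * t powr (-1/16))"
      using t0 by (simp add: ln_div)
    then show ?thesis using False t0 by simp
  qed
  then have "\<bar>ln t\<bar> ^ 4 \<le> (16 * K powr (1/8) * t powr (-1/16)) ^ 4"
    by (intro power_mono) auto
  also have "\<dots> = 65536 * (K powr (1/2) * t powr (-1/4))"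
    using t0 K by (simp add: power_mult_distrib powr_power)
  finally have ln4: "\<bar>ln t\<bar> ^ 4 \<le> 65536 * (K powr (1/2) * t powr (-1/4))" .
  have lnj: "\<bar>ln t\<bar> ^ j \<le> 1 + \<bar>ln t\<bar> ^ 4"
  proof (cases "\<bar>ln t\<bar> \<le> 1")
    case True
    then have "\<bar>ln t\<bar> ^ j \<le> 1" by (intro power_le_one) auto
    moreover have "0 \<le> \<bar>ln t\<bar> ^ 4" by simp
    ultimately show ?thesis by linarith
  next
    case False
    then have "\<bar>ln t\<bar> ^ j \<le> \<bar>ln t\<bar> ^ 4" using j by (intro power_increasing) auto
    then show ?thesis by linarith
  qed
  have "\<bar>t * ln t ^ j\<bar> = t * \<bar>ln t\<bar> ^ j"
    using t0 by (simp add: abs_mult power_abs)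
  also have "\<dots> \<le> t * (1 + 65536 * (K powr (1/2) * t powr (-1/4)))"
    using lnj ln4 t0 by (intro mult_left_mono) auto
  also have "\<dots> = t powr (1/4) * t powr (3/4) + 65536 * K powr (1/2) * t powr (3/4)"
  proof -
    have "t powr (1/4) * t powr (3/4) = t" "t * t powr (-1/4) = t powr (3/4)"
      using t0 powr_add[of t 1 "-1/4"] by (simp_all add: powr_add[symmetric])
    then show ?thesis by (simp add: algebra_simps)
  qed
  also have "\<dots> \<le> K powr (1/2) * t powr (3/4) + 65536 * K powr (1/2) * t powr (3/4)"
  proof -
    have "t powr (1/4) \<le> K powr (1/4)" using tK t0 by (intro powr_mono2) auto
    also have "\<dots> \<le> K powr (1/2)" using K by (intro powr_mono) auto
    finally show ?thesis by (intro add_right_mono mult_right_mono) auto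
  qed
  also have "\<dots> = 65537 * K powr (1/2) * t powr (3/4)" by simp
  also have "\<dots> \<le> 65537 * K powr (1/2) * (K powr (3/4) * (1 + a) powr (-3/2))"
  proof -
    have "t powr (3/4) \<le> (K / (1 + a)\<^sup>2) powr (3/4)"
      using t t0 by (intro powr_mono2) auto
    also have "\<dots> = K powr (3/4) * (1 + a) powr (-3/2)"
    proof -
      have "(1 + a)\<^sup>2 = (1 + a) powr 2" using a by (simp add: powr_numeral)
      then have "((1 + a)\<^sup>2) powr (3/4) = (1 + a) powr (3/2)"
        by (simp only: powr_powr) simp
      then have "(K / (1 + a)\<^sup>2) powr (3/4) = K powr (3/4) / ((1 + a) powr (3/2))"
        using a K by (simp add: powr_divide)
      then show ?thesis by (simp add: powr_minus_divide)
    qed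
    finally show ?thesis by (intro mult_left_mono) auto
  qed
  also have "\<dots> = 65537 * K powr (5/4) * (1 + a) powr (-3/2)"
    by (simp add: powr_add[symmetric] mult.assoc[symmetric])
  also have "\<dots> \<le> 65537 * K\<^sup>2 * (1 + a) powr (-3/2)"
  proof -
    have "K powr (5/4) \<le> K powr 2" using K by (intro powr_mono) auto
    then show ?thesis using K by (intro mult_right_mono mult_left_mono) (auto simp: powr_numeral)
  qed
  finally show ?thesis .
qed simp

lemma integrable_envelope: "integrable lborel (\<lambda>y::real. (1 + \<bar>y\<bar>) powr (-3/2))"
proof -
  let ?h = "\<lambda>y::real. indicator {0..} y * (1 + y) powr (-3/2)"
  have "(\<integral>\<^sup>+y. ennreal ((1 + y) powr (-3/2)) * indicator {0..} y \<partial>lborel)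
      = ennreal (0 - (- 2 * (1 + 0) powr (-1/2)))"
  proof (rule nn_integral_FTC_atLeast)
    fix y :: real assume "0 \<le> y"
    then show "((\<lambda>y. - 2 * (1 + y) powr (-1/2)) has_real_derivative (1 + y) powr (-3/2)) (at y)"
      by (auto intro!: derivative_eq_intros)
  next
    show "((\<lambda>y::real. - 2 * (1 + y) powr (-1/2)) \<longlongrightarrow> 0) at_top"
      by real_asymp
  qed auto
  then have "(\<integral>\<^sup>+y. ennreal (?h y) \<partial>lborel) < \<infinity>"
    by (subst nn_integral_cong[where v = "\<lambda>y. ennreal ((1 + y) powr (-3/2)) * indicator {0..} y"])
       (auto split: split_indicator)
  then have h: "integrable lborel ?h"
    by (intro integrableI_nonneg) auto
  have "integrable lborel (\<lambda>y. ?h (0 + (-1) * y))"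
    by (rule lborel_integrable_real_affine[OF h]) simp
  with h have "integrable lborel (\<lambda>y. ?h y + ?h (0 + (-1) * y))"
    by (rule Bochner_Integration.integrable_add)
  then show ?thesis
  proof (rule Bochner_Integration.integrable_bound)
    show "AE y in lborel. norm ((1 + \<bar>y\<bar>) powr (-3/2)) \<le> norm (?h y + ?h (0 + (-1) * y))"
      by (intro AE_I2) (auto split: split_indicator)
  qed simp
qed

text \<open>
  Sums over the integers are integrals over the line of functions of the integer part, so that
  dominated convergence can be applied on a fixed measure space for all scales.
\<close>

lemma distr_floor_lborel: "distr lborel (count_space UNIV) (floor :: real \<Rightarrow> int) = count_space UNIV"
proof (rule measure_eqI_countable[where A = UNIV])
  fix n :: int
  have "(floor :: real \<Rightarrow> int) -` {n} = {real_of_int n..<real_of_int n + 1}"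
    by (auto simp: floor_eq_iff)
  then show "emeasure (distr lborel (count_space UNIV) (floor :: real \<Rightarrow> int)) {n} = emeasure (count_space UNIV) {n}"
    by (subst emeasure_distr) (simp_all add: measurable_real_floor)
qed auto

lemma integral_count_int_floor:
  fixes F :: "int \<Rightarrow> real"
  shows "(LINT x|count_space UNIV. F x) = (LINT y::real|lborel. F \<lfloor>y\<rfloor>)"
    and "integrable (count_space UNIV) F \<longleftrightarrow> integrable lborel (\<lambda>y::real. F \<lfloor>y\<rfloor>)"
  by (subst distr_floor_lborel[symmetric], subst integral_distr integrable_distr_eq,
      simp_all add: measurable_real_floor)+

lemma integral_count_int_scaled:
  fixes F :: "int \<Rightarrow> real"
  assumes "0 < (r::real)"
  shows "(LINT x|count_space UNIV. F x) = r * (LINT y|lborel. F \<lfloor>m + r * y\<rfloor>)"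
    and "integrable (count_space UNIV) F \<longleftrightarrow> integrable lborel (\<lambda>y. F \<lfloor>m + r * y\<rfloor>)"
  using assms lborel_integral_real_affine[of r "\<lambda>y::real. F \<lfloor>y\<rfloor>" m]
    lborel_integrable_real_affine_iff[of r "\<lambda>y::real. F \<lfloor>y\<rfloor>" m]
  by (simp_all add: integral_count_int_floor)

lemma borel_measurable_comp_floor [measurable]:
  fixes F :: "int \<Rightarrow> real"
  shows "(\<lambda>y::real. F \<lfloor>m + r * y\<rfloor>) \<in> borel_measurable borel"
proof -
  have "(\<lambda>y::real. \<lfloor>m + r * y\<rfloor>) \<in> measurable borel (count_space UNIV)"
    by (rule measurable_compose[OF _ measurable_real_floor]) simp
  then show ?thesis by (rule measurable_compose) simp
qed

text \<open>
  The factor \<open>sqrt s\<close> removes the divergence of the logarithm; the resulting moments converge.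
\<close>

definition log_moment :: "real \<Rightarrow> real \<Rightarrow> nat \<Rightarrow> real" where
  "log_moment c s j = (LINT x|count_space UNIV. lattice_mass c s x * ln (sqrt s * lattice_mass c s x) ^ j)"

definition gaussian_log_moment :: "nat \<Rightarrow> real" where
  "gaussian_log_moment j = (LINT y|lborel. std_normal_density y * ln (std_normal_density y) ^ j)"

context
  fixes c :: real
  assumes c: "\<bar>c\<bar> \<le> 1" and pos: "\<And>s x. 0 \<le> s \<Longrightarrow> 0 \<le> lattice_mass c s x"
begin

lemma rescaled_mass_envelope:
  assumes "1 \<le> s" "j \<le> 4"
  shows "\<bar>rescaled_mass c s y * ln (rescaled_mass c s y) ^ j\<bar> \<le> 65537 * 132\<^sup>2 * (1 + \<bar>y\<bar>) powr (-3/2)"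
proof (rule ln_power_envelope)
  show "0 \<le> rescaled_mass c s y" using assms pos[of s] by (simp add: rescaled_mass_def)
  show "rescaled_mass c s y \<le> 132 / (1 + \<bar>y\<bar>)\<^sup>2"
    using rescaled_mass_bound[OF c assms(1), of y] by linarith
qed (use assms in auto)

lemma measurable_rescaled_mass [measurable]: "rescaled_mass c s \<in> borel_measurable borel"
  unfolding rescaled_mass_def[abs_def] by measurable

lemma integrable_rescaled_log:
  assumes "1 \<le> s" "j \<le> 4"
  shows "integrable lborel (\<lambda>y. rescaled_mass c s y * ln (rescaled_mass c s y) ^ j)"
proof (rule Bochner_Integration.integrable_bound)
  show "integrable lborel (\<lambda>y::real. 65537 * 132\<^sup>2 * (1 + \<bar>y\<bar>) powr (-3/2))"
    by (intro integrable_mult_right integrable_envelope)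
  show "AE y in lborel. norm (rescaled_mass c s y * ln (rescaled_mass c s y) ^ j)
      \<le> norm (65537 * 132\<^sup>2 * (1 + \<bar>y\<bar>) powr (-3/2))"
    using rescaled_mass_envelope[OF assms] by (intro AE_I2) simp
qed measurable

lemma integrable_log_moment:
  assumes "1 \<le> s" "j \<le> 4"
  shows "integrable (count_space UNIV) (\<lambda>x. lattice_mass c s x * ln (sqrt s * lattice_mass c s x) ^ j)"
proof -
  have r: "0 < sqrt s" using assms by simp
  have "integrable lborel (\<lambda>y. (1 / sqrt s) * (rescaled_mass c s y * ln (rescaled_mass c s y) ^ j))"
    by (intro integrable_mult_right integrable_rescaled_log assms)
  then show ?thesis
    unfolding integral_count_int_scaled(2)[OF r, where m = "c * s"]
    using r by (simp add: rescaled_mass_def mult.assoc[symmetric])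
qed

lemma log_moment_eq:
  assumes "1 \<le> s"
  shows "log_moment c s j = (LINT y|lborel. rescaled_mass c s y * ln (rescaled_mass c s y) ^ j)"
proof -
  have r: "0 < sqrt s" using assms by simp
  show ?thesis
    unfolding log_moment_def integral_count_int_scaled(1)[OF r, where m = "c * s"]
      rescaled_mass_def mult.assoc
    by (rule integral_mult_right_zero[symmetric])
qed

text \<open>
  Pointwise convergence is the local limit theorem, and \<open>rescaled_mass_envelope\<close> is the majorant. Exponents
  up to \<open>4\<close> are needed: \<open>2\<close> for the variance and \<open>4\<close> for the moment condition of the central limit
  theorem.
\<close>

lemma log_moment_tendsto:
  assumes S: "filterlim S at_top sequentially" and j: "j \<le> 4"
  shows "(\<lambda>n. log_moment c (S n) j) \<longlonglongrightarrow> gaussian_log_moment j"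
proof -
  \<comment> \<open>The majorant is available for times at least \<open>1\<close> only.\<close>
  define T where "T n = max 1 (S n)" for n
  have T1: "1 \<le> T n" for n by (simp add: T_def)
  have T: "filterlim T at_top sequentially"
    by (rule filterlim_at_top_mono[OF S]) (simp add: T_def)
  have "(\<lambda>n. LINT y|lborel. rescaled_mass c (T n) y * ln (rescaled_mass c (T n) y) ^ j)
      \<longlonglongrightarrow> gaussian_log_moment j"
    unfolding gaussian_log_moment_def
  proof (rule integral_dominated_convergence)
    show "integrable lborel (\<lambda>y::real. 65537 * 132\<^sup>2 * (1 + \<bar>y\<bar>) powr (-3/2))"
      by (intro integrable_mult_right integrable_envelope)
    show "AE y in lborel. norm (rescaled_mass c (T n) y * ln (rescaled_mass c (T n) y) ^ j)
      \<le> 65537 * 132\<^sup>2 * (1 + \<bar>y\<bar>) powr (-3/2)" for n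
      using rescaled_mass_envelope[OF T1 j] by (intro AE_I2) simp
    show "AE y in lborel. (\<lambda>n. rescaled_mass c (T n) y * ln (rescaled_mass c (T n) y) ^ j)
        \<longlonglongrightarrow> std_normal_density y * ln (std_normal_density y) ^ j"
    proof (rule AE_I2)
      fix y :: real
      have "std_normal_density y \<noteq> 0" by (simp add: std_normal_density_def)
      then show "(\<lambda>n. rescaled_mass c (T n) y * ln (rescaled_mass c (T n) y) ^ j)
        \<longlonglongrightarrow> std_normal_density y * ln (std_normal_density y) ^ j"
        by (intro tendsto_mult tendsto_power tendsto_ln rescaled_mass_tendsto T)
    qed
  qed measurable
  moreover have "\<forall>\<^sub>F n in sequentially.
      (LINT y|lborel. rescaled_mass c (T n) y * ln (rescaled_mass c (T n) y) ^ j) = log_moment c (S n) j"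
    using filterlim_at_top_dense[THEN iffD1, OF S, rule_format, of 1]
  proof eventually_elim
    fix n assume "1 < S n"
    then show "(LINT y|lborel. rescaled_mass c (T n) y * ln (rescaled_mass c (T n) y) ^ j) = log_moment c (S n) j"
      using log_moment_eq[of "S n" j] by (simp add: T_def)
  qed
  ultimately show ?thesis by (rule Lim_transform_eventually)
qed

definition lattice_entropy :: "real \<Rightarrow> real" where
  "lattice_entropy s = (LINT x|count_space UNIV. - (lattice_mass c s x * ln (lattice_mass c s x)))"

lemma lattice_mass_continuous:
  assumes S: "S \<longlonglongrightarrow> s" and S0: "\<And>n. 0 \<le> S n"
  shows "(\<lambda>n. lattice_mass c (S n) x) \<longlonglongrightarrow> lattice_mass c s x"
proof -
  let ?F = "\<lambda>s \<theta>. indicator {-pi..pi} \<theta> *\<^sub>R (exp (s * (cos \<theta> - 1)) * cos (real_of_int x * \<theta> - c * s * sin \<theta>))"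
  have "(\<lambda>n. LINT \<theta>|lborel. ?F (S n) \<theta>) \<longlonglongrightarrow> (LINT \<theta>|lborel. ?F s \<theta>)"
  proof (rule integral_dominated_convergence)
    show "integrable lborel (indicator {-pi..pi} :: real \<Rightarrow> real)" by simp
    show "AE \<theta> in lborel. norm (?F (S n) \<theta>) \<le> indicator {-pi..pi} \<theta>" for n
    proof (rule AE_I2)
      fix \<theta> :: real
      have "exp (S n * (cos \<theta> - 1)) * \<bar>cos (real_of_int x * \<theta> - c * S n * sin \<theta>)\<bar> \<le> 1"
        using S0[of n] by (intro mult_le_one) (auto simp: mult_nonneg_nonpos)
      then show "norm (?F (S n) \<theta>) \<le> indicator {-pi..pi} \<theta>"
        by (simp add: abs_mult split: split_indicator)
    qed
    show "AE \<theta> in lborel. (\<lambda>n. ?F (S n) \<theta>) \<longlonglongrightarrow> ?F s \<theta>"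
      by (intro AE_I2 tendsto_intros S)
  qed simp_all
  then show ?thesis
    unfolding lattice_mass_def set_lebesgue_integral_def by (intro tendsto_divide tendsto_const) simp_all
qed

lemma tendsto_x_ln_x:
  fixes t :: real
  assumes T: "T \<longlonglongrightarrow> t" and T0: "\<And>n. 0 \<le> T n"
  shows "(\<lambda>n. T n * ln (T n)) \<longlonglongrightarrow> t * ln t"
proof -
  have "continuous_on {0..} (\<lambda>t::real. t * ln t)"
    unfolding continuous_on_def
  proof
    fix t :: real assume "t \<in> {0..}"
    show "((\<lambda>t. t * ln t) \<longlongrightarrow> t * ln t) (at t within {0..})"
    proof (cases "t = 0")
      case True
      have "((\<lambda>t::real. t * ln t) \<longlongrightarrow> 0) (at_right 0)" by real_asymp
      then show ?thesis using True by (simp add: at_within_Ici_at_right)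
    qed (auto intro!: tendsto_intros)
  qed
  moreover have "0 \<le> t" using T T0 by (intro LIMSEQ_le_const[OF T]) auto
  ultimately show ?thesis
    using T T0 by (intro continuous_on_tendsto_compose[of "{0..}" "\<lambda>t. t * ln t" T t]) auto
qed

text \<open>
  On a bounded range of times the masses are dominated by a fixed inverse square function, which also
  dominates the terms of the entropy through \<open>ln_power_envelope\<close>.
\<close>

lemma lattice_entropy_continuous: "continuous_on {0..} lattice_entropy"
proof (rule continuous_on_sequentiallyI)
  fix S :: "nat \<Rightarrow> real" and s
  assume S0: "\<forall>n. S n \<in> {0..}" and s0: "s \<in> {0..}" and S: "S \<longlonglongrightarrow> s"
  obtain B where B: "\<And>n. \<bar>S n\<bar> \<le> B"
    using S[THEN convergentI, THEN convergent_imp_Bseq] by (auto simp: Bseq_def)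
  \<comment> \<open>A convergent sequence of times stays in a bounded range, so one majorant serves all its terms.\<close>
  define B' where "B' = max 1 B"
  have B': "1 \<le> B'" "S n \<le> B'" for n using B[of n] by (auto simp: B'_def)
  have mass: "0 \<le> lattice_mass c (S n) x" "0 \<le> S n" for n x using S0 pos by auto
  let ?w = "\<lambda>y::real. 65537 * (118 * B'\<^sup>2)\<^sup>2 * (1 + \<bar>y\<bar>) powr (-3/2)"
  have "(\<lambda>n. LINT y::real|lborel. - (lattice_mass c (S n) \<lfloor>y\<rfloor> * ln (lattice_mass c (S n) \<lfloor>y\<rfloor>)))
      \<longlonglongrightarrow> (LINT y::real|lborel. - (lattice_mass c s \<lfloor>y\<rfloor> * ln (lattice_mass c s \<lfloor>y\<rfloor>)))"
  proof (rule integral_dominated_convergence)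
    show "integrable lborel ?w" by (intro integrable_mult_right integrable_envelope)
    show "AE y in lborel. norm (- (lattice_mass c (S n) \<lfloor>y\<rfloor> * ln (lattice_mass c (S n) \<lfloor>y\<rfloor>))) \<le> ?w y" for n
    proof (rule AE_I2)
      fix y :: real
      have "\<bar>lattice_mass c (S n) \<lfloor>y\<rfloor> * ln (lattice_mass c (S n) \<lfloor>y\<rfloor>) ^ 1\<bar> \<le> ?w y"
      proof (rule ln_power_envelope[OF mass(1)])
        show "lattice_mass c (S n) \<lfloor>y\<rfloor> \<le> 118 * B'\<^sup>2 / (1 + \<bar>y\<bar>)\<^sup>2"
          using lattice_mass_floor_bound[OF c mass(2) B'(2) B'(1), of n y] by linarith
        have "1 \<le> B'\<^sup>2" using B' by (simp add: one_le_power)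
        then show "1 \<le> 118 * B'\<^sup>2" by linarith
      qed auto
      then show "norm (- (lattice_mass c (S n) \<lfloor>y\<rfloor> * ln (lattice_mass c (S n) \<lfloor>y\<rfloor>))) \<le> ?w y"
        by simp
    qed
    show "AE y in lborel. (\<lambda>n. - (lattice_mass c (S n) \<lfloor>y\<rfloor> * ln (lattice_mass c (S n) \<lfloor>y\<rfloor>)))
        \<longlonglongrightarrow> - (lattice_mass c s \<lfloor>y\<rfloor> * ln (lattice_mass c s \<lfloor>y\<rfloor>))"
      by (intro AE_I2 tendsto_minus tendsto_x_ln_x lattice_mass_continuous S mass)
  qed (use borel_measurable_comp_floor[of _ 0 1] in simp_all)
  then show "(\<lambda>n. lattice_entropy (S n)) \<longlonglongrightarrow> lattice_entropy s"
    unfolding lattice_entropy_def integral_count_int_floor(1) .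
qed

end

section \<open>Surprisals as functions of independent coordinates\<close>

lemma abs_drift_le: "\<bar>drift w\<bar> \<le> 1"
  by (cases w) simp_all

lemma lattice_mass_nonneg:
  assumes "0 \<le> s"
  shows "0 \<le> lattice_mass (drift w) s x"
proof -
  have "lattice_mass (drift w) s x = measure (walk_space w 1) {\<omega>. \<forall>i\<in>{0}. walk 1 s \<omega> i = x}"
    using assms by (subst prob_walk_coords) simp_all
  then show ?thesis by simp
qed

definition mass_law :: "walk_kind \<Rightarrow> real \<Rightarrow> int measure" where
  "mass_law w s = density (count_space UNIV) (\<lambda>x. ennreal (lattice_mass (drift w) s x))"

lemma emeasure_mass_law_singleton: "emeasure (mass_law w s) {x} = ennreal (lattice_mass (drift w) s x)"
  unfolding mass_law_def by (subst emeasure_density) (simp_all add: nn_integral_count_space_indicator)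

lemma sets_mass_law [simp]: "sets (mass_law w s) = UNIV" and space_mass_law [simp]: "space (mass_law w s) = UNIV"
  by (simp_all add: mass_law_def)

lemma distr_walk_coord:
  assumes "0 < k" "0 \<le> t" "i < k"
  shows "distr (walk_space w k) (count_space UNIV) (\<lambda>\<omega>. walk k t \<omega> i) = mass_law w (t / real k)"
proof (rule measure_eqI_countable[where A = UNIV])
  interpret W: prob_space "walk_space w k" by (rule prob_space_walk_space)
  fix x :: int
  have "emeasure (distr (walk_space w k) (count_space UNIV) (\<lambda>\<omega>. walk k t \<omega> i)) {x}
      = emeasure (walk_space w k) ((\<lambda>\<omega>. walk k t \<omega> i) -` {x} \<inter> space (walk_space w k))"
    using assms(3) by (intro emeasure_distr measurable_walk_coord) simp_all
  also have "(\<lambda>\<omega>. walk k t \<omega> i) -` {x} \<inter> space (walk_space w k) = {\<omega>. \<forall>i\<in>{i}. walk k t \<omega> i = x}"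
    by auto
  also have "emeasure (walk_space w k) {\<omega>. \<forall>i\<in>{i}. walk k t \<omega> i = x}
      = ennreal (lattice_mass (drift w) (t / real k) x)"
    unfolding W.emeasure_eq_measure using assms by (subst prob_walk_coords) simp_all
  finally show "emeasure (distr (walk_space w k) (count_space UNIV) (\<lambda>\<omega>. walk k t \<omega> i)) {x}
      = emeasure (mass_law w (t / real k)) {x}"
    by (simp add: emeasure_mass_law_singleton)
qed simp_all

lemma prob_space_mass_law:
  assumes "0 \<le> s"
  shows "prob_space (mass_law w s)"
  using prob_space.prob_space_distr[OF prob_space_walk_space measurable_walk_coord[of 0 1 s w]]
    distr_walk_coord[of 1 s 0 w] assms by simp

lemma nu_eq: "0 < k \<Longrightarrow> 0 \<le> s \<Longrightarrow> nu w k s = mass_law w s"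
  unfolding nu_def using distr_walk_coord[of k "s * real k" 0 w] by simp

lemma measure_nu_singleton:
  "0 < k \<Longrightarrow> 0 \<le> s \<Longrightarrow> measure (nu w k s) {x} = lattice_mass (drift w) s x"
  by (simp add: nu_eq measure_def emeasure_mass_law_singleton lattice_mass_nonneg)

lemma Q_coord_eq:
  "0 < k \<Longrightarrow> 0 \<le> t \<Longrightarrow> Q_coord w k i t \<omega> = - ln (lattice_mass (drift w) (t / real k) (walk k t \<omega> i))"
  by (simp add: Q_coord_def measure_nu_singleton)

text \<open>
  The position is extensional, so it is determined by its \<open>k\<close> coordinates, and the event of being at
  it is one of those covered by \<open>prob_walk_coords\<close>.
\<close>

lemma measure_mu_walk:
  assumes "0 < k" "0 \<le> t"
  shows "measure (mu w k t) {walk k t \<omega>} = (\<Prod>i<k. lattice_mass (drift w) (t / real k) (walk k t \<omega> i))"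
proof -
  have ext: "walk k t \<eta> \<in> extensional {..<k}" for \<eta> by (simp add: walk_def)
  have eq: "walk k t \<eta> = walk k t \<omega> \<longleftrightarrow> (\<forall>i\<in>{..<k}. walk k t \<eta> i = walk k t \<omega> i)" for \<eta>
    by (rule iffI, simp, rule extensionalityI[OF ext ext], blast)
  have "{walk k t \<omega>} = PiE {..<k} (\<lambda>i. {walk k t \<omega> i})"
    using ext[of \<omega>] by (subst PiE_singleton) auto
  then have "{walk k t \<omega>} \<in> sets (\<Pi>\<^sub>M i\<in>{..<k}. count_space UNIV)"
    by (simp add: sets_PiM_I_finite)
  then have "measure (mu w k t) {walk k t \<omega>}
      = measure (walk_space w k) (walk k t -` {walk k t \<omega>} \<inter> space (walk_space w k))"
    unfolding mu_def by (intro measure_distr measurable_walk)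
  also have "walk k t -` {walk k t \<omega>} \<inter> space (walk_space w k) = {\<eta>. \<forall>i\<in>{..<k}. walk k t \<eta> i = walk k t \<omega> i}"
    by (rule set_eqI) (simp only: Int_iff vimage_eq singleton_iff space_walk_space UNIV_I mem_Collect_eq eq simp_thms)
  also have "measure (walk_space w k) \<dots> = (\<Prod>i<k. lattice_mass (drift w) (t / real k) (walk k t \<omega> i))"
    using assms by (intro prob_walk_coords) simp_all
  finally show ?thesis .
qed

lemma AE_lattice_mass_pos:
  assumes "0 \<le> s"
  shows "AE x in mass_law w s. 0 < lattice_mass (drift w) s x"
  unfolding mass_law_def by (subst AE_density) simp_all

lemma AE_walk_mass_pos:
  assumes "0 < k" "0 \<le> t"
  shows "AE \<omega> in walk_space w k. \<forall>i<k. 0 < lattice_mass (drift w) (t / real k) (walk k t \<omega> i)"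
proof -
  have "AE \<omega> in walk_space w k. 0 < lattice_mass (drift w) (t / real k) (walk k t \<omega> i)" if "i < k" for i
  proof -
    have "AE x in distr (walk_space w k) (count_space UNIV) (\<lambda>\<omega>. walk k t \<omega> i).
        0 < lattice_mass (drift w) (t / real k) x"
      unfolding distr_walk_coord[OF assms that] by (rule AE_lattice_mass_pos) (use assms in simp)
    then show ?thesis
      by (subst (asm) AE_distr_iff) (simp_all add: measurable_walk_coord that)
  qed
  then have "AE \<omega> in walk_space w k. \<forall>i\<in>{..<k}. 0 < lattice_mass (drift w) (t / real k) (walk k t \<omega> i)"
    by (intro AE_finite_allI) simp_all
  then show ?thesis by (simp only: Ball_def lessThan_iff)
qed

text \<open>
  Only almost sure: where a factor vanishes, the logarithm of the product is not the sum of the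
  logarithms.
\<close>

lemma Q_total_eq_sum:
  assumes "0 < k" "0 \<le> t"
  shows "AE \<omega> in walk_space w k. Q_total w k t \<omega> = (\<Sum>i<k. Q_coord w k i t \<omega>)"
  using AE_walk_mass_pos[OF assms, of w]
proof eventually_elim
  fix \<omega> assume pos: "\<forall>i<k. 0 < lattice_mass (drift w) (t / real k) (walk k t \<omega> i)"
  then show "Q_total w k t \<omega> = (\<Sum>i<k. Q_coord w k i t \<omega>)"
    unfolding Q_total_def measure_mu_walk[OF assms] Q_coord_eq[OF assms] sum_negf
    by (subst ln_prod) auto
qed

lemma measurable_walk_fun:
  fixes F :: "int \<Rightarrow> real"
  assumes "i < k"
  shows "(\<lambda>\<omega>. F (walk k t \<omega> i)) \<in> borel_measurable (walk_space w k)"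
  by (rule measurable_compose[OF measurable_walk_coord[OF assms]]) simp

lemma Q_total_measurable:
  assumes "0 < k" "0 \<le> t"
  shows "Q_total w k t \<in> borel_measurable (walk_space w k)"
proof -
  have eq: "Q_total w k t = (\<lambda>\<omega>. - ln (\<Prod>i<k. lattice_mass (drift w) (t / real k) (walk k t \<omega> i)))"
    by (simp add: fun_eq_iff Q_total_def measure_mu_walk[OF assms])
  show ?thesis
    unfolding eq
    by (intro borel_measurable_uminus borel_measurable_ln borel_measurable_prod measurable_walk_fun) simp
qed

lemma Q_coord_measurable:
  assumes "0 < k" "0 \<le> t" "i < k"
  shows "Q_coord w k i t \<in> borel_measurable (walk_space w k)"
proof -
  have eq: "Q_coord w k i t = (\<lambda>\<omega>. - ln (lattice_mass (drift w) (t / real k) (walk k t \<omega> i)))"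
    by (simp add: fun_eq_iff Q_coord_eq[OF assms(1,2)])
  show ?thesis unfolding eq by (rule measurable_walk_fun[OF assms(3)])
qed

text \<open>
  Both the joint law and the product law live on a countable space, so it suffices to compare them on
  single points, where \<open>prob_walk_coords\<close> applies.
\<close>

lemma indep_walk_coords:
  assumes "0 < k" "0 \<le> t"
  shows "prob_space.indep_vars (walk_space w k) (\<lambda>_. count_space UNIV) (\<lambda>i \<omega>. walk k t \<omega> i) {..<k}"
proof -
  interpret W: prob_space "walk_space w k" by (rule prob_space_walk_space)
  interpret N: prob_space "mass_law w (t / real k)" by (rule prob_space_mass_law) (use assms in simp)
  interpret PN: product_prob_space "\<lambda>_. mass_law w (t / real k)" "{..<k}" ..
  have ne: "{..<k} \<noteq> {}" using assms by auto
  have rv: "W.random_variable (count_space UNIV) (\<lambda>\<omega>. walk k t \<omega> i)" if "i \<in> {..<k}" for i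
    using that by (intro measurable_walk_coord) simp
  have sets_eq: "sets (\<Pi>\<^sub>M i\<in>{..<k}. mass_law w (t / real k)) = sets (\<Pi>\<^sub>M i\<in>{..<k}. count_space UNIV :: int measure)"
    by (rule sets_PiM_cong) simp_all
  have meas: "(\<lambda>\<omega>. \<lambda>i\<in>{..<k}. walk k t \<omega> i) \<in> measurable (walk_space w k) (\<Pi>\<^sub>M i\<in>{..<k}. count_space UNIV)"
    by (rule measurable_restrict) (use rv in simp)
  have singleton: "{x} = PiE {..<k} (\<lambda>i. {x i})" if "x \<in> PiE {..<k} (\<lambda>_. UNIV)" for x :: "nat \<Rightarrow> int"
    using that by (subst PiE_singleton) (auto simp: PiE_def)
  have singleton_sets: "{x} \<in> sets (\<Pi>\<^sub>M i\<in>{..<k}. count_space UNIV)" if "x \<in> PiE {..<k} (\<lambda>_. UNIV)"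
    for x :: "nat \<Rightarrow> int"
    unfolding singleton[OF that] by (rule sets_PiM_I_finite) simp_all
  have "distr (walk_space w k) (\<Pi>\<^sub>M i\<in>{..<k}. count_space UNIV) (\<lambda>\<omega>. \<lambda>i\<in>{..<k}. walk k t \<omega> i)
      = (\<Pi>\<^sub>M i\<in>{..<k}. mass_law w (t / real k))"
  proof (rule measure_eqI_countable'[where A = "PiE {..<k} (\<lambda>_. UNIV)"])
    show "countable (PiE {..<k} (\<lambda>_. UNIV :: int set))"
      by (rule countable_PiE) simp_all
    fix x :: "nat \<Rightarrow> int" assume x: "x \<in> PiE {..<k} (\<lambda>_. UNIV)"
    show "{x} \<in> sets (distr (walk_space w k) (\<Pi>\<^sub>M i\<in>{..<k}. count_space UNIV) (\<lambda>\<omega>. \<lambda>i\<in>{..<k}. walk k t \<omega> i))"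
      "{x} \<in> sets (\<Pi>\<^sub>M i\<in>{..<k}. mass_law w (t / real k))"
      using singleton_sets[OF x] by (simp_all add: sets_eq)
    have "emeasure (distr (walk_space w k) (\<Pi>\<^sub>M i\<in>{..<k}. count_space UNIV) (\<lambda>\<omega>. \<lambda>i\<in>{..<k}. walk k t \<omega> i)) {x}
        = emeasure (walk_space w k) ((\<lambda>\<omega>. \<lambda>i\<in>{..<k}. walk k t \<omega> i) -` {x} \<inter> space (walk_space w k))"
      by (rule emeasure_distr[OF meas singleton_sets[OF x]])
    also have "(\<lambda>\<omega>. \<lambda>i\<in>{..<k}. walk k t \<omega> i) -` {x} \<inter> space (walk_space w k)
        = {\<omega>. \<forall>i\<in>{..<k}. walk k t \<omega> i = x i}"
    proof -
      have "x \<in> extensional {..<k}" using x by (simp add: PiE_def)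
      then have eq: "restrict (walk k t \<omega>) {..<k} = x \<longleftrightarrow> (\<forall>i\<in>{..<k}. walk k t \<omega> i = x i)" for \<omega>
        using extensionalityI[OF restrict_extensional \<open>x \<in> extensional {..<k}\<close>, of "walk k t \<omega>"] by fastforce
      show ?thesis
        by (rule set_eqI) (simp only: Int_iff vimage_eq singleton_iff space_walk_space UNIV_I mem_Collect_eq eq simp_thms)
    qed
    also have "emeasure (walk_space w k) \<dots> = ennreal (\<Prod>i<k. lattice_mass (drift w) (t / real k) (x i))"
      unfolding W.emeasure_eq_measure using assms by (subst prob_walk_coords) simp_all
    also have "\<dots> = (\<Prod>i<k. emeasure (mass_law w (t / real k)) {x i})"
      unfolding emeasure_mass_law_singleton using assms by (intro prod_ennreal[symmetric] lattice_mass_nonneg) simp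
    also have "\<dots> = emeasure (\<Pi>\<^sub>M i\<in>{..<k}. mass_law w (t / real k)) {x}"
      unfolding singleton[OF x] by (rule PN.emeasure_PiM[symmetric]) simp_all
    finally show "emeasure (distr (walk_space w k) (\<Pi>\<^sub>M i\<in>{..<k}. count_space UNIV) (\<lambda>\<omega>. \<lambda>i\<in>{..<k}. walk k t \<omega> i)) {x}
        = emeasure (\<Pi>\<^sub>M i\<in>{..<k}. mass_law w (t / real k)) {x}" .
  qed (simp_all add: space_PiM)
  also have "\<dots> = (\<Pi>\<^sub>M i\<in>{..<k}. distr (walk_space w k) (count_space UNIV) (\<lambda>\<omega>. walk k t \<omega> i))"
    by (rule PiM_cong) (simp_all add: distr_walk_coord[OF assms])
  finally show ?thesis
    by (subst W.indep_vars_iff_distr_eq_PiM'[OF ne rv])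
qed

lemma
  fixes F :: "int \<Rightarrow> real"
  assumes "0 \<le> s"
  shows integral_mass_law: "(LINT x|mass_law w s. F x) = (LINT x|count_space UNIV. lattice_mass (drift w) s x * F x)"
    and integrable_mass_law: "integrable (mass_law w s) F \<longleftrightarrow> integrable (count_space UNIV) (\<lambda>x. lattice_mass (drift w) s x * F x)"
  unfolding mass_law_def using lattice_mass_nonneg[OF assms, of w]
  by (simp_all add: integral_density integrable_density)

lemma integral_walk_coord:
  fixes F :: "int \<Rightarrow> real"
  assumes "0 < k" "0 \<le> t" "i < k"
  shows "(LINT \<omega>|walk_space w k. F (walk k t \<omega> i)) = (LINT x|mass_law w (t / real k). F x)"
  unfolding distr_walk_coord[OF assms, symmetric]
  by (simp add: integral_distr[OF measurable_walk_coord[OF assms(3)]])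

section \<open>A central limit theorem for arrays\<close>

text \<open>
  The law of the summands may change with \<open>n\<close>, so the classical theorem for one sequence does not
  apply. The proof compares the characteristic function of one summand with
  \<open>1 - t\<^sup>2 / (2 k)\<close>; bounded third absolute moments make the error, multiplied by \<open>k\<close>, of order
  \<open>1 / sqrt k\<close>.
\<close>

lemma clt_array:
  fixes M :: "nat \<Rightarrow> 'a measure" and X :: "nat \<Rightarrow> nat \<Rightarrow> 'a \<Rightarrow> real" and \<mu> :: "nat \<Rightarrow> real measure"
    and k :: "nat \<Rightarrow> nat" and v :: "nat \<Rightarrow> real" and v0 B :: real
  assumes M: "\<And>n. prob_space (M n)"
    and indep: "\<And>n. prob_space.indep_vars (M n) (\<lambda>_. borel) (X n) {..<k n}"
    and distr: "\<And>n i. i < k n \<Longrightarrow> distr (M n) borel (X n i) = \<mu> n"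
    and \<mu>: "\<And>n. real_distribution (\<mu> n)"
    and mean: "\<And>n. integrable (\<mu> n) (\<lambda>x. x)" "\<And>n. (LINT x|\<mu> n. x) = 0"
    and var: "\<And>n. integrable (\<mu> n) (\<lambda>x. x\<^sup>2)" "\<And>n. (LINT x|\<mu> n. x\<^sup>2) = v n"
    and cube: "\<And>n. integrable (\<mu> n) (\<lambda>x. \<bar>x\<bar> ^ 3)" "\<And>n. (LINT x|\<mu> n. \<bar>x\<bar> ^ 3) \<le> B"
    and v: "\<And>n. 0 < v n" "v \<longlonglongrightarrow> v0" "0 < v0"
    and k: "filterlim k at_top sequentially" "\<And>n. 0 < k n"
  shows "weak_conv_m (\<lambda>n. distr (M n) borel (\<lambda>\<omega>. (\<Sum>i<k n. X n i \<omega>) / sqrt (real (k n) * v n)))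
           std_normal_distribution"
proof (rule levy_continuity)
  have X_rv: "X n i \<in> borel_measurable (M n)" if "i < k n" for n i
    using prob_space.indep_vars_def2[OF M, THEN iffD1, OF indep[of n]] that by auto
  have S_rv: "(\<lambda>\<omega>. (\<Sum>i<k n. X n i \<omega>) / sqrt (real (k n) * v n)) \<in> borel_measurable (M n)" for n
    using X_rv by (intro borel_measurable_divide borel_measurable_sum borel_measurable_const) auto
  show "real_distribution (distr (M n) borel (\<lambda>\<omega>. (\<Sum>i<k n. X n i \<omega>) / sqrt (real (k n) * v n)))" for n
    using prob_space.real_distribution_distr[OF M S_rv] .
  show "real_distribution std_normal_distribution" by (rule real_dist_normal_dist)
  fix t :: real
  define \<tau> where "\<tau> n = t / sqrt (real (k n) * v n)" for n
  define z where "z n = complex_of_real (1 + (- (t\<^sup>2 / 2)) / real (k n))" for n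
  have kv: "0 < real (k n) * v n" for n using k v by simp
  have char_eq: "char (distr (M n) borel (\<lambda>\<omega>. (\<Sum>i<k n. X n i \<omega>) / sqrt (real (k n) * v n))) t
      = char (\<mu> n) (\<tau> n) ^ k n" for n
  proof -
    interpret prob_space "M n" by (rule M)
    have "char (distr (M n) borel (\<lambda>\<omega>. (\<Sum>i<k n. X n i \<omega>) / sqrt (real (k n) * v n))) t
        = char (distr (M n) borel (\<lambda>\<omega>. \<Sum>i<k n. X n i \<omega>)) (\<tau> n)"
      unfolding char_def \<tau>_def using S_rv[of n] X_rv
      by (subst (1 2) integral_distr) (auto intro!: borel_measurable_sum)
    also have "\<dots> = (\<Prod>i<k n. char (distr (M n) borel (X n i)) (\<tau> n))"
      by (rule char_distr_sum[OF indep])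
    also have "\<dots> = char (\<mu> n) (\<tau> n) ^ k n"
      using distr by simp
    finally show ?thesis .
  qed
  have bound: "\<forall>\<^sub>F n in sequentially.
      norm (char (\<mu> n) (\<tau> n) ^ k n - z n ^ k n) \<le> \<bar>t\<bar> ^ 3 * B / 6 * (1 / (v n * sqrt (real (k n) * v n)))"
  proof -
    have "\<forall>\<^sub>F n in sequentially. nat \<lceil>t\<^sup>2 / 4\<rceil> \<le> k n"
      using k(1) unfolding filterlim_at_top by blast
    then show ?thesis
    proof eventually_elim
      fix n assume "nat \<lceil>t\<^sup>2 / 4\<rceil> \<le> k n"
      then have kt: "t\<^sup>2 / 4 \<le> real (k n)" by (simp add: nat_ceiling_le_eq)
      interpret \<mu>: real_distribution "\<mu> n" by (rule \<mu>)
      have \<tau>2: "(\<tau> n)\<^sup>2 * v n = t\<^sup>2 / real (k n)"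
        using kv[of n] v(1)[of n] by (simp add: \<tau>_def power_divide)
      have z: "norm (z n) \<le> 1"
        unfolding z_def norm_of_real using kt k(2)[of n] by (auto simp: abs_le_iff field_simps)
      have z_eq: "1 - (\<tau> n)\<^sup>2 * v n / 2 = z n"
        unfolding z_def using arg_cong[OF \<tau>2, of complex_of_real] by simp
      have "norm (char (\<mu> n) (\<tau> n) - (1 - (\<tau> n)\<^sup>2 * v n / 2))
          \<le> (\<tau> n)\<^sup>2 / 6 * (LINT x|\<mu> n. min (6 * x\<^sup>2) (\<bar>\<tau> n\<bar> * \<bar>x\<bar> ^ 3))"
        by (rule \<mu>.char_approx3) (simp_all add: mean var)
      also have "\<dots> \<le> (\<tau> n)\<^sup>2 / 6 * (\<bar>\<tau> n\<bar> * B)"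
      proof (rule mult_left_mono)
        have "(LINT x|\<mu> n. min (6 * x\<^sup>2) (\<bar>\<tau> n\<bar> * \<bar>x\<bar> ^ 3)) \<le> (LINT x|\<mu> n. \<bar>\<tau> n\<bar> * \<bar>x\<bar> ^ 3)"
        proof (rule integral_mono)
          show "integrable (\<mu> n) (\<lambda>x. min (6 * x\<^sup>2) (\<bar>\<tau> n\<bar> * \<bar>x\<bar> ^ 3))"
            by (intro integrable_min integrable_mult_right var cube)
        qed (auto intro!: integrable_mult_right cube)
        also have "\<dots> \<le> \<bar>\<tau> n\<bar> * B"
          by (simp add: mult_left_mono cube)
        finally show "(LINT x|\<mu> n. min (6 * x\<^sup>2) (\<bar>\<tau> n\<bar> * \<bar>x\<bar> ^ 3)) \<le> \<bar>\<tau> n\<bar> * B" .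
      qed simp
      also have "\<dots> = (\<bar>\<tau> n\<bar> ^ 3) * B / 6"
        by (simp add: power3_eq_cube power2_eq_square)
      finally have le: "norm (char (\<mu> n) (\<tau> n) - z n) \<le> \<bar>\<tau> n\<bar> ^ 3 * B / 6"
        unfolding z_eq .
      have "norm (char (\<mu> n) (\<tau> n) ^ k n - z n ^ k n) \<le> real (k n) * norm (char (\<mu> n) (\<tau> n) - z n)"
        by (rule norm_power_diff[OF \<mu>.cmod_char_le_1 z])
      also have "\<dots> \<le> real (k n) * (\<bar>\<tau> n\<bar> ^ 3 * B / 6)"
        by (rule mult_left_mono[OF le]) simp
      also have "\<dots> = \<bar>t\<bar> ^ 3 * B / 6 * (1 / (v n * sqrt (real (k n) * v n)))"
      proof -
        have "\<bar>\<tau> n\<bar> ^ 3 = \<bar>t\<bar> ^ 3 / (real (k n) * v n * sqrt (real (k n) * v n))"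
          using kv[of n] unfolding \<tau>_def abs_divide power_divide power3_eq_cube by simp
        then show ?thesis using k(2)[of n] v(1)[of n] by (simp add: field_simps)
      qed
      finally show "norm (char (\<mu> n) (\<tau> n) ^ k n - z n ^ k n)
          \<le> \<bar>t\<bar> ^ 3 * B / 6 * (1 / (v n * sqrt (real (k n) * v n)))" .
    qed
  qed
  have k_top: "filterlim (\<lambda>n. real (k n)) at_top sequentially"
    by (rule filterlim_compose[OF filterlim_real_sequentially k(1)])
  have "filterlim (\<lambda>n. v n * sqrt (real (k n) * v n)) at_top sequentially"
  proof (rule filterlim_tendsto_pos_mult_at_top[OF v(2,3)])
    have "filterlim (\<lambda>n. v n * real (k n)) at_top sequentially"
      by (rule filterlim_tendsto_pos_mult_at_top[OF v(2,3) k_top])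
    then show "filterlim (\<lambda>n. sqrt (real (k n) * v n)) at_top sequentially"
      by (intro filterlim_compose[OF sqrt_at_top]) (simp add: mult.commute)
  qed
  then have "(\<lambda>n. 1 / (v n * sqrt (real (k n) * v n))) \<longlonglongrightarrow> 0"
    by (intro tendsto_divide_0[OF tendsto_const] filterlim_at_top_imp_at_infinity)
  then have err: "(\<lambda>n. \<bar>t\<bar> ^ 3 * B / 6 * (1 / (v n * sqrt (real (k n) * v n)))) \<longlonglongrightarrow> 0"
    by (rule tendsto_mult_right_zero)
  have "(\<lambda>n. (1 + (- (t\<^sup>2 / 2)) / real (k n)) ^ k n) \<longlonglongrightarrow> exp (- (t\<^sup>2 / 2))"
    by (rule filterlim_compose[OF tendsto_exp_limit_sequentially k(1)])
  then have "(\<lambda>n. z n ^ k n) \<longlonglongrightarrow> complex_of_real (exp (- (t\<^sup>2 / 2)))"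
    unfolding z_def of_real_power[symmetric] by (rule tendsto_of_real)
  then have "(\<lambda>n. char (\<mu> n) (\<tau> n) ^ k n) \<longlonglongrightarrow> complex_of_real (exp (- (t\<^sup>2 / 2)))"
    by (rule Lim_transform) (rule Lim_null_comparison[OF bound err])
  then show "(\<lambda>n. char (distr (M n) borel (\<lambda>\<omega>. (\<Sum>i<k n. X n i \<omega>) / sqrt (real (k n) * v n))) t)
      \<longlonglongrightarrow> char std_normal_distribution t"
    by (simp add: char_eq char_std_normal_distribution)
qed

text \<open>
  Distribution functions are monotone and the limit is continuous, so a convergent sequence of
  thresholds can be squeezed between two fixed ones.
\<close>

lemma weak_conv_m_moving_threshold:
  fixes a :: "nat \<Rightarrow> real"
  assumes conv: "weak_conv_m D N" and D: "\<And>n. real_distribution (D n)"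
    and N: "real_distribution N" "\<And>x. measure N {x} = 0"
    and a: "a \<longlonglongrightarrow> a0"
  shows "(\<lambda>n. measure (D n) {..a n}) \<longlonglongrightarrow> measure N {..a0}"
proof -
  interpret D: real_distribution "D n" for n by (rule D)
  interpret N: real_distribution N by (rule N)
  have cont: "isCont (cdf N) x" for x using N(2) by (simp add: N.isCont_cdf)
  have lim: "(\<lambda>n. cdf (D n) x) \<longlonglongrightarrow> cdf N x" for x
    using conv cont by (simp add: weak_conv_m_def weak_conv_def)
  have "(\<lambda>n. cdf (D n) (a n)) \<longlonglongrightarrow> cdf N a0"
  proof (rule order_tendstoI)
    fix y assume "y < cdf N a0"
    then have "\<forall>\<^sub>F x in at a0. y < cdf N x"
      using order_tendstoD(1)[OF cont[of a0, unfolded isCont_def]] by blast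
    then obtain e where e: "0 < e" "\<And>x. x \<noteq> a0 \<Longrightarrow> dist x a0 < e \<Longrightarrow> y < cdf N x"
      by (auto simp: eventually_at)
    have "y < cdf N (a0 - e / 2)" using e by (intro e(2)) (auto simp: dist_real_def)
    then have "\<forall>\<^sub>F n in sequentially. y < cdf (D n) (a0 - e / 2)"
      by (rule order_tendstoD(1)[OF lim])
    moreover have "\<forall>\<^sub>F n in sequentially. a0 - e / 2 < a n"
      using e(1) by (intro order_tendstoD(1)[OF a]) simp
    ultimately show "\<forall>\<^sub>F n in sequentially. y < cdf (D n) (a n)"
      by eventually_elim (use D.cdf_nondecreasing in \<open>meson less_le_trans less_imp_le\<close>)
  next
    fix y assume "cdf N a0 < y"
    then have "\<forall>\<^sub>F x in at a0. cdf N x < y"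
      using order_tendstoD(2)[OF cont[of a0, unfolded isCont_def]] by blast
    then obtain e where e: "0 < e" "\<And>x. x \<noteq> a0 \<Longrightarrow> dist x a0 < e \<Longrightarrow> cdf N x < y"
      by (auto simp: eventually_at)
    have "cdf N (a0 + e / 2) < y" using e by (intro e(2)) (auto simp: dist_real_def)
    then have "\<forall>\<^sub>F n in sequentially. cdf (D n) (a0 + e / 2) < y"
      by (rule order_tendstoD(2)[OF lim])
    moreover have "\<forall>\<^sub>F n in sequentially. a n < a0 + e / 2"
      using e(1) by (intro order_tendstoD(2)[OF a]) simp
    ultimately show "\<forall>\<^sub>F n in sequentially. cdf (D n) (a n) < y"
      by eventually_elim (use D.cdf_nondecreasing in \<open>meson le_less_trans less_imp_le\<close>)
  qed
  then show ?thesis by (simp add: cdf_def)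
qed

lemma std_normal_atom: "measure std_normal_distribution {x} = 0"
proof -
  have "emeasure std_normal_distribution {x} = (\<integral>\<^sup>+ y. ennreal (std_normal_density y) * indicator {x} y \<partial>lborel)"
    by (rule emeasure_density) simp_all
  also have "\<dots> = 0"
    by (subst nn_integral_indicator_singleton) simp_all
  finally show ?thesis by (simp add: measure_def)
qed

lemma std_normal_cdf_minus: "measure std_normal_distribution {..- \<alpha>} = Psi \<alpha>"
proof -
  interpret N: real_distribution std_normal_distribution by (rule real_dist_normal_dist)
  have "measure std_normal_distribution {..- \<alpha>} = (LINT x|std_normal_distribution. indicator {..- \<alpha>} x)"
    by simp
  also have "\<dots> = (LINT x|lborel. std_normal_density x *\<^sub>R indicator {..- \<alpha>} x)"
    by (rule integral_density) simp_all
  also have "\<dots> = (LINT x:{..- \<alpha>}|lborel. std_normal_density (- x))"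
    unfolding set_lebesgue_integral_def by (simp add: std_normal_density_def mult.commute)
  also have "\<dots> = (LINT x:{x. - x \<in> {\<alpha>..}}|lborel. std_normal_density (- x))"
    by (rule arg_cong[where f = "\<lambda>A. LINT x:A|lborel. std_normal_density (- x)"]) auto
  also have "\<dots> = Psi \<alpha>"
    unfolding Psi_def by (rule set_integral_reflect[symmetric])
  finally show ?thesis .
qed

section \<open>Mean and variance of the surprisals\<close>

lemma (in prob_space) second_moment_sum_indep:
  fixes X :: "'i \<Rightarrow> 'a \<Rightarrow> real"
  assumes "finite I" "indep_vars (\<lambda>_. borel) X I"
    and "\<And>i. i \<in> I \<Longrightarrow> integrable M (X i)" "\<And>i. i \<in> I \<Longrightarrow> expectation (X i) = 0"
    and "\<And>i. i \<in> I \<Longrightarrow> integrable M (\<lambda>\<omega>. (X i \<omega>)\<^sup>2)"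
  shows "integrable M (\<lambda>\<omega>. (\<Sum>i\<in>I. X i \<omega>)\<^sup>2)
       \<and> expectation (\<lambda>\<omega>. (\<Sum>i\<in>I. X i \<omega>)\<^sup>2) = (\<Sum>i\<in>I. expectation (\<lambda>\<omega>. (X i \<omega>)\<^sup>2))"
  using assms
proof (induction I rule: finite_induct)
  case (insert i I)
  let ?S = "\<lambda>\<omega>. \<Sum>i\<in>I. X i \<omega>"
  have IH: "integrable M (\<lambda>\<omega>. (?S \<omega>)\<^sup>2)"
    "expectation (\<lambda>\<omega>. (?S \<omega>)\<^sup>2) = (\<Sum>i\<in>I. expectation (\<lambda>\<omega>. (X i \<omega>)\<^sup>2))"
    using insert.IH[OF indep_vars_subset[OF insert.prems(1)]] insert.prems by auto
  have ind: "indep_var borel (X i) borel ?S"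
    using insert by (intro indep_vars_sum) auto
  have int: "integrable M (X i)" "integrable M ?S"
    using insert.prems by auto
  have prod: "integrable M (\<lambda>\<omega>. X i \<omega> * ?S \<omega>)" "expectation (\<lambda>\<omega>. X i \<omega> * ?S \<omega>) = 0"
    using indep_var_integrable[OF ind int] indep_var_lebesgue_integral[OF ind int] insert.prems(3)[of i] by auto
  have sq: "integrable M (\<lambda>\<omega>. (X i \<omega>)\<^sup>2)" using insert.prems by auto
  have eq: "(\<lambda>\<omega>. (\<Sum>i\<in>insert i I. X i \<omega>)\<^sup>2) = (\<lambda>\<omega>. (X i \<omega>)\<^sup>2 + (2 * (X i \<omega> * ?S \<omega>) + (?S \<omega>)\<^sup>2))"
    using insert.hyps by (simp add: fun_eq_iff power2_sum)
  show ?case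
    unfolding eq using sq prod IH insert.hyps by simp
qed simp

text \<open>
  The logarithm of the Gaussian density at a Gaussian point is a constant minus half a squared
  standard Gaussian, and the square has variance \<open>2\<close>.
\<close>

lemma gaussian_log_variance:
  "gaussian_log_moment 2 - (gaussian_log_moment 1)\<^sup>2 = 1 / 2"
proof -
  define a where "a = ln (2 * pi) / 2"
  have ln_eq: "ln (std_normal_density y) = - a - y\<^sup>2 / 2" for y
  proof -
    have "ln (1 / sqrt (2 * pi)) = - a"
      by (simp add: a_def ln_div ln_sqrt)
    moreover have "ln (1 / sqrt (2 * pi) * exp (- y\<^sup>2 / 2)) = ln (1 / sqrt (2 * pi)) + ln (exp (- y\<^sup>2 / 2))"
      by (rule ln_mult_pos) simp_all
    ultimately show ?thesis by (simp add: std_normal_density_def)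
  qed
  have m0: "has_bochner_integral lborel std_normal_density 1"
    using std_normal_moment_even[of 0] by simp
  have m2: "has_bochner_integral lborel (\<lambda>y. std_normal_density y * y\<^sup>2) 1"
    using std_normal_moment_even[of 1] by (simp add: fact_numeral)
  have m4: "has_bochner_integral lborel (\<lambda>y. std_normal_density y * y ^ 4) 3"
    using std_normal_moment_even[of 2] by (simp add: fact_numeral)
  have "has_bochner_integral lborel (\<lambda>y. - a * std_normal_density y + (- 1/2) * (std_normal_density y * y\<^sup>2))
      (- a * 1 + (- 1/2) * 1)"
    by (intro has_bochner_integral_add has_bochner_integral_mult_right m0 m2)
  also have "(\<lambda>y. - a * std_normal_density y + (- 1/2) * (std_normal_density y * y\<^sup>2))
      = (\<lambda>y. std_normal_density y * ln (std_normal_density y) ^ 1)"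
    by (simp add: fun_eq_iff ln_eq algebra_simps)
  finally have 1: "gaussian_log_moment 1 = - a - 1/2"
    unfolding gaussian_log_moment_def by (simp add: has_bochner_integral_integral_eq)
  have "has_bochner_integral lborel (\<lambda>y. a\<^sup>2 * std_normal_density y + (a * (std_normal_density y * y\<^sup>2)
      + (1/4) * (std_normal_density y * y ^ 4))) (a\<^sup>2 * 1 + (a * 1 + (1/4) * 3))"
    by (intro has_bochner_integral_add has_bochner_integral_mult_right m0 m2 m4)
  also have "(\<lambda>y. a\<^sup>2 * std_normal_density y + (a * (std_normal_density y * y\<^sup>2)
      + (1/4) * (std_normal_density y * y ^ 4))) = (\<lambda>y. std_normal_density y * ln (std_normal_density y) ^ 2)"
    by (simp add: fun_eq_iff ln_eq algebra_simps power2_eq_square eval_nat_numeral)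
  finally have 2: "gaussian_log_moment 2 = a\<^sup>2 + a + 3/4"
    unfolding gaussian_log_moment_def by (simp add: has_bochner_integral_integral_eq)
  show ?thesis
    unfolding 1 2 by (simp add: power2_eq_square algebra_simps)
qed

abbreviation walk_entropy :: "walk_kind \<Rightarrow> real \<Rightarrow> real" where
  "walk_entropy w \<equiv> lattice_entropy (drift w)"

definition surprisal_var :: "walk_kind \<Rightarrow> real \<Rightarrow> real" where
  "surprisal_var w s = log_moment (drift w) s 2 - (log_moment (drift w) s 1)\<^sup>2"

lemma surprisal_var_tendsto:
  assumes "filterlim S at_top sequentially"
  shows "(\<lambda>n. surprisal_var w (S n)) \<longlonglongrightarrow> 1 / 2"
  unfolding surprisal_var_def gaussian_log_variance[symmetric]
  by (intro tendsto_diff tendsto_power log_moment_tendsto abs_drift_le lattice_mass_nonneg assms) simp_all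

lemma entropy_eq_integral:
  "0 \<le> s \<Longrightarrow> walk_entropy w s = (LINT x|mass_law w s. - ln (lattice_mass (drift w) s x))"
  by (simp add: integral_mass_law lattice_entropy_def abs_drift_le lattice_mass_nonneg)

definition scaled_log :: "walk_kind \<Rightarrow> real \<Rightarrow> int \<Rightarrow> real" where
  "scaled_log w s x = ln (sqrt s * lattice_mass (drift w) s x)"

lemma
  assumes "1 \<le> s" "j \<le> 4"
  shows integrable_scaled_log: "integrable (mass_law w s) (\<lambda>x. scaled_log w s x ^ j)"
    and integral_scaled_log: "(LINT x|mass_law w s. scaled_log w s x ^ j) = log_moment (drift w) s j"
proof -
  have s: "0 \<le> s" using assms by simp
  show "integrable (mass_law w s) (\<lambda>x. scaled_log w s x ^ j)"
    unfolding integrable_mass_law[OF s] scaled_log_def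
    by (rule integrable_log_moment[OF abs_drift_le lattice_mass_nonneg assms])
  show "(LINT x|mass_law w s. scaled_log w s x ^ j) = log_moment (drift w) s j"
    unfolding integral_mass_law[OF s] scaled_log_def log_moment_def ..
qed

text \<open>
  The surprisal is a constant minus \<open>scaled_log\<close>, so all its centred moments are those of \<open>scaled_log\<close>.
\<close>

lemma AE_surprisal_eq:
  assumes "1 \<le> s"
  shows "AE x in mass_law w s. - ln (lattice_mass (drift w) s x) = ln s / 2 - scaled_log w s x"
proof -
  have "AE x in mass_law w s. 0 < lattice_mass (drift w) s x"
    using assms by (intro AE_lattice_mass_pos) simp
  then show ?thesis
    by eventually_elim (use assms in \<open>simp add: scaled_log_def ln_mult ln_sqrt\<close>)
qed

lemma entropy_eq_log_moment:
  assumes "1 \<le> s"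
  shows "walk_entropy w s = ln s / 2 - log_moment (drift w) s 1"
proof -
  interpret prob_space "mass_law w s" by (rule prob_space_mass_law) (use assms in simp)
  have prob_UNIV: "prob UNIV = 1" using prob_space by simp
  have "walk_entropy w s = (LINT x|mass_law w s. ln s / 2 - scaled_log w s x)"
    unfolding entropy_eq_integral[OF order_trans[OF zero_le_one assms]]
    by (rule integral_cong_AE[OF _ _ AE_surprisal_eq[OF assms]])
       (simp_all add: mass_law_def)
  also have "\<dots> = ln s / 2 - log_moment (drift w) s 1"
    using integrable_scaled_log[OF assms, of 1 w] integral_scaled_log[OF assms, of 1 w]
    by (subst Bochner_Integration.integral_diff) (simp_all add: prob_UNIV)
  finally show ?thesis .
qed

text \<open>
  The common law of the centred surprisals of the coordinates.
\<close>

definition surprisal_law :: "walk_kind \<Rightarrow> real \<Rightarrow> real measure" where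
  "surprisal_law w s = distr (mass_law w s) borel (\<lambda>x. - ln (lattice_mass (drift w) s x) - walk_entropy w s)"

lemma measurable_mass_law_borel [measurable]: "F \<in> measurable (mass_law w s) borel"
  by (simp add: mass_law_def)

lemma real_distribution_surprisal_law:
  "0 \<le> s \<Longrightarrow> real_distribution (surprisal_law w s)"
  unfolding surprisal_law_def
  by (rule prob_space.real_distribution_distr[OF prob_space_mass_law]) simp_all

lemma
  fixes G :: "real \<Rightarrow> real"
  assumes s: "1 \<le> s" and [measurable]: "G \<in> borel_measurable borel"
  shows integral_surprisal_law: "(LINT y|surprisal_law w s. G y)
      = (LINT x|mass_law w s. G (log_moment (drift w) s 1 - scaled_log w s x))"
    and integrable_surprisal_law: "integrable (surprisal_law w s) G
      \<longleftrightarrow> integrable (mass_law w s) (\<lambda>x. G (log_moment (drift w) s 1 - scaled_log w s x))"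
proof -
  have AE: "AE x in mass_law w s. G (- ln (lattice_mass (drift w) s x) - walk_entropy w s)
      = G (log_moment (drift w) s 1 - scaled_log w s x)"
    using AE_surprisal_eq[OF s, of w]
  proof eventually_elim
    fix x assume "- ln (lattice_mass (drift w) s x) = ln s / 2 - scaled_log w s x"
    then have "- ln (lattice_mass (drift w) s x) - walk_entropy w s = log_moment (drift w) s 1 - scaled_log w s x"
      by (simp only: entropy_eq_log_moment[OF s])
    then show "G (- ln (lattice_mass (drift w) s x) - walk_entropy w s)
      = G (log_moment (drift w) s 1 - scaled_log w s x)"
      by (simp only:)
  qed
  have "(LINT y|surprisal_law w s. G y)
      = (LINT x|mass_law w s. G (- ln (lattice_mass (drift w) s x) - walk_entropy w s))"
    unfolding surprisal_law_def by (rule integral_distr) simp_all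
  also have "\<dots> = (LINT x|mass_law w s. G (log_moment (drift w) s 1 - scaled_log w s x))"
    by (rule integral_cong_AE[OF _ _ AE]) simp_all
  finally show "(LINT y|surprisal_law w s. G y)
      = (LINT x|mass_law w s. G (log_moment (drift w) s 1 - scaled_log w s x))" .
  have "integrable (surprisal_law w s) G
      \<longleftrightarrow> integrable (mass_law w s) (\<lambda>x. G (- ln (lattice_mass (drift w) s x) - walk_entropy w s))"
    unfolding surprisal_law_def by (rule integrable_distr_eq) simp_all
  also have "\<dots> \<longleftrightarrow> integrable (mass_law w s) (\<lambda>x. G (log_moment (drift w) s 1 - scaled_log w s x))"
    by (rule integrable_cong_AE[OF _ _ AE]) simp_all
  finally show "integrable (surprisal_law w s) G
      \<longleftrightarrow> integrable (mass_law w s) (\<lambda>x. G (log_moment (drift w) s 1 - scaled_log w s x))" .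
qed

lemma
  assumes s: "1 \<le> s"
  shows surprisal_law_integrable: "integrable (surprisal_law w s) (\<lambda>x. x)"
    and surprisal_law_mean: "(LINT x|surprisal_law w s. x) = 0"
    and surprisal_law_square_integrable: "integrable (surprisal_law w s) (\<lambda>x. x\<^sup>2)"
    and surprisal_law_square: "(LINT x|surprisal_law w s. x\<^sup>2) = surprisal_var w s"
    and surprisal_law_cube_integrable: "integrable (surprisal_law w s) (\<lambda>x. \<bar>x\<bar> ^ 3)"
    and surprisal_law_cube: "(LINT x|surprisal_law w s. \<bar>x\<bar> ^ 3)
      \<le> 1 + 8 * (log_moment (drift w) s 4 + log_moment (drift w) s 1 ^ 4)"
proof -
  interpret prob_space "mass_law w s" by (rule prob_space_mass_law) (use s in simp)
  have prob_UNIV: "prob UNIV = 1" using prob_space by simp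
  let ?m = "log_moment (drift w) s 1"
  let ?L = "scaled_log w s"
  have L: "integrable (mass_law w s) ?L" "(LINT x|mass_law w s. ?L x) = ?m"
    using integrable_scaled_log[OF s, of 1 w] integral_scaled_log[OF s, of 1 w] by simp_all
  have L2: "integrable (mass_law w s) (\<lambda>x. (?L x)\<^sup>2)" "(LINT x|mass_law w s. (?L x)\<^sup>2) = log_moment (drift w) s 2"
    using integrable_scaled_log[OF s, of 2 w] integral_scaled_log[OF s, of 2 w] by simp_all
  have L4: "integrable (mass_law w s) (\<lambda>x. ?L x ^ 4)" "(LINT x|mass_law w s. ?L x ^ 4) = log_moment (drift w) s 4"
    using integrable_scaled_log[OF s, of 4 w] integral_scaled_log[OF s, of 4 w] by simp_all
  show "integrable (surprisal_law w s) (\<lambda>x. x)"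
    by (subst integrable_surprisal_law[OF s]) (simp_all add: L)
  show "(LINT x|surprisal_law w s. x) = 0"
    by (subst integral_surprisal_law[OF s]) (simp_all add: L prob_UNIV)
  have sq: "(\<lambda>x. (?m - ?L x)\<^sup>2) = (\<lambda>x. ?m\<^sup>2 + ((?L x)\<^sup>2 - (2 * ?m) * ?L x))"
    by (simp add: fun_eq_iff power2_diff)
  show "integrable (surprisal_law w s) (\<lambda>x. x\<^sup>2)"
    by (subst integrable_surprisal_law[OF s], simp, unfold sq) (simp add: L L2)
  have "(LINT x|surprisal_law w s. x\<^sup>2) = (LINT x|mass_law w s. ?m\<^sup>2 + ((?L x)\<^sup>2 - (2 * ?m) * ?L x))"
    by (subst integral_surprisal_law[OF s], simp, unfold sq) simp
  also have "\<dots> = ?m\<^sup>2 + (log_moment (drift w) s 2 - 2 * ?m * ?m)"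
    using L L2 by (simp add: prob_UNIV)
  finally show "(LINT x|surprisal_law w s. x\<^sup>2) = surprisal_var w s"
    by (simp add: surprisal_var_def power2_eq_square)
  have cube: "\<bar>?m - ?L x\<bar> ^ 3 \<le> 1 + 8 * (?L x ^ 4 + ?m ^ 4)" for x
  proof -
    define y where "y = \<bar>?m - ?L x\<bar>"
    have y0: "0 \<le> y" by (simp add: y_def)
    have "y ^ 3 \<le> 1 + y ^ 4"
    proof (cases "y \<le> 1")
      case True
      then have "y ^ 3 \<le> 1" using y0 by (intro power_le_one)
      then show ?thesis using y0 by (simp add: add_increasing2)
    next
      case False
      then have "y ^ 3 \<le> y ^ 4" by (intro power_increasing) auto
      then show ?thesis by simp
    qed
    moreover have "y ^ 4 \<le> 8 * (?L x ^ 4 + ?m ^ 4)"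
    proof -
      have sq: "(a - b)\<^sup>2 \<le> 2 * (a\<^sup>2 + b\<^sup>2)" for a b :: real
        using zero_le_power2[of "a + b"] by (simp add: power2_eq_square algebra_simps)
      have sq': "(a + b)\<^sup>2 \<le> 2 * (a\<^sup>2 + b\<^sup>2)" for a b :: real
        using zero_le_power2[of "a - b"] by (simp add: power2_eq_square algebra_simps)
      have "y ^ 4 = ((?m - ?L x)\<^sup>2)\<^sup>2"
        by (simp add: y_def power_even_abs)
      also have "\<dots> \<le> (2 * (?m\<^sup>2 + (?L x)\<^sup>2))\<^sup>2"
        by (intro power_mono sq) simp
      also have "\<dots> = 4 * (?m\<^sup>2 + (?L x)\<^sup>2)\<^sup>2" by (subst power_mult_distrib) simp
      also have "\<dots> \<le> 4 * (2 * ((?m\<^sup>2)\<^sup>2 + ((?L x)\<^sup>2)\<^sup>2))"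
        by (intro mult_left_mono sq') simp
      finally show ?thesis by simp
    qed
    ultimately show ?thesis unfolding y_def by linarith
  qed
  have bound_int: "integrable (mass_law w s) (\<lambda>x. 1 + 8 * (?L x ^ 4 + ?m ^ 4))"
    using L4 by simp
  have cube_int: "integrable (mass_law w s) (\<lambda>x. \<bar>?m - ?L x\<bar> ^ 3)"
  proof (rule Bochner_Integration.integrable_bound[OF bound_int])
    show "AE x in mass_law w s. norm (\<bar>?m - ?L x\<bar> ^ 3) \<le> norm (1 + 8 * (?L x ^ 4 + ?m ^ 4))"
      using cube by (intro AE_I2) (simp add: order_trans[OF cube abs_ge_self])
  qed simp
  show "integrable (surprisal_law w s) (\<lambda>x. \<bar>x\<bar> ^ 3)"
    using cube_int by (subst integrable_surprisal_law[OF s]) simp_all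
  have "(LINT x|surprisal_law w s. \<bar>x\<bar> ^ 3) = (LINT x|mass_law w s. \<bar>?m - ?L x\<bar> ^ 3)"
    by (subst integral_surprisal_law[OF s]) simp_all
  also have "\<dots> \<le> (LINT x|mass_law w s. 1 + 8 * (?L x ^ 4 + ?m ^ 4))"
    by (rule integral_mono[OF cube_int bound_int cube])
  also have "\<dots> = 1 + 8 * (log_moment (drift w) s 4 + ?m ^ 4)"
    using L4 by (simp add: prob_UNIV)
  finally show "(LINT x|surprisal_law w s. \<bar>x\<bar> ^ 3) \<le> 1 + 8 * (log_moment (drift w) s 4 + ?m ^ 4)" .
qed

lemma
  assumes k: "0 < k" and t: "0 \<le> t" and i: "i < k"
  shows Q_coord_expectation: "(LINT \<omega>|walk_space w k. Q_coord w k i t \<omega>) = walk_entropy w (t / real k)"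
    and distr_Q_coord: "distr (walk_space w k) borel (\<lambda>\<omega>. Q_coord w k i t \<omega> - walk_entropy w (t / real k))
      = surprisal_law w (t / real k)"
proof -
  have s: "0 \<le> t / real k" using t by simp
  show "(LINT \<omega>|walk_space w k. Q_coord w k i t \<omega>) = walk_entropy w (t / real k)"
    unfolding Q_coord_eq[OF k t] entropy_eq_integral[OF s]
    by (rule integral_walk_coord[OF k t i])
  have "distr (walk_space w k) borel (\<lambda>\<omega>. Q_coord w k i t \<omega> - walk_entropy w (t / real k))
      = distr (distr (walk_space w k) (count_space UNIV) (\<lambda>\<omega>. walk k t \<omega> i)) borel
          (\<lambda>x. - ln (lattice_mass (drift w) (t / real k) x) - walk_entropy w (t / real k))"
    unfolding Q_coord_eq[OF k t]
    by (subst distr_distr) (simp_all add: measurable_walk_coord i comp_def)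
  then show "distr (walk_space w k) borel (\<lambda>\<omega>. Q_coord w k i t \<omega> - walk_entropy w (t / real k))
      = surprisal_law w (t / real k)"
    unfolding distr_walk_coord[OF k t i] surprisal_law_def .
qed

lemma indep_surprisals:
  assumes k: "0 < k" and t: "0 \<le> t"
  shows "prob_space.indep_vars (walk_space w k) (\<lambda>_. borel)
    (\<lambda>i \<omega>. Q_coord w k i t \<omega> - walk_entropy w (t / real k)) {..<k}"
  unfolding Q_coord_eq[OF k t]
  by (rule prob_space.indep_vars_compose2[OF prob_space_walk_space indep_walk_coords[OF k t],
        where Y = "\<lambda>_ x. - ln (lattice_mass (drift w) (t / real k) x) - walk_entropy w (t / real k)"]) simp

lemma
  fixes G :: "real \<Rightarrow> real"
  assumes k: "0 < k" and t: "0 \<le> t" and i: "i < k" and G: "G \<in> borel_measurable borel"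
  shows integral_surprisal: "(LINT \<omega>|walk_space w k. G (Q_coord w k i t \<omega> - walk_entropy w (t / real k)))
      = (LINT y|surprisal_law w (t / real k). G y)"
    and integrable_surprisal: "integrable (walk_space w k) (\<lambda>\<omega>. G (Q_coord w k i t \<omega> - walk_entropy w (t / real k)))
      \<longleftrightarrow> integrable (surprisal_law w (t / real k)) G"
proof -
  have m: "(\<lambda>\<omega>. Q_coord w k i t \<omega> - walk_entropy w (t / real k)) \<in> borel_measurable (walk_space w k)"
    using Q_coord_measurable[OF k t i, of w] by simp
  show "(LINT \<omega>|walk_space w k. G (Q_coord w k i t \<omega> - walk_entropy w (t / real k)))
      = (LINT y|surprisal_law w (t / real k). G y)"
    unfolding distr_Q_coord[OF k t i, symmetric] by (rule integral_distr[OF m G, symmetric])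
  show "integrable (walk_space w k) (\<lambda>\<omega>. G (Q_coord w k i t \<omega> - walk_entropy w (t / real k)))
      \<longleftrightarrow> integrable (surprisal_law w (t / real k)) G"
    unfolding distr_Q_coord[OF k t i, symmetric] by (rule integrable_distr_eq[OF m G, symmetric])
qed

lemma Q_coord_variance:
  assumes k: "0 < k" and t: "0 \<le> t" and s: "1 \<le> t / real k"
  shows "prob_space.variance (walk_space w k) (Q_coord w k 0 t) = surprisal_var w (t / real k)"
  unfolding Q_coord_expectation[OF k t k] surprisal_law_square[OF s, symmetric]
  by (rule integral_surprisal[OF k t k]) simp

lemma Q_total_variance:
  assumes k: "0 < k" and t: "0 \<le> t" and s: "1 \<le> t / real k"
  shows "prob_space.variance (walk_space w k) (Q_total w k t) = real k * surprisal_var w (t / real k)"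
proof -
  interpret W: prob_space "walk_space w k" by (rule prob_space_walk_space)
  let ?h = "walk_entropy w (t / real k)"
  let ?X = "\<lambda>i \<omega>. Q_coord w k i t \<omega> - ?h"
  have int: "integrable (walk_space w k) (?X i)" "(LINT \<omega>|walk_space w k. ?X i \<omega>) = 0" if "i < k" for i
    by (rule integrable_surprisal[OF k t that measurable_ident_sets[OF refl], THEN iffD2,
              OF surprisal_law_integrable[OF s]],
        rule trans[OF integral_surprisal[OF k t that measurable_ident_sets[OF refl]] surprisal_law_mean[OF s]])
  have sq_meas: "(\<lambda>y::real. y\<^sup>2) \<in> borel_measurable borel" by simp
  have sq: "integrable (walk_space w k) (\<lambda>\<omega>. (?X i \<omega>)\<^sup>2)"
    "(LINT \<omega>|walk_space w k. (?X i \<omega>)\<^sup>2) = surprisal_var w (t / real k)" if "i < k" for i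
    by (rule integrable_surprisal[OF k t that sq_meas, THEN iffD2, OF surprisal_law_square_integrable[OF s]],
        rule trans[OF integral_surprisal[OF k t that sq_meas] surprisal_law_square[OF s]])
  have AE: "AE \<omega> in walk_space w k. Q_total w k t \<omega> = real k * ?h + (\<Sum>i<k. ?X i \<omega>)"
    using Q_total_eq_sum[OF k t, of w] by eventually_elim (simp add: sum_subtractf)
  have Q_meas: "Q_total w k t \<in> borel_measurable (walk_space w k)" by (rule Q_total_measurable[OF k t])
  have S_meas: "(\<lambda>\<omega>. \<Sum>i<k. ?X i \<omega>) \<in> borel_measurable (walk_space w k)"
    by (intro borel_measurable_sum borel_measurable_diff Q_coord_measurable[OF k t] borel_measurable_const)
       (simp only: lessThan_iff)
  have "(LINT \<omega>|walk_space w k. Q_total w k t \<omega>) = (LINT \<omega>|walk_space w k. real k * ?h + (\<Sum>i<k. ?X i \<omega>))"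
    by (rule integral_cong_AE[OF Q_meas _ AE]) (use S_meas in simp)
  also have "\<dots> = real k * ?h"
  proof -
    have "integrable (walk_space w k) (\<lambda>\<omega>. \<Sum>i<k. ?X i \<omega>)" "(LINT \<omega>|walk_space w k. (\<Sum>i<k. ?X i \<omega>)) = 0"
    proof -
      show "integrable (walk_space w k) (\<lambda>\<omega>. \<Sum>i<k. ?X i \<omega>)"
        by (rule Bochner_Integration.integrable_sum) (simp only: lessThan_iff int)
      have "(LINT \<omega>|walk_space w k. (\<Sum>i<k. ?X i \<omega>)) = (\<Sum>i<k. (LINT \<omega>|walk_space w k. ?X i \<omega>))"
        by (rule Bochner_Integration.integral_sum) (simp only: lessThan_iff int)
      also have "\<dots> = 0"
        by (intro sum.neutral ballI int(2)) (simp only: lessThan_iff)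
      finally show "(LINT \<omega>|walk_space w k. (\<Sum>i<k. ?X i \<omega>)) = 0" .
    qed
    moreover have "(LINT \<omega>|walk_space w k. real k * ?h + (\<Sum>i<k. ?X i \<omega>))
        = (LINT \<omega>|walk_space w k. real k * ?h) + (LINT \<omega>|walk_space w k. (\<Sum>i<k. ?X i \<omega>))"
      by (rule Bochner_Integration.integral_add) (simp_all only: W.integrable_const calculation)
    moreover have "(LINT \<omega>|walk_space w k. real k * ?h) = real k * ?h"
      using W.prob_space by simp
    ultimately show ?thesis by simp
  qed
  finally have mean: "(LINT \<omega>|walk_space w k. Q_total w k t \<omega>) = real k * ?h" .
  have "prob_space.variance (walk_space w k) (Q_total w k t)
      = (LINT \<omega>|walk_space w k. (\<Sum>i<k. ?X i \<omega>)\<^sup>2)"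
    unfolding mean
  proof (rule integral_cong_AE)
    show "AE \<omega> in walk_space w k. (Q_total w k t \<omega> - real k * ?h)\<^sup>2 = (\<Sum>i<k. ?X i \<omega>)\<^sup>2"
      using AE by eventually_elim simp
  qed (use Q_meas S_meas in simp_all)
  also have "\<dots> = (\<Sum>i<k. (LINT \<omega>|walk_space w k. (?X i \<omega>)\<^sup>2))"
    by (rule conjunct2[OF W.second_moment_sum_indep[OF _ indep_surprisals[OF k t]]]) (use int sq in simp_all)
  also have "\<dots> = real k * surprisal_var w (t / real k)"
    using sq by simp
  finally show ?thesis .
qed

lemma entropy_at_top:
  assumes "filterlim S at_top sequentially"
  shows "filterlim (\<lambda>n. walk_entropy w (S n)) at_top sequentially"
proof -
  have "filterlim (\<lambda>n. - log_moment (drift w) (S n) 1 + ln (S n) / 2) at_top sequentially"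
  proof (rule filterlim_tendsto_add_at_top)
    show "(\<lambda>n. - log_moment (drift w) (S n) 1) \<longlonglongrightarrow> - gaussian_log_moment 1"
      by (intro tendsto_minus log_moment_tendsto abs_drift_le lattice_mass_nonneg assms) simp_all
    have "filterlim (\<lambda>n. 1 / 2 * ln (S n)) at_top sequentially"
      by (rule filterlim_tendsto_pos_mult_at_top[OF tendsto_const _ filterlim_compose[OF ln_at_top assms]]) simp
    then show "filterlim (\<lambda>n. ln (S n) / 2) at_top sequentially" by simp
  qed
  then show ?thesis
  proof (rule filterlim_cong[OF refl refl, THEN iffD1, rotated])
    show "\<forall>\<^sub>F n in sequentially. - log_moment (drift w) (S n) 1 + ln (S n) / 2 = walk_entropy w (S n)"
      using assms[unfolded filterlim_at_top, rule_format, of 1]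
      by eventually_elim (simp add: entropy_eq_log_moment)
  qed
qed

lemma entropy_continuous: "continuous_on {0..} (walk_entropy w)"
  by (intro lattice_entropy_continuous abs_drift_le lattice_mass_nonneg)

text \<open>
  A continuous function is bounded on compact sets, so large entropy forces large time, whichever
  solution \<open>entropy_time\<close> selects.
\<close>

lemma entropy_at_topD:
  assumes H: "filterlim (\<lambda>n. walk_entropy w (S n)) at_top sequentially"
    and S0: "\<forall>\<^sub>F n in sequentially. 0 \<le> S n"
  shows "filterlim S at_top sequentially"
  unfolding filterlim_at_top
proof
  fix Z :: real
  have "bounded (walk_entropy w ` {0..max 0 Z})"
    by (rule compact_imp_bounded[OF compact_continuous_image[OF
          continuous_on_subset[OF entropy_continuous] compact_Icc]]) simp
  then obtain B where B: "\<forall>x\<in>walk_entropy w ` {0..max 0 Z}. \<bar>x\<bar> \<le> B"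
    unfolding bounded_real by blast
  have "\<forall>\<^sub>F n in sequentially. B < walk_entropy w (S n)"
    using H unfolding filterlim_at_top_dense by blast
  with S0 show "\<forall>\<^sub>F n in sequentially. Z \<le> S n"
  proof eventually_elim
    fix n assume n: "0 \<le> S n" "B < walk_entropy w (S n)"
    show "Z \<le> S n"
    proof (rule ccontr)
      assume "\<not> Z \<le> S n"
      with n(1) have "S n \<in> {0..max 0 Z}" by simp
      then have "\<bar>walk_entropy w (S n)\<bar> \<le> B" using B by blast
      with n(2) show False by linarith
    qed
  qed
qed

text \<open>
  The entropy is continuous and tends to infinity, so the intermediate value theorem provides a
  solution for every value above the entropy at time \<open>0\<close>.
\<close>

lemma entropy_time:
  assumes k: "0 < k" and h: "walk_entropy w 0 \<le> h"
  shows "0 \<le> entropy_time w k h" "walk_entropy w (entropy_time w k h / real k) = h"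
proof -
  have "filterlim (\<lambda>n. walk_entropy w (real n)) at_top sequentially"
    by (rule entropy_at_top[OF filterlim_real_sequentially])
  then have "\<forall>\<^sub>F n in sequentially. h \<le> walk_entropy w (real n)"
    unfolding filterlim_at_top by blast
  then obtain n where "h \<le> walk_entropy w (real n)"
    by (auto simp: eventually_sequentially)
  then obtain s where s: "0 \<le> s" "walk_entropy w s = h"
    using IVT'[of "walk_entropy w" 0 h "real n", OF h]
      continuous_on_subset[OF entropy_continuous, of "{0..real n}" w] by auto
  let ?P = "\<lambda>t. 0 \<le> t \<and> prob_space.expectation (walk_space w k) (Q_coord w k 0 t) = h"
  have "?P (s * real k)"
    unfolding Q_coord_expectation[OF k mult_nonneg_nonneg[OF s(1) of_nat_0_le_iff] k]
    using s k by simp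
  then have "?P (entropy_time w k h)"
    unfolding entropy_time_def by (rule someI)
  then have P: "0 \<le> entropy_time w k h"
    "(LINT \<omega>|walk_space w k. Q_coord w k 0 (entropy_time w k h) \<omega>) = h"
    by blast+
  show "0 \<le> entropy_time w k h" by (rule P(1))
  show "walk_entropy w (entropy_time w k h / real k) = h"
    using P(2) unfolding Q_coord_expectation[OF k P(1) k] .
qed

section \<open>Convergence of the distribution of the total surprisal\<close>

lemma Q_total_clt_uniform:
  fixes k :: "nat \<Rightarrow> nat" and T S a :: "nat \<Rightarrow> real"
  assumes k: "filterlim k at_top sequentially" "\<And>n. 0 < k n" and T: "\<And>n. 0 \<le> T n"
    and S: "\<And>n. S n = T n / real (k n)" "filterlim S at_top sequentially" "\<And>n. 1 \<le> S n"
    and var: "\<And>n. 0 < surprisal_var w (S n)"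
    and cube: "\<And>n. 1 + 8 * (log_moment (drift w) (S n) 4 + log_moment (drift w) (S n) 1 ^ 4) \<le> B"
    and a: "a \<longlonglongrightarrow> a0"
  shows "(\<lambda>n. measure (walk_space w (k n)) {\<omega>. Q_total w (k n) (T n) \<omega>
            \<le> real (k n) * walk_entropy w (S n) + a n * sqrt (real (k n) * surprisal_var w (S n))})
         \<longlonglongrightarrow> measure std_normal_distribution {..a0}"
proof -
  let ?X = "\<lambda>n i \<omega>. Q_coord w (k n) i (T n) \<omega> - walk_entropy w (S n)"
  let ?r = "\<lambda>n. sqrt (real (k n) * surprisal_var w (S n))"
  let ?D = "\<lambda>n. distr (walk_space w (k n)) borel (\<lambda>\<omega>. (\<Sum>i<k n. ?X n i \<omega>) / ?r n)"
  have S0: "0 \<le> S n" for n using S(3)[of n] by linarith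
  have r: "0 < ?r n" for n using k(2) var by simp
  have Z_meas: "(\<lambda>\<omega>. (\<Sum>i<k n. ?X n i \<omega>) / ?r n) \<in> borel_measurable (walk_space w (k n))" for n
    by (intro borel_measurable_divide borel_measurable_sum borel_measurable_diff borel_measurable_const
        Q_coord_measurable[OF k(2) T]) (simp only: lessThan_iff)
  have conv: "weak_conv_m ?D std_normal_distribution"
  proof (rule clt_array[where \<mu> = "\<lambda>n. surprisal_law w (S n)" and B = B and ?v0.0 = "1 / 2"])
    show "prob_space (walk_space w (k n))" for n by (rule prob_space_walk_space)
    show "prob_space.indep_vars (walk_space w (k n)) (\<lambda>_. borel) (?X n) {..<k n}" for n
      using indep_surprisals[OF k(2)[of n] T[of n], where w = w] unfolding S(1)[symmetric] .
    show "distr (walk_space w (k n)) borel (?X n i) = surprisal_law w (S n)" if "i < k n" for n i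
      using distr_Q_coord[OF k(2)[of n] T[of n] that, where w = w] unfolding S(1)[symmetric] .
    show "real_distribution (surprisal_law w (S n))" for n by (rule real_distribution_surprisal_law[OF S0])
    show "(LINT x|surprisal_law w (S n). \<bar>x\<bar> ^ 3) \<le> B" for n
      by (rule order_trans[OF surprisal_law_cube[OF S(3)] cube])
    show "(\<lambda>n. surprisal_var w (S n)) \<longlonglongrightarrow> 1 / 2" by (rule surprisal_var_tendsto[OF S(2)])
  qed (simp_all only: surprisal_law_integrable[OF S(3)] surprisal_law_mean[OF S(3)] var k
      surprisal_law_square_integrable[OF S(3)] surprisal_law_square[OF S(3)]
      surprisal_law_cube_integrable[OF S(3)] half_gt_zero_iff zero_less_one)
  have "(\<lambda>n. measure (?D n) {..a n}) \<longlonglongrightarrow> measure std_normal_distribution {..a0}"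
    by (rule weak_conv_m_moving_threshold[OF conv _ real_dist_normal_dist std_normal_atom a])
       (rule prob_space.real_distribution_distr[OF prob_space_walk_space Z_meas])
  moreover have "measure (?D n) {..a n} = measure (walk_space w (k n)) {\<omega>. Q_total w (k n) (T n) \<omega>
            \<le> real (k n) * walk_entropy w (S n) + a n * ?r n}" for n
  proof -
    interpret W: prob_space "walk_space w (k n)" by (rule prob_space_walk_space)
    have "measure (?D n) {..a n} = W.prob {\<omega> \<in> space (walk_space w (k n)). (\<Sum>i<k n. ?X n i \<omega>) / ?r n \<le> a n}"
      by (subst measure_distr[OF Z_meas]) (auto intro!: arg_cong[where f = W.prob])
    also have "\<dots> = W.prob {\<omega> \<in> space (walk_space w (k n)). Q_total w (k n) (T n) \<omega>
            \<le> real (k n) * walk_entropy w (S n) + a n * ?r n}"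
    proof (rule W.prob_eq_AE)
      show "AE \<omega> in walk_space w (k n). ((\<Sum>i<k n. ?X n i \<omega>) / ?r n \<le> a n)
          = (Q_total w (k n) (T n) \<omega> \<le> real (k n) * walk_entropy w (S n) + a n * ?r n)"
        using Q_total_eq_sum[OF k(2)[of n] T[of n], where w = w]
      proof eventually_elim
        fix \<omega> assume Q: "Q_total w (k n) (T n) \<omega> = (\<Sum>i<k n. Q_coord w (k n) i (T n) \<omega>)"
        have sum: "(\<Sum>i<k n. ?X n i \<omega>) = (\<Sum>i<k n. Q_coord w (k n) i (T n) \<omega>) - real (k n) * walk_entropy w (S n)"
          by (simp add: sum_subtractf)
        show "((\<Sum>i<k n. ?X n i \<omega>) / ?r n \<le> a n)
          = (Q_total w (k n) (T n) \<omega> \<le> real (k n) * walk_entropy w (S n) + a n * ?r n)"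
          unfolding Q sum pos_divide_le_eq[OF r] by linarith
      qed
      have "Measurable.pred (walk_space w (k n)) (\<lambda>\<omega>. (\<Sum>i<k n. ?X n i \<omega>) / ?r n \<le> a n)"
        by (rule borel_measurable_le[OF Z_meas borel_measurable_const, unfolded pred_def[symmetric]])
      then show "{\<omega> \<in> space (walk_space w (k n)). (\<Sum>i<k n. ?X n i \<omega>) / ?r n \<le> a n} \<in> W.events"
        by (simp only: pred_def)
      show "{\<omega> \<in> space (walk_space w (k n)). Q_total w (k n) (T n) \<omega>
            \<le> real (k n) * walk_entropy w (S n) + a n * ?r n} \<in> W.events"
        by (rule borel_measurable_le[OF Q_total_measurable[OF k(2) T] borel_measurable_const])
    qed
    finally show ?thesis by (simp only: space_walk_space UNIV_I simp_thms)
  qed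
  ultimately show ?thesis by (simp only:)
qed

text \<open>
  The hypotheses of \<open>Q_total_clt_uniform\<close> hold from some index on, with a bound \<open>B\<close> read off from the
  limits of the moments; the sequences are shifted to start at that index.
\<close>

lemma Q_total_clt:
  fixes k :: "nat \<Rightarrow> nat" and T a :: "nat \<Rightarrow> real"
  defines "S \<equiv> \<lambda>n. T n / real (k n)"
  assumes k: "filterlim k at_top sequentially" and T: "\<forall>\<^sub>F n in sequentially. 0 \<le> T n"
    and S: "filterlim S at_top sequentially" and a: "a \<longlonglongrightarrow> a0"
  shows "(\<lambda>n. measure (walk_space w (k n)) {\<omega>. Q_total w (k n) (T n) \<omega>
            \<le> real (k n) * walk_entropy w (S n) + a n * sqrt (real (k n) * surprisal_var w (S n))})
         \<longlonglongrightarrow> measure std_normal_distribution {..a0}"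
proof -
  define B where "B = 1 + 8 * ((gaussian_log_moment 4 + 1) + (\<bar>gaussian_log_moment 1\<bar> + 1) ^ 4)"
  have lim: "(\<lambda>n. log_moment (drift w) (S n) j) \<longlonglongrightarrow> gaussian_log_moment j" if "j \<le> 4" for j
    by (rule log_moment_tendsto[OF abs_drift_le lattice_mass_nonneg S that])
  have "\<forall>\<^sub>F n in sequentially. 0 < k n"
    using k[unfolded filterlim_at_top, rule_format, of 1] by eventually_elim simp
  moreover have "\<forall>\<^sub>F n in sequentially. 1 \<le> S n"
    using S unfolding filterlim_at_top by blast
  moreover have "\<forall>\<^sub>F n in sequentially. 0 < surprisal_var w (S n)"
    by (rule order_tendstoD(1)[OF surprisal_var_tendsto[OF S]]) simp
  moreover have "\<forall>\<^sub>F n in sequentially.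
      1 + 8 * (log_moment (drift w) (S n) 4 + log_moment (drift w) (S n) 1 ^ 4) \<le> B"
  proof -
    have "\<forall>\<^sub>F n in sequentially. log_moment (drift w) (S n) 4 < gaussian_log_moment 4 + 1"
      by (rule order_tendstoD(2)[OF lim]) simp_all
    moreover have "\<forall>\<^sub>F n in sequentially. \<bar>log_moment (drift w) (S n) 1\<bar> < \<bar>gaussian_log_moment 1\<bar> + 1"
      by (rule order_tendstoD(2)[OF tendsto_rabs[OF lim]]) simp_all
    ultimately show ?thesis
    proof eventually_elim
      fix n assume 4: "log_moment (drift w) (S n) 4 < gaussian_log_moment 4 + 1"
        and 1: "\<bar>log_moment (drift w) (S n) 1\<bar> < \<bar>gaussian_log_moment 1\<bar> + 1"
      have "\<bar>log_moment (drift w) (S n) 1\<bar> ^ 4 \<le> (\<bar>gaussian_log_moment 1\<bar> + 1) ^ 4"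
        using 1 by (intro power_mono) linarith+
      then have "log_moment (drift w) (S n) 1 ^ 4 \<le> (\<bar>gaussian_log_moment 1\<bar> + 1) ^ 4"
        by (simp only: power_even_abs_numeral even_numeral)
      with 4 show "1 + 8 * (log_moment (drift w) (S n) 4 + log_moment (drift w) (S n) 1 ^ 4) \<le> B"
        unfolding B_def by (intro add_left_mono mult_left_mono add_mono less_imp_le) simp_all
    qed
  qed
  ultimately have "\<forall>\<^sub>F n in sequentially. 0 < k n \<and> 0 \<le> T n \<and> 1 \<le> S n \<and> 0 < surprisal_var w (S n) \<and>
      1 + 8 * (log_moment (drift w) (S n) 4 + log_moment (drift w) (S n) 1 ^ 4) \<le> B"
    using T by eventually_elim blast
  then obtain N where N: "\<And>n. N \<le> n \<Longrightarrow> 0 < k n \<and> 0 \<le> T n \<and> 1 \<le> S n \<and> 0 < surprisal_var w (S n) \<and>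
      1 + 8 * (log_moment (drift w) (S n) 4 + log_moment (drift w) (S n) 1 ^ 4) \<le> B"
    unfolding eventually_sequentially by blast
  have shift: "filterlim (\<lambda>n. n + N) at_top sequentially"
    by (rule filterlim_add_const_nat_at_top)
  show ?thesis
  proof (rule LIMSEQ_offset[where k = N], rule Q_total_clt_uniform[where B = B])
    show "filterlim (\<lambda>n. k (n + N)) at_top sequentially" by (rule filterlim_compose[OF k shift])
    show "filterlim (\<lambda>n. S (n + N)) at_top sequentially" by (rule filterlim_compose[OF S shift])
    show "(\<lambda>n. a (n + N)) \<longlonglongrightarrow> a0" by (rule filterlim_compose[OF a shift])
    show "S (n + N) = T (n + N) / real (k (n + N))" for n by (simp only: S_def)
  qed (use N in auto)
qed

theorem propositionA3:
  fixes w :: walk_kind and k :: "nat \<Rightarrow> nat" and \<alpha> :: real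
  assumes "(\<lambda>n. 1) \<in> o(\<lambda>n. real (k n))"
    and "(\<lambda>n. real (k n)) \<in> o(\<lambda>n. ln (real n))"
  shows "((\<lambda>n. \<P>(\<omega> in walk_space w (k n).
              Q_total w (k n) (t_alpha w (k n) n \<alpha>) \<omega> \<le> ln (real n) + window w (k n) n))
            \<longlonglongrightarrow> Psi \<alpha>)
       \<and> ((\<lambda>n. \<P>(\<omega> in walk_space w (k n).
              Q_total w (k n) (t_alpha w (k n) n \<alpha>) \<omega> \<le> ln (real n) - window w (k n) n))
            \<longlonglongrightarrow> Psi \<alpha>)"
proof -
  have k_real: "filterlim (\<lambda>n. real (k n)) at_top sequentially"
    unfolding filterlim_at_top
  proof
    fix Z :: real
    have "\<forall>\<^sub>F n in sequentially. norm (1 :: real) \<le> 1 / max 1 Z * norm (real (k n))"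
      by (rule landau_o.smallD[OF assms(1)]) simp
    then show "\<forall>\<^sub>F n in sequentially. Z \<le> real (k n)"
      by eventually_elim (simp add: field_simps)
  qed
  then have k_top: "filterlim k at_top sequentially"
    unfolding filterlim_at_top by (metis (mono_tags, lifting) eventually_mono of_nat_le_iff)
  have k_pos: "\<forall>\<^sub>F n in sequentially. 0 < k n"
    using k_top[unfolded filterlim_at_top, rule_format, of 1] by eventually_elim simp
  have H0: "filterlim (\<lambda>n. ln (real n) / real (k n)) at_top sequentially"
    unfolding filterlim_at_top
  proof
    fix Z :: real
    have "\<forall>\<^sub>F n in sequentially. norm (real (k n)) \<le> 1 / max 1 Z * norm (ln (real n))"
      by (rule landau_o.smallD[OF assms(2)]) simp
    then show "\<forall>\<^sub>F n in sequentially. Z \<le> ln (real n) / real (k n)"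
      using k_pos eventually_ge_at_top[of 1]
    proof eventually_elim
      fix n :: nat assume n: "norm (real (k n)) \<le> 1 / max 1 Z * norm (ln (real n))" "0 < k n" "1 \<le> n"
      then have "max 1 Z * real (k n) \<le> ln (real n)" by (simp add: field_simps)
      moreover have "Z * real (k n) \<le> max 1 Z * real (k n)" by (intro mult_right_mono) auto
      ultimately have "Z * real (k n) \<le> ln (real n)" by linarith
      then show "Z \<le> ln (real n) / real (k n)" using n(2) by (simp add: pos_le_divide_eq)
    qed
  qed
  have solve: "\<forall>\<^sub>F n in sequentially. 0 \<le> entropy_time w (k n) (H n)
        \<and> walk_entropy w (entropy_time w (k n) (H n) / real (k n)) = H n"
      "filterlim (\<lambda>n. entropy_time w (k n) (H n) / real (k n)) at_top sequentially"
    if H: "filterlim H at_top sequentially" for H :: "nat \<Rightarrow> real"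
  proof -
    have "\<forall>\<^sub>F n in sequentially. walk_entropy w 0 \<le> H n"
      using H unfolding filterlim_at_top by blast
    with k_pos show ev: "\<forall>\<^sub>F n in sequentially. 0 \<le> entropy_time w (k n) (H n)
        \<and> walk_entropy w (entropy_time w (k n) (H n) / real (k n)) = H n"
      by eventually_elim (blast intro: entropy_time)
    show "filterlim (\<lambda>n. entropy_time w (k n) (H n) / real (k n)) at_top sequentially"
    proof (rule entropy_at_topD)
      have "\<forall>\<^sub>F n in sequentially. walk_entropy w (entropy_time w (k n) (H n) / real (k n)) = H n"
        using ev by eventually_elim blast
      then show "filterlim (\<lambda>n. walk_entropy w (entropy_time w (k n) (H n) / real (k n))) at_top sequentially"
        by (rule filterlim_cong[OF refl refl, THEN iffD2]) (rule H)
      show "\<forall>\<^sub>F n in sequentially. 0 \<le> entropy_time w (k n) (H n) / real (k n)"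
        using ev by eventually_elim simp
    qed
  qed
  define S0 where "S0 n = t_zero w (k n) n / real (k n)" for n
  define v where "v n = surprisal_var w (S0 n)" for n
  have S0: "filterlim S0 at_top sequentially"
    using solve(2)[OF H0] unfolding S0_def t_zero_def .
  have v: "v \<longlonglongrightarrow> 1 / 2"
    unfolding v_def by (rule surprisal_var_tendsto[OF S0])
  have t0: "\<forall>\<^sub>F n in sequentially. 0 < k n \<and> 0 \<le> t_zero w (k n) n \<and> 1 \<le> t_zero w (k n) n / real (k n)"
    using k_pos solve(1)[OF H0] S0[unfolded filterlim_at_top, rule_format, of 1]
    by eventually_elim (simp only: t_zero_def S0_def simp_thms)
  have var: "\<forall>\<^sub>F n in sequentially. var_coord w (k n) n = v n"
    using t0 by eventually_elim (simp only: var_coord_def v_def S0_def Q_coord_variance)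
  have window: "\<forall>\<^sub>F n in sequentially. window w (k n) n = (real (k n) * v n) powr (1/4)"
    using t0 by eventually_elim (simp only: window_def v_def S0_def Q_total_variance)
  have inv_sqrt: "(\<lambda>n. 1 / sqrt (real (k n))) \<longlonglongrightarrow> 0"
    by (intro tendsto_divide_0[OF tendsto_const] filterlim_at_top_imp_at_infinity
        filterlim_compose[OF sqrt_at_top k_real])
  define H where "H n = (ln (real n) + \<alpha> * sqrt (var_coord w (k n) n * real (k n))) / real (k n)" for n
  have "filterlim (\<lambda>n. \<alpha> * sqrt (v n) * (1 / sqrt (real (k n))) + ln (real n) / real (k n)) at_top sequentially"
  proof (rule filterlim_tendsto_add_at_top[OF _ H0])
    show "(\<lambda>n. \<alpha> * sqrt (v n) * (1 / sqrt (real (k n)))) \<longlonglongrightarrow> \<alpha> * sqrt (1 / 2) * 0"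
      by (intro tendsto_mult tendsto_const tendsto_real_sqrt v inv_sqrt)
  qed
  then have H: "filterlim H at_top sequentially"
  proof (rule filterlim_cong[OF refl refl, THEN iffD1, rotated])
    show "\<forall>\<^sub>F n in sequentially. \<alpha> * sqrt (v n) * (1 / sqrt (real (k n))) + ln (real n) / real (k n) = H n"
      using var k_pos
    proof eventually_elim
      fix n assume n: "var_coord w (k n) n = v n" "0 < k n"
      have "1 / sqrt (real (k n)) = sqrt (real (k n)) / real (k n)"
        using n(2) by (simp add: divide_simps)
      then have "\<alpha> * sqrt (v n) * (1 / sqrt (real (k n)))
          = \<alpha> * sqrt (v n) * (sqrt (real (k n)) / real (k n))"
        by (rule arg_cong)
      also have "\<dots> = \<alpha> * sqrt (v n * real (k n)) / real (k n)"
        by (simp only: real_sqrt_mult times_divide_eq_right mult.assoc)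
      finally have "\<alpha> * sqrt (v n) * (1 / sqrt (real (k n))) = \<alpha> * sqrt (v n * real (k n)) / real (k n)" .
      then show "\<alpha> * sqrt (v n) * (1 / sqrt (real (k n))) + ln (real n) / real (k n) = H n"
        unfolding H_def n(1) by (simp add: add_divide_distrib)
    qed
  qed
  have t_alpha: "t_alpha w (k n) n \<alpha> = entropy_time w (k n) (H n)" for n
    by (simp only: t_alpha_def H_def)
  define S1 where "S1 n = t_alpha w (k n) n \<alpha> / real (k n)" for n
  define v1 where "v1 n = surprisal_var w (S1 n)" for n
  have S1: "filterlim S1 at_top sequentially"
    using solve(2)[OF H] unfolding S1_def t_alpha .
  have v1: "v1 \<longlonglongrightarrow> 1 / 2"
    unfolding v1_def by (rule surprisal_var_tendsto[OF S1])
  have main: "(\<lambda>n. \<P>(\<omega> in walk_space w (k n).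
      Q_total w (k n) (t_alpha w (k n) n \<alpha>) \<omega> \<le> ln (real n) + \<sigma> * window w (k n) n)) \<longlonglongrightarrow> Psi \<alpha>"
    for \<sigma> :: real
  proof -
    \<comment> \<open>The threshold \<open>ln n + \<sigma> window\<close> in units of the standard deviation of \<open>Q(t\<^sub>\<alpha>)\<close>, measured from its mean.\<close>
    define a where "a n = \<sigma> * (v n powr (1/4) * real (k n) powr (- (1/4)) / sqrt (v1 n))
      - \<alpha> * (sqrt (v n) / sqrt (v1 n))" for n
    have "a \<longlonglongrightarrow> \<sigma> * ((1/2) powr (1/4) * 0 / sqrt (1/2)) - \<alpha> * (sqrt (1/2) / sqrt (1/2))"
      unfolding a_def
      by (intro tendsto_intros v v1 tendsto_neg_powr k_real) simp_all
    then have a: "a \<longlonglongrightarrow> - \<alpha>" by simp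
    have "(\<lambda>n. measure (walk_space w (k n)) {\<omega>. Q_total w (k n) (t_alpha w (k n) n \<alpha>) \<omega>
        \<le> real (k n) * walk_entropy w (S1 n) + a n * sqrt (real (k n) * surprisal_var w (S1 n))})
        \<longlonglongrightarrow> measure std_normal_distribution {..- \<alpha>}"
      unfolding S1_def
    proof (rule Q_total_clt[OF k_top _ _ a])
      show "\<forall>\<^sub>F n in sequentially. 0 \<le> t_alpha w (k n) n \<alpha>"
        using solve(1)[OF H] by eventually_elim (simp only: t_alpha)
      show "filterlim (\<lambda>n. t_alpha w (k n) n \<alpha> / real (k n)) at_top sequentially"
        using S1 unfolding S1_def .
    qed
    moreover have "\<forall>\<^sub>F n in sequentially.
        measure (walk_space w (k n)) {\<omega>. Q_total w (k n) (t_alpha w (k n) n \<alpha>) \<omega>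
          \<le> real (k n) * walk_entropy w (S1 n) + a n * sqrt (real (k n) * surprisal_var w (S1 n))}
        = \<P>(\<omega> in walk_space w (k n).
            Q_total w (k n) (t_alpha w (k n) n \<alpha>) \<omega> \<le> ln (real n) + \<sigma> * window w (k n) n)"
      using k_pos var window solve(1)[OF H] order_tendstoD(1)[OF v, of 0, simplified]
        order_tendstoD(1)[OF v1, of 0, simplified]
    proof eventually_elim
      fix n
      assume n: "0 < k n" "var_coord w (k n) n = v n" "window w (k n) n = (real (k n) * v n) powr (1/4)"
        "0 \<le> entropy_time w (k n) (H n)
          \<and> walk_entropy w (entropy_time w (k n) (H n) / real (k n)) = H n"
        "0 < v n" "0 < v1 n"
      let ?k = "real (k n)"
      have k0: "0 < ?k" using n(1) by simp
      have "?k * walk_entropy w (S1 n) = ?k * H n"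
        using n(4) by (simp only: S1_def t_alpha)
      also have "\<dots> = ln (real n) + \<alpha> * sqrt (v n * ?k)"
        using k0 by (simp add: H_def n(2))
      finally have mean: "?k * walk_entropy w (S1 n) = ln (real n) + \<alpha> * sqrt (v n * ?k)" .
      have "?k powr (- (1/4)) * sqrt ?k = ?k powr (1/4)"
        using k0 by (simp add: powr_half_sqrt[symmetric] powr_add[symmetric])
      then have "v n powr (1/4) * ?k powr (- (1/4)) / sqrt (v1 n) * sqrt (?k * v1 n) = window w (k n) n"
        using k0 n(5,6) by (simp add: n(3) powr_mult real_sqrt_mult)
      moreover have "sqrt (v n) / sqrt (v1 n) * sqrt (?k * v1 n) = sqrt (v n * ?k)"
        using n(6) by (simp add: real_sqrt_mult)
      ultimately have "a n * sqrt (?k * v1 n) = \<sigma> * window w (k n) n - \<alpha> * sqrt (v n * ?k)"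
        unfolding a_def left_diff_distrib mult.assoc by (simp only:)
      then have "?k * walk_entropy w (S1 n) + a n * sqrt (?k * surprisal_var w (S1 n))
          = ln (real n) + \<sigma> * window w (k n) n"
        unfolding mean v1_def[symmetric] by linarith
      then show "measure (walk_space w (k n)) {\<omega>. Q_total w (k n) (t_alpha w (k n) n \<alpha>) \<omega>
          \<le> ?k * walk_entropy w (S1 n) + a n * sqrt (?k * surprisal_var w (S1 n))}
        = \<P>(\<omega> in walk_space w (k n).
            Q_total w (k n) (t_alpha w (k n) n \<alpha>) \<omega> \<le> ln (real n) + \<sigma> * window w (k n) n)"
        by (simp only: space_walk_space UNIV_I simp_thms)
    qed
    ultimately show ?thesis
      unfolding std_normal_cdf_minus by (rule Lim_transform_eventually)
  qed
  show ?thesis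
    using main[of 1] main[of "- 1"] by (simp only: mult_1 mult_minus_left diff_conv_add_uminus simp_thms)
qed

end
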